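(* Let $n\ge 2$ and $l\ge 1$ be integers, let $V$ be the irreducible highest weight representation of $U_q(sl_n)$ with highest weight $(nl,0,\dots,0)$, and let $I_1=\mathrm{Tr}_1[L_1]$ be the operator defined in the context (the trace being over the $n$-dimensional matrix representation), restricted to functions of the differences of $y_1,\dots,y_n$ with values in the (one-dimensional) zero weight subspace of $V$. Then the Hamiltonian $H=I_1$ reads $$H=I_1=\sum_{i=1}^n e^{p_i}\prod_{k<i}\bigl(1-[l][l+1]\,\xi(y_i-y_k)\bigr),\qquad p_i=2\frac{\partial}{\partial y_i},$$ where $$\xi(y)=\frac{(q-q^{-1})^2q^{y+1}}{(q^y-1)(q^{y+2}-1)}.$$
   Context: Fix $q\in\mathbb{C}^*$, not a root of unity, with a fixed choice of $\log q$ defining $q^y$, and put $[m]=(q^m-q^{-m})/(q-q^{-1})$, $[m]!=[1]\cdots[m]$. Identities between functions of $y=(y_1,\dots,y_n)$ are identities of meromorphic functions. **Algebra.** $U_q(sl_n)$ has generators $e_i,f_i,h_i$ ($1\le i\le n-1$) with relations $[h_i,h_j]=0$, $[h_i,e_j]=a_{ij}e_j$, $[h_i,f_j]=-a_{ij}f_j$, where $a_{ii}=2$, $a_{i,i\pm1}=-1$ and $a_{ij}=0$ otherwise, $[e_i,f_j]=\delta_{ij}\frac{q^{h_i}-q^{-h_i}}{q-q^{-1}}$, $[e_i,e_j]=[f_i,f_j]=0$ if $|i-j|>1$, and $e_i^2e_j+e_je_i^2=(q+q^{-1})e_ie_je_i$ if $|i-j|=1$, and the same for the $f$'s. Let $h^1,\dots,h^{n-1}$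 be the basis of the span of the $h_i$ dual to $h_1,\dots,h_{n-1}$ with respect to the invariant form $(h_i,h_j)=a_{ij}$ (in the matrix representation $h^i=\sum_{j\le i}E_{jj}-\frac{i}{n}\,\mathrm{Id}$). Root vectors: $e_{i,i+1}=e_i$, $f_{i,i+1}=f_i$, and for $i<k<j$, $e_{ij}=e_{ik}e_{kj}-q\,e_{kj}e_{ik}$, $f_{ij}=f_{kj}f_{ik}-q^{-1}f_{ik}f_{kj}$ (independent of $k$). The positive roots $(ij)$, $i<j$, are ordered lexicographically: $(12)<(13)<\dots<(1n)<(23)<\dots<(n-1,n)$. A product with superscript or subscript $>$ is ordered so that larger roots stand to the left. The Poincaré–Birkhoff–Witt elements are $e^p=\prod^>(e_{ij})^{p_{ij}}$, $f^p=\prod^>(f_{ij})^{p_{ij}}$. **Universal $R$-matrix.** $R_{12}=K\hat R_{12}$ with $K=q^{\sum_{j=1}^{n-1}h_j\otimes h^j}$ and $\hat R_{12}=\prod_{(ij),>}\exp_q\bigl((q-q^{-1})e_{ij}\otimes f_{ij}\bigr)$, $\exp_q(z)=\sum_{m\ge0}z^m/[m]!$. **Quasi-Hopf shift and dynamical $R$-matrix.** Put $x_j=y_{j+1}-y_j$ and $B=q^{\sum_{j=1}^{n-1}(h_jh^j-x_jh^j)}$; $B_a$ denotes $B$ acting in the $a$-th tensor factor. $F_{12}=F_{12}(y)$ is the solution of the linear equation $$\hat R_{12}F_{12}=B_2F_{12}B_2^{-1}$$ of the form $F_{12}=\sum_{p,r}e^p\otimes f^r\phi_{p,r}$, the sum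 being over pairs of Poincaré–Birkhoff–Witt elements $e^p,f^r$ of the same weight (up to sign), with term $1\otimes 1$ in weight zero. $F_{21}$ is obtained from $F_{12}$ by exchanging the two tensor factors. The dynamical $R$-matrix is $R_{12}(y)=F_{21}^{-1}(y)\,R_{12}\,F_{12}(y)$. **$L$-operator.** The first tensor factor is taken in the $n$-dimensional matrix representation, in which $e_{ij}$ is the matrix unit $E_{ij}$ and $f_{ij}$ is $E_{ji}$ for $i<j$, and $h_i=E_{ii}-E_{i+1,i+1}$; the second (quantum) factor is taken in $V$. Set $p_i=2\,\partial/\partial y_i$, define $\tilde p_i$ ($1\le i\le n-1$) by $q^{\tilde p_i}=e^{p_{i+1}-p_i}$, and write $H_ap=\sum_{i=1}^{n-1}h^i_{(a)}\tilde p_i$, where $h^i_{(a)}$ is $h^i$ acting in the $a$-th factor. Then $$L=q^{-(H_1+H_2/2)p}\,R_{12}(y)\,q^{H_2p/2},$$ acting on functions of the differences $y_i-y_j$ with values in the tensor product of the two representations. Here operators act from right to left, so that $e^{p_i}g(y)$ means: multiply by $g(y)$, then translate $y_i\mapsto y_i+2$. $I_1=\mathrm{Tr}_1[L_1]$ is the trace of $L$ over the first factor; it leaves invariant the functions with values in the zero weight subspace of $V$. *)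

theory Defs
  imports "HOL-Analysis.Analysis"
begin

section \<open>Matrices as operators\<close>

text \<open>
  Finite-dimensional spaces are coordinate spaces \<^typ>\<open>complex^'m\<close>, operators on them are square
  matrices.  Throughout, \<open>\<kappa>\<close> is the chosen value of $\log q$, so \<open>q = exp \<kappa>\<close>.
\<close>

definition mscale :: "complex \<Rightarrow> complex^'m^'m \<Rightarrow> complex^'m^'m"  (infixr "*\<^sub>M" 75)
  where "c *\<^sub>M A = (\<chi> i j. c * A $ i $ j)"

definition comm :: "complex^'m^'m \<Rightarrow> complex^'m^'m \<Rightarrow> complex^'m^'m"
  where "comm A B = A ** B - B ** A"

primrec mpow :: "complex^'m^'m \<Rightarrow> nat \<Rightarrow> complex^'m^'m"
  where
    "mpow A 0 = mat 1"
  | "mpow A (Suc k) = A ** mpow A k"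

definition qpow :: "complex \<Rightarrow> complex \<Rightarrow> complex"
  where "qpow \<kappa> y = exp (\<kappa> * y)"

text \<open>The operator \<open>q\<^sup>X\<close>, as the exponential series of $X\log q$.\<close>

definition op_qpow :: "complex \<Rightarrow> complex^'m^'m \<Rightarrow> complex^'m^'m"
  where "op_qpow \<kappa> X = (\<Sum>k. (\<kappa> ^ k / fact k) *\<^sub>M mpow X k)"

definition qint :: "complex \<Rightarrow> nat \<Rightarrow> complex"
  where "qint \<kappa> m = (exp \<kappa> ^ m - inverse (exp \<kappa>) ^ m) / (exp \<kappa> - inverse (exp \<kappa>))"

definition qfact :: "complex \<Rightarrow> nat \<Rightarrow> complex"
  where "qfact \<kappa> m = (\<Prod>k = 1..m. qint \<kappa> k)"

text \<open>The series is only applied to nilpotent operators, for which it is a finite sum.\<close>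

definition qexp :: "complex \<Rightarrow> complex^'m^'m \<Rightarrow> complex^'m^'m"
  where "qexp \<kappa> Z = (\<Sum>m. (1 / qfact \<kappa> m) *\<^sub>M mpow Z m)"


section \<open>Representations of the quantum group\<close>

text \<open>
  The action of the generators on a space; only the indices \<open>1, \<dots>, n - 1\<close> matter.
\<close>

record ('m::finite) action =
  gen_e :: "nat \<Rightarrow> complex^'m^'m"
  gen_f :: "nat \<Rightarrow> complex^'m^'m"
  gen_h :: "nat \<Rightarrow> complex^'m^'m"

definition cartan :: "nat \<Rightarrow> nat \<Rightarrow> complex"
  where "cartan i j = (if i = j then 2 else if i = j + 1 \<or> j = i + 1 then - 1 else 0)"

definition uq_rep :: "nat \<Rightarrow> complex \<Rightarrow> ('m::finite) action \<Rightarrow> bool"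
  where "uq_rep n \<kappa> a \<longleftrightarrow>
    (\<forall>i\<in>{1..<n}. \<forall>j\<in>{1..<n}.
       comm (gen_h a i) (gen_h a j) = 0
     \<and> comm (gen_h a i) (gen_e a j) = cartan i j *\<^sub>M gen_e a j
     \<and> comm (gen_h a i) (gen_f a j) = (- cartan i j) *\<^sub>M gen_f a j
     \<and> comm (gen_e a i) (gen_f a j) =
         (if i = j
          then (1 / (exp \<kappa> - inverse (exp \<kappa>))) *\<^sub>M
                 (op_qpow \<kappa> (gen_h a i) - op_qpow \<kappa> (- gen_h a i))
          else 0)
     \<and> (i + 1 < j \<or> j + 1 < i \<longrightarrow>
          comm (gen_e a i) (gen_e a j) = 0 \<and> comm (gen_f a i) (gen_f a j) = 0)
     \<and> (j = i + 1 \<or> i = j + 1 \<longrightarrow>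
          gen_e a i ** gen_e a i ** gen_e a j + gen_e a j ** gen_e a i ** gen_e a i
            = (exp \<kappa> + inverse (exp \<kappa>)) *\<^sub>M (gen_e a i ** gen_e a j ** gen_e a i)
        \<and> gen_f a i ** gen_f a i ** gen_f a j + gen_f a j ** gen_f a i ** gen_f a i
            = (exp \<kappa> + inverse (exp \<kappa>)) *\<^sub>M (gen_f a i ** gen_f a j ** gen_f a i)))"

definition invariant_subspace :: "nat \<Rightarrow> ('m::finite) action \<Rightarrow> (complex^'m) set \<Rightarrow> bool"
  where "invariant_subspace n a W \<longleftrightarrow> vec.subspace W \<and>
    (\<forall>i\<in>{1..<n}. \<forall>w\<in>W. gen_e a i *v w \<in> W \<and> gen_f a i *v w \<in> W \<and> gen_h a i *v w \<in> W)"

definition irreducible_rep :: "nat \<Rightarrow> ('m::finite) action \<Rightarrow> bool"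
  where "irreducible_rep n a \<longleftrightarrow> (\<forall>W. invariant_subspace n a W \<longrightarrow> W = {0} \<or> W = UNIV)"

definition weight_space :: "nat \<Rightarrow> ('m::finite) action \<Rightarrow> (nat \<Rightarrow> complex) \<Rightarrow> (complex^'m) set"
  where "weight_space n a \<mu> = {v. \<forall>i\<in>{1..<n}. gen_h a i *v v = \<mu> i *s v}"

definition highest_weight_rep :: "nat \<Rightarrow> ('m::finite) action \<Rightarrow> (nat \<Rightarrow> complex) \<Rightarrow> bool"
  where "highest_weight_rep n a \<Lambda> \<longleftrightarrow>
    (\<exists>v. v \<noteq> 0 \<and> v \<in> weight_space n a \<Lambda> \<and> (\<forall>i\<in>{1..<n}. gen_e a i *v v = 0) \<and>
         (\<forall>W. invariant_subspace n a W \<and> v \<in> W \<longrightarrow> W = UNIV))"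

text \<open>
  The elements \<open>h\<^sup>i\<close>: their coefficients are the entries of the inverse Cartan matrix.
\<close>

definition cartan_inv :: "nat \<Rightarrow> nat \<Rightarrow> nat \<Rightarrow> complex"
  where "cartan_inv n i j = of_nat (min i j) - of_nat (i * j) / of_nat n"

lemma cartan_inv_dual:
  assumes "i \<in> {1..<n}" "j \<in> {1..<n}"
  shows "(\<Sum>k\<in>{1..<n}. cartan_inv n i k * cartan k j) = (if i = j then 1 else 0)"
proof -
  let ?c = "cartan_inv n i"
  obtain m where m: "j = Suc m" using assms(2) by (cases j) auto
  have c0: "?c 0 = 0" and cn: "?c n = 0"
    using assms by (auto simp: cartan_inv_def min_def)
  have "(\<Sum>k\<in>{1..<n}. ?c k * cartan k j) = (\<Sum>k\<in>{0..n}. ?c k * cartan k j)"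
  proof (rule sum.mono_neutral_left, simp, force, intro ballI)
    fix k assume "k \<in> {0..n} - {1..<n}"
    hence "k = 0 \<or> k = n" by auto
    thus "?c k * cartan k j = 0" using c0 cn by auto
  qed
  also have "\<dots> = (\<Sum>k\<in>{m, m + 1, m + 2}. ?c k * cartan k j)"
    by (rule sum.mono_neutral_right) (use assms m in \<open>auto simp: cartan_def\<close>)
  also have "\<dots> = 2 * ?c (m + 1) - ?c m - ?c (m + 2)"
    by (simp add: cartan_def m)
  also have "\<dots> = (if i = j then 1 else 0)"
  proof -
    have "2 * (of_nat (min i (m + 1)) :: complex)
             = of_nat (min i m) + of_nat (min i (m + 2)) + (if i = j then 1 else 0)"
    proof -
      consider "i \<le> m" | "i = m + 1" | "i \<ge> m + 2" by linarith
      thus ?thesis by cases (simp_all add: m)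
    qed
    thus ?thesis unfolding cartan_inv_def
      by (simp add: add_divide_distrib algebra_simps)
  qed
  finally show ?thesis .
qed

definition dual_h :: "nat \<Rightarrow> ('m::finite) action \<Rightarrow> nat \<Rightarrow> complex^'m^'m"
  where "dual_h n a i = (\<Sum>j\<in>{1..<n}. cartan_inv n i j *\<^sub>M gen_h a j)"

text \<open>
  Root vectors \<open>e\<^sub>i\<^sub>j\<close> and \<open>f\<^sub>i\<^sub>j\<close> for \<open>i < j\<close>, with the intermediate index \<open>k = j - 1\<close> in the
  recursion (the result does not depend on \<open>k\<close>).
\<close>

primrec root_e :: "complex \<Rightarrow> ('m::finite) action \<Rightarrow> nat \<Rightarrow> nat \<Rightarrow> complex^'m^'m"
  where
    "root_e \<kappa> a i 0 = 0"
  | "root_e \<kappa> a i (Suc k) =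
       (if k = i then gen_e a i
        else root_e \<kappa> a i k ** gen_e a k - exp \<kappa> *\<^sub>M (gen_e a k ** root_e \<kappa> a i k))"

primrec root_f :: "complex \<Rightarrow> ('m::finite) action \<Rightarrow> nat \<Rightarrow> nat \<Rightarrow> complex^'m^'m"
  where
    "root_f \<kappa> a i 0 = 0"
  | "root_f \<kappa> a i (Suc k) =
       (if k = i then gen_f a i
        else gen_f a k ** root_f \<kappa> a i k - inverse (exp \<kappa>) *\<^sub>M (root_f \<kappa> a i k ** gen_f a k))"

text \<open>The positive roots in increasing lexicographic order.\<close>

definition pos_roots :: "nat \<Rightarrow> (nat \<times> nat) list"
  where "pos_roots n = concat (map (\<lambda>i. map (\<lambda>j. (i, j)) [Suc i..<Suc n]) [1..<n])"

text \<open>Ordered products: the factors of larger roots stand to the left.\<close>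

definition prod_gt :: "nat \<Rightarrow> (nat \<times> nat \<Rightarrow> complex^'m^'m) \<Rightarrow> complex^'m^'m"
  where "prod_gt n X = foldr (\<lambda>r P. X r ** P) (rev (pos_roots n)) (mat 1)"

definition pbw_e :: "nat \<Rightarrow> complex \<Rightarrow> ('m::finite) action \<Rightarrow> (nat \<times> nat \<Rightarrow> nat) \<Rightarrow> complex^'m^'m"
  where "pbw_e n \<kappa> a p = prod_gt n (\<lambda>(i, j). mpow (root_e \<kappa> a i j) (p (i, j)))"

definition pbw_f :: "nat \<Rightarrow> complex \<Rightarrow> ('m::finite) action \<Rightarrow> (nat \<times> nat \<Rightarrow> nat) \<Rightarrow> complex^'m^'m"
  where "pbw_f n \<kappa> a p = prod_gt n (\<lambda>(i, j). mpow (root_f \<kappa> a i j) (p (i, j)))"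

definition pbw_exponents :: "nat \<Rightarrow> (nat \<times> nat \<Rightarrow> nat) set"
  where "pbw_exponents n = {p. \<forall>r. r \<notin> set (pos_roots n) \<longrightarrow> p r = 0}"

text \<open>The coefficient of the simple root \<open>\<alpha>\<^sub>k\<close> in the weight of a PBW element, where
  \<open>(ij) = \<alpha>\<^sub>i + \<dots> + \<alpha>\<^sub>j\<^sub>-\<^sub>1\<close>.\<close>

definition pbw_weight :: "nat \<Rightarrow> (nat \<times> nat \<Rightarrow> nat) \<Rightarrow> nat \<Rightarrow> nat"
  where "pbw_weight n p k = (\<Sum>(i, j)\<in>{(i, j). (i, j) \<in> set (pos_roots n) \<and> i \<le> k \<and> k < j}. p (i, j))"


section \<open>R-matrix, quasi-Hopf shift and dynamical R-matrix\<close>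

text \<open>
  A tensor product of two representations is handled through the two commuting actions \<open>a\<close>, \<open>b\<close> of
  the quantum group on it, so that $u\otimes v$ acts as the product of the action of $u$ by \<open>a\<close>
  and of $v$ by \<open>b\<close>.  Exchanging the tensor factors of a universal expression means exchanging
  \<open>a\<close> and \<open>b\<close>.
\<close>

definition R_hat :: "nat \<Rightarrow> complex \<Rightarrow> ('m::finite) action \<Rightarrow> 'm action \<Rightarrow> complex^'m^'m"
  where "R_hat n \<kappa> a b =
    prod_gt n (\<lambda>(i, j). qexp \<kappa> ((exp \<kappa> - inverse (exp \<kappa>)) *\<^sub>M (root_e \<kappa> a i j ** root_f \<kappa> b i j)))"

definition K_op :: "nat \<Rightarrow> complex \<Rightarrow> ('m::finite) action \<Rightarrow> 'm action \<Rightarrow> complex^'m^'m"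
  where "K_op n \<kappa> a b = op_qpow \<kappa> (\<Sum>j\<in>{1..<n}. gen_h a j ** dual_h n b j)"

definition R_univ :: "nat \<Rightarrow> complex \<Rightarrow> ('m::finite) action \<Rightarrow> 'm action \<Rightarrow> complex^'m^'m"
  where "R_univ n \<kappa> a b = K_op n \<kappa> a b ** R_hat n \<kappa> a b"

definition B_op :: "nat \<Rightarrow> complex \<Rightarrow> (nat \<Rightarrow> complex) \<Rightarrow> ('m::finite) action \<Rightarrow> complex^'m^'m"
  where "B_op n \<kappa> y a = op_qpow \<kappa>
    (\<Sum>j\<in>{1..<n}. gen_h a j ** dual_h n a j - (y (j + 1) - y j) *\<^sub>M dual_h n a j)"

definition cartan_function :: "nat \<Rightarrow> ('m::finite) action \<Rightarrow> complex^'m^'m \<Rightarrow> bool"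
  where "cartan_function n a \<Phi> \<longleftrightarrow> (\<exists>g. \<forall>\<mu>. \<forall>v\<in>weight_space n a \<mu>. \<Phi> *v v = g \<mu> *s v)"

text \<open>
  The coefficients \<open>\<phi>\<^sub>p\<^sub>,\<^sub>r\<close> of the shift are functions of \<open>y\<close> and of the Cartan generators of the
  second factor, on which \<open>B\<^sub>2\<close> acts.  In a finite-dimensional representation all but
  finitely many PBW elements vanish, so the sum is taken over a finite set of pairs \<open>(p, r)\<close>.
\<close>

definition shift_form :: "nat \<Rightarrow> complex \<Rightarrow> ('m::finite) action \<Rightarrow> 'm action \<Rightarrow> complex^'m^'m \<Rightarrow> bool"
  where "shift_form n \<kappa> a b F \<longleftrightarrow>
    (\<exists>S \<phi>. finite S \<and> (\<lambda>_. 0, \<lambda>_. 0) \<in> S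
       \<and> (\<forall>(p, r)\<in>S. p \<in> pbw_exponents n \<and> r \<in> pbw_exponents n
            \<and> (\<forall>k\<in>{1..<n}. pbw_weight n p k = pbw_weight n r k)
            \<and> cartan_function n b (\<phi> p r))
       \<and> \<phi> (\<lambda>_. 0) (\<lambda>_. 0) = mat 1
       \<and> F = (\<Sum>(p, r)\<in>S. pbw_e n \<kappa> a p ** pbw_f n \<kappa> b r ** \<phi> p r))"

definition F_shift ::
    "nat \<Rightarrow> complex \<Rightarrow> (nat \<Rightarrow> complex) \<Rightarrow> ('m::finite) action \<Rightarrow> 'm action \<Rightarrow> complex^'m^'m"
  where "F_shift n \<kappa> y a b =
    (THE F. shift_form n \<kappa> a b F
       \<and> R_hat n \<kappa> a b ** F = B_op n \<kappa> y b ** F ** matrix_inv (B_op n \<kappa> y b))"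

definition R_dyn ::
    "nat \<Rightarrow> complex \<Rightarrow> (nat \<Rightarrow> complex) \<Rightarrow> ('m::finite) action \<Rightarrow> 'm action \<Rightarrow> complex^'m^'m"
  where "R_dyn n \<kappa> y a b =
    matrix_inv (F_shift n \<kappa> y b a) ** R_univ n \<kappa> a b ** F_shift n \<kappa> y a b"


section \<open>Translation operators\<close>

text \<open>Only the coordinates \<open>y\<^sub>1, \<dots>, y\<^sub>n\<close> of \<open>y\<close> matter.\<close>

definition function_of_differences :: "nat \<Rightarrow> ((nat \<Rightarrow> complex) \<Rightarrow> 'b) \<Rightarrow> bool"
  where "function_of_differences n \<psi> \<longleftrightarrow>
    (\<forall>y z. (\<forall>i\<in>{1..n}. \<forall>j\<in>{1..n}. y i - y j = z i - z j) \<longrightarrow> \<psi> y = \<psi> z)"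

text \<open>The operator $e^{p_i}$ with $p_i = 2\,\partial/\partial y_i$.\<close>

definition transl :: "nat \<Rightarrow> ((nat \<Rightarrow> complex) \<Rightarrow> 'b) \<Rightarrow> (nat \<Rightarrow> complex) \<Rightarrow> 'b"
  where "transl i \<psi> y = \<psi> (y(i := y i + 2))"

text \<open>The point to which $\prod_i e^{c_i(p_{i+1}-p_i)}$ moves \<open>y\<close>.\<close>

definition dual_move :: "nat \<Rightarrow> (nat \<Rightarrow> complex) \<Rightarrow> (nat \<Rightarrow> complex) \<Rightarrow> nat \<Rightarrow> complex"
  where "dual_move n c y k =
    y k + 2 * (\<Sum>i\<in>{1..<n}. c i * ((if k = i + 1 then 1 else 0) - (if k = i then 1 else 0)))"

text \<open>
  The operator $q^{\sum_i X_i\tilde p_i}$ with $q^{\tilde p_i}=e^{p_{i+1}-p_i}$, for commuting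
  diagonalizable operators \<open>X\<^sub>1, \<dots>, X\<^sub>n\<^sub>-\<^sub>1\<close>: on a scalar function times a joint eigenvector,
  each \<open>X\<^sub>i\<close> is replaced by its eigenvalue.  (As the scalar functions are arbitrary, additivity of
  the operator amounts to linearity.)
\<close>

definition qshift ::
    "nat \<Rightarrow> (nat \<Rightarrow> complex^'m^'m) \<Rightarrow> ((nat \<Rightarrow> complex) \<Rightarrow> complex^'m) \<Rightarrow> (nat \<Rightarrow> complex) \<Rightarrow> complex^'m"
  where "qshift n X =
    (THE D. (\<forall>\<psi> \<eta>. D (\<lambda>y. \<psi> y + \<eta> y) = (\<lambda>y. D \<psi> y + D \<eta> y))
       \<and> (\<forall>v \<mu> g. (\<forall>i\<in>{1..<n}. X i *v v = \<mu> i *s v) \<longrightarrow>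
             D (\<lambda>y. g y *s v) = (\<lambda>y. g (dual_move n \<mu> y) *s v)))"


section \<open>The L-operator\<close>

text \<open>The position \<open>1, \<dots>, n\<close> of an element of the index type of the matrix representation.\<close>

definition idx :: "'n::{finite,linorder} \<Rightarrow> nat"
  where "idx a = card {b. b \<le> a}"

definition mat_unit :: "nat \<Rightarrow> nat \<Rightarrow> complex^('n::{finite,linorder})^('n::{finite,linorder})"
  where "mat_unit i j = (\<chi> a b. if idx a = i \<and> idx b = j then 1 else 0)"

definition matrix_rep :: "('n::{finite,linorder}) action"
  where "matrix_rep = \<lparr> gen_e = (\<lambda>i. mat_unit i (i + 1)),
                        gen_f = (\<lambda>i. mat_unit (i + 1) i),
                        gen_h = (\<lambda>i. mat_unit i i - mat_unit (i + 1) (i + 1)) \<rparr>"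

definition tensor_op :: "complex^'n^'n \<Rightarrow> complex^'d^'d \<Rightarrow> complex^('n \<times> 'd)^('n \<times> 'd)"
  where "tensor_op A C = (\<chi> s t. A $ fst s $ fst t * C $ snd s $ snd t)"

definition first_leg :: "('n::finite) action \<Rightarrow> ('n \<times> 'd::finite) action"
  where "first_leg a = \<lparr> gen_e = (\<lambda>i. tensor_op (gen_e a i) (mat 1)),
                         gen_f = (\<lambda>i. tensor_op (gen_f a i) (mat 1)),
                         gen_h = (\<lambda>i. tensor_op (gen_h a i) (mat 1)) \<rparr>"

definition second_leg :: "('d::finite) action \<Rightarrow> ('n::finite \<times> 'd) action"
  where "second_leg a = \<lparr> gen_e = (\<lambda>i. tensor_op (mat 1) (gen_e a i)),
                          gen_f = (\<lambda>i. tensor_op (mat 1) (gen_f a i)),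
                          gen_h = (\<lambda>i. tensor_op (mat 1) (gen_h a i)) \<rparr>"

definition L_general ::
    "nat \<Rightarrow> complex \<Rightarrow> ('m::finite) action \<Rightarrow> 'm action \<Rightarrow>
     ((nat \<Rightarrow> complex) \<Rightarrow> complex^'m) \<Rightarrow> (nat \<Rightarrow> complex) \<Rightarrow> complex^'m"
  where "L_general n \<kappa> a b \<psi> =
    qshift n (\<lambda>i. - (dual_h n a i + (1 / 2) *\<^sub>M dual_h n b i))
      (\<lambda>y. R_dyn n \<kappa> y a b *v qshift n (\<lambda>i. (1 / 2) *\<^sub>M dual_h n b i) \<psi> y)"

definition L_op ::
    "complex \<Rightarrow> ('d::finite) action \<Rightarrow>
     ((nat \<Rightarrow> complex) \<Rightarrow> complex^('n::{finite,linorder} \<times> 'd)) \<Rightarrow> (nat \<Rightarrow> complex) \<Rightarrow> complex^('n::{finite,linorder} \<times> 'd)"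
  where "L_op \<kappa> V = L_general CARD('n) \<kappa> (first_leg matrix_rep) (second_leg V)"

text \<open>The vector $v_k\otimes w$, and the component in \<open>V\<close> of a vector along \<open>v\<^sub>k\<close>.\<close>

definition tensor_basis :: "'n \<Rightarrow> complex^'d \<Rightarrow> complex^('n::finite \<times> 'd::finite)"
  where "tensor_basis k w = (\<chi> s. if fst s = k then w $ snd s else 0)"

definition component :: "'n \<Rightarrow> complex^('n::finite \<times> 'd::finite) \<Rightarrow> complex^'d"
  where "component k t = (\<chi> c. t $ (k, c))"

text \<open>$I_1=\mathrm{Tr}_1[L]$, the sum of the diagonal matrix elements of \<open>L\<close> in the first factor,
  each of which is an operator on functions with values in \<open>V\<close>.\<close>

definition I1 ::
    "'n::{finite,linorder} itself \<Rightarrow> complex \<Rightarrow> ('d::finite) action \<Rightarrow>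
     ((nat \<Rightarrow> complex) \<Rightarrow> complex^'d) \<Rightarrow> (nat \<Rightarrow> complex) \<Rightarrow> complex^'d"
  where "I1 TYPE('n) \<kappa> V \<psi> y =
    (\<Sum>k\<in>(UNIV :: 'n set). component k (L_op \<kappa> V (\<lambda>z. tensor_basis k (\<psi> z)) y))"

definition xi :: "complex \<Rightarrow> complex \<Rightarrow> complex"
  where "xi \<kappa> u = (exp \<kappa> - inverse (exp \<kappa>))\<^sup>2 * qpow \<kappa> (u + 1)
                   / ((qpow \<kappa> u - 1) * (qpow \<kappa> (u + 2) - 1))"

text \<open>
  The complement of finitely many hypersurfaces $q^{y_i-y_j+m}=1$, outside of which identities of
  meromorphic functions of \<open>y\<close> are stated.
\<close>

definition generic_point :: "nat \<Rightarrow> complex \<Rightarrow> int set \<Rightarrow> (nat \<Rightarrow> complex) \<Rightarrow> bool"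
  where "generic_point n \<kappa> M y \<longleftrightarrow>
    (\<forall>i\<in>{1..n}. \<forall>j\<in>{1..n}. \<forall>m\<in>M. i \<noteq> j \<longrightarrow> qpow \<kappa> (y i - y j + of_int m) \<noteq> 1)"

end

theory Submission
  imports Defs
begin

text \<open>
  The representation \<open>V\<close> is the \<open>N\<close>-th quantum symmetric power, \<open>N = n l\<close>.  It is spanned by vectors
  \<open>u\<^sub>m\<close>, one for each monomial $x^m=x_1^{m_1}\cdots x_n^{m_n}$ of degree \<open>N\<close>, on which the
  generators, and then all root vectors, move one unit of the exponent with an explicit coefficient
  (\<open>monomial_action_exists\<close>, \<open>root_vectors_on_monomials\<close>).  The zero weight space is the line of
  \<open>u\<^sub>m\<close> with \<open>m = (l, \<dots>, l)\<close>, so that the trace $I_1$ only involves the diagonal matrix elements of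
  the dynamical \<open>R\<close>-matrix on the vectors $v_k\otimes u_{(l,\dots,l)}$.

  With one factor in the vector representation everything becomes triangular.  There
  $\hat R_{12}=1+(q-q^{-1})\sum_{i<j}E_{ij}\otimes f_{ij}$ and
  $\hat R_{21}^{-1}=1-(q-q^{-1})\sum_{i<j}E_{ji}\otimes e_{ij}$, because all products of matrix units
  which arise vanish.  Componentwise the equation for $F_{12}$ is therefore a recursion along
  $v_k, v_{k-1},\dots,v_1$ with scalar coefficients on the monomials, and the equation for $F_{21}$ is a
  recursion along $v_k,v_{k+1},\dots,v_n$ with operators on \<open>V\<close> as coefficients; so is the equation for
  $F_{21}^{-1}$.  At a generic point \<open>y\<close> the leading coefficients do not vanish, and each equation
  has exactly one solution of the required form (\<open>F_shift_upper\<close>, \<open>F_shift_lower\<close>,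
  \<open>F_down_matrix_inv\<close>).

  In the diagonal element the vector $v_k\otimes u_m$ is first sent to $v_i\otimes u_{m'}$, \<open>i \<le> k\<close>, by
  $\hat R_{12}F_{12}$ and then back to $v_k\otimes u_m$ by $F_{21}^{-1}$.  This gives
  $1+\sum_{i<k}q^{y_k-y_i+1}a_ig_i$ with two families $a_i$, $g_i$ determined by similar recursions;
  the sum telescopes to the product of the factors
  $1-[l][l+1]\xi(y_k-y_i)$ (\<open>recursions_give_product\<close>, \<open>R_dyn_diagonal\<close>).

  The two translations in \<open>L\<close> then act as follows.  The inner one is trivial on weight zero, and the
  outer one moves \<open>y\<close> in the \<open>k\<close>-th summand to $y+2\epsilon_k$, up to a common translation of the
  coordinates.  As the outer translation is applied to a function with components of all weights, the
  dynamical \<open>R\<close>-matrix is needed at finitely many points, each of them differing from \<open>y\<close> by integers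
  in the differences of the coordinates; hence finitely many hypersurfaces have to be avoided.
\<close>


section \<open>Matrices acting on vectors\<close>

lemma mscale_mult_vec: "(c *\<^sub>M A) *v x = c *s (A *v x)"
  by (simp add: mscale_def matrix_vector_mult_def vec_eq_iff sum_distrib_left mult.assoc)

lemma mscale_mult_left: "(c *\<^sub>M A) ** B = c *\<^sub>M (A ** B)"
  by (simp add: matrix_eq mscale_mult_vec flip: matrix_vector_mul_assoc)

lemma mscale_mult_right: "A ** (c *\<^sub>M B) = c *\<^sub>M (A ** B)"
  by (simp add: matrix_eq mscale_mult_vec vec.scale flip: matrix_vector_mul_assoc)

lemma mscale_mscale: "c *\<^sub>M (d *\<^sub>M A) = (c * d) *\<^sub>M A"
  by (simp add: mscale_def vec_eq_iff mult.assoc)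

lemma sum_mult_vec: "(\<Sum>i\<in>I. A i) *v x = (\<Sum>i\<in>I. A i *v x)"
  for A :: "'i \<Rightarrow> complex^'m^'k"
  by (induction I rule: infinite_finite_induct) (simp_all add: matrix_vector_mult_add_rdistrib)

lemma uminus_mult_vec: "(- A) *v x = - (A *v x)" for A :: "complex^'m^'k"
  by (simp add: matrix_vector_mult_def vec_eq_iff sum_negf)

lemma mult_vec_uminus: "A *v (- x) = - (A *v x)" for A :: "complex^'m^'k"
  by (rule vec.neg)

lemmas op_simps = mscale_mult_vec sum_mult_vec uminus_mult_vec mult_vec_uminus vec.scale vec.sum
  matrix_vector_mult_add_rdistrib matrix_vector_mult_diff_rdistrib

lemma comm_apply: "comm A B *v x = A *v (B *v x) - B *v (A *v x)"
  by (simp add: comm_def op_simps matrix_vector_mul_assoc)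

lemma matrix_eq_on_spanning:
  fixes A B :: "complex^'m^'k"
  assumes "vec.span E = UNIV" "\<And>x. x \<in> E \<Longrightarrow> A *v x = B *v x"
  shows "A = B"
proof -
  have "A *v x = B *v x" for x
  proof -
    have "x \<in> vec.span E" using assms by simp
    thus ?thesis
      by (induction rule: vec.span_induct_alt) (simp_all add: op_simps vec.add assms)
  qed
  thus ?thesis by (simp add: matrix_eq)
qed

lemma matrix_inv_unique:
  fixes A :: "complex^'m^'m"
  assumes "A ** B = mat 1" "B ** A = mat 1"
  shows "matrix_inv A = B"
proof -
  have "A ** matrix_inv A = mat 1 \<and> matrix_inv A ** A = mat 1"
    unfolding matrix_inv_def by (rule someI[of _ B]) (use assms in simp)
  hence "matrix_inv A = (B ** A) ** matrix_inv A"
    using assms by simp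
  also have "\<dots> = B" using \<open>A ** matrix_inv A = mat 1 \<and> _\<close>
    by (simp flip: matrix_mul_assoc)
  finally show ?thesis .
qed


section \<open>Joint eigenvectors\<close>

definition joint_eigenspace ::
    "nat set \<Rightarrow> (nat \<Rightarrow> complex^'m^'m) \<Rightarrow> (nat \<Rightarrow> complex) \<Rightarrow> (complex^'m) set"
  where "joint_eigenspace I X \<mu> = {v. \<forall>i\<in>I. X i *v v = \<mu> i *s v}"

definition eigen_spanning :: "nat set \<Rightarrow> (nat \<Rightarrow> complex^'m^'m) \<Rightarrow> (complex^'m) set \<Rightarrow> bool"
  where "eigen_spanning I X E \<longleftrightarrow> vec.span E = UNIV \<and> (\<forall>v\<in>E. \<exists>\<mu>. v \<in> joint_eigenspace I X \<mu>)"

lemma weight_space_eq: "weight_space n a \<mu> = joint_eigenspace {1..<n} (gen_h a) \<mu>"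
  by (simp add: weight_space_def joint_eigenspace_def)

lemma subspace_joint_eigenspace: "vec.subspace (joint_eigenspace I X \<mu>)"
  by (auto simp: vec.subspace_def joint_eigenspace_def vec.scale vec.add
      vector_add_ldistrib mult.commute)

lemma joint_eigenspace_cong:
  "(\<And>i. i \<in> I \<Longrightarrow> \<mu> i = \<nu> i) \<Longrightarrow> joint_eigenspace I X \<mu> = joint_eigenspace I X \<nu>"
  by (auto simp: joint_eigenspace_def)

lemma joint_eigenvalue_unique:
  assumes "v \<noteq> 0" "v \<in> joint_eigenspace I X \<mu>" "v \<in> joint_eigenspace I X \<nu>" "i \<in> I"
  shows "\<mu> i = \<nu> i"
  using assms by (auto simp: joint_eigenspace_def)

lemma eigen_spanning_basis:
  assumes "eigen_spanning I X E"
  obtains B where "B \<subseteq> E" "finite B" "vec.independent B" "vec.span B = UNIV" "0 \<notin> B"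
proof -
  obtain B where B: "B \<subseteq> E" "vec.independent B" "E \<subseteq> vec.span B"
    using vec.maximal_independent_subset[of E] by blast
  have "vec.span B = UNIV"
    using B(3) assms vec.span_minimal[OF B(3) vec.subspace_span] by (auto simp: eigen_spanning_def)
  moreover have "finite B" using B(2) by (rule vec.finiteI_independent)
  moreover have "0 \<notin> B" using B(2) vec.dependent_zero by blast
  ultimately show ?thesis using that B by blast
qed

lemma representation_joint_eigenvector:
  assumes B: "vec.independent B" "vec.span B = UNIV" "finite B"
    and ev: "\<And>b. b \<in> B \<Longrightarrow> b \<in> joint_eigenspace I X (ev b)"
    and v: "v \<in> joint_eigenspace I X \<mu>" and b: "vec.representation B v b \<noteq> 0" and i: "i \<in> I"
  shows "ev b i = \<mu> i"
proof -
  have bB: "b \<in> B" using b vec.representation_ne_zero by blast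
  have v_eq: "v = (\<Sum>b\<in>B. vec.representation B v b *s b)"
    by (rule vec.sum_representation_eq[symmetric]) (use B in auto)
  have "X i *v v = (\<Sum>b\<in>B. vec.representation B v b *s (X i *v b))"
    by (subst v_eq) (simp add: op_simps)
  also have "\<dots> = (\<Sum>b\<in>B. (vec.representation B v b * ev b i) *s b)"
    using ev i by (intro sum.cong) (auto simp: joint_eigenspace_def)
  finally have "vec.representation B (X i *v v) b =
      (\<Sum>c\<in>B. (vec.representation B v c * ev c i) * (if b = c then 1 else 0))"
    using B by (simp add: vec.representation_sum vec.representation_scale vec.representation_basis)
  also have "\<dots> = vec.representation B v b * ev b i"
    using B bB by (simp add: if_distrib cong: if_cong)
  also have "vec.representation B (X i *v v) b = \<mu> i * vec.representation B v b"
    using v i B by (simp add: joint_eigenspace_def vec.representation_scale)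
  finally show ?thesis using b by simp
qed

text \<open>Expanding an eigenvector in a basis of eigenvectors, only basis vectors with the same
  eigenvalues occur.  This is how weights of vectors will be controlled throughout.\<close>

lemma joint_eigenspace_subset_span:
  assumes "eigen_spanning I X E"
  shows "joint_eigenspace I X \<mu> \<subseteq> vec.span (E \<inter> joint_eigenspace I X \<mu>)"
proof
  fix v assume v: "v \<in> joint_eigenspace I X \<mu>"
  obtain B where B: "B \<subseteq> E" "finite B" "vec.independent B" "vec.span B = UNIV"
    using eigen_spanning_basis[OF assms] by metis
  define ev where "ev b = (SOME \<nu>. b \<in> joint_eigenspace I X \<nu>)" for b
  have ev: "b \<in> joint_eigenspace I X (ev b)" if "b \<in> B" for b
    using assms B(1) that someI_ex[of "\<lambda>\<nu>. b \<in> joint_eigenspace I X \<nu>"]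
    unfolding ev_def eigen_spanning_def by blast
  have "(\<Sum>b\<in>B. vec.representation B v b *s b) \<in> vec.span (E \<inter> joint_eigenspace I X \<mu>)"
  proof (rule vec.span_sum)
    fix b assume b: "b \<in> B"
    show "vec.representation B v b *s b \<in> vec.span (E \<inter> joint_eigenspace I X \<mu>)"
    proof (cases "vec.representation B v b = 0")
      case False
      hence "joint_eigenspace I X (ev b) = joint_eigenspace I X \<mu>"
        using representation_joint_eigenvector[OF B(3,4,2) ev v False]
        by (intro joint_eigenspace_cong) auto
      hence "b \<in> E \<inter> joint_eigenspace I X \<mu>" using ev[OF b] b B(1) by auto
      thus ?thesis by (intro vec.span_scale vec.span_base)
    qed (simp add: vec.span_zero)
  qed
  thus "v \<in> vec.span (E \<inter> joint_eigenspace I X \<mu>)"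
    using vec.sum_representation_eq[of B v B] B by auto
qed

text \<open>The operator is defined by the prescribed eigenvalues on a basis of eigenvectors; an eigenvector
  involves only basis vectors with its own eigenvalues, so the prescription holds for all of them.\<close>

lemma diagonal_operator_exists:
  assumes E: "eigen_spanning I X E"
    and g: "\<And>\<mu> \<nu>. (\<And>i. i \<in> I \<Longrightarrow> \<mu> i = \<nu> i) \<Longrightarrow> g \<mu> = g \<nu>"
  shows "\<exists>\<Phi>. \<forall>\<mu>. \<forall>v\<in>joint_eigenspace I X \<mu>. \<Phi> *v v = g \<mu> *s v"
proof -
  obtain B where B: "B \<subseteq> E" "finite B" "vec.independent B" "vec.span B = UNIV"
    using eigen_spanning_basis[OF E] by metis
  define ev where "ev b = (SOME \<nu>. b \<in> joint_eigenspace I X \<nu>)" for b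
  have ev: "b \<in> joint_eigenspace I X (ev b)" if "b \<in> B" for b
    using E B(1) that someI_ex[of "\<lambda>\<nu>. b \<in> joint_eigenspace I X \<nu>"]
    unfolding ev_def eigen_spanning_def by blast
  define f where "f v = (\<Sum>b\<in>B. (vec.representation B v b * g (ev b)) *s b)" for v
  have "Vector_Spaces.linear (*s) (*s) f"
    by unfold_locales
      (use B in \<open>auto simp: f_def vec.representation_add vec.representation_scale
         algebra_simps sum.distrib vec.scale_sum_right\<close>)
  hence f: "matrix f *v v = f v" for v by (rule matrix_works)
  have "f v = g \<mu> *s v" if v: "v \<in> joint_eigenspace I X \<mu>" for \<mu> v
  proof -
    have "f v = (\<Sum>b\<in>B. g \<mu> *s (vec.representation B v b *s b))"
      unfolding f_def
    proof (rule sum.cong)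
      fix b assume "b \<in> B"
      show "(vec.representation B v b * g (ev b)) *s b = g \<mu> *s (vec.representation B v b *s b)"
        using representation_joint_eigenvector[OF B(3,4,2) ev v, of b] g[of "ev b" \<mu>]
        by (cases "vec.representation B v b = 0") auto
    qed simp
    also have "\<dots> = g \<mu> *s v"
      using vec.sum_representation_eq[of B v B] B
      by (simp only: vec.scale_sum_right[symmetric]) simp
    finally show ?thesis .
  qed
  thus ?thesis using f by metis
qed


section \<open>Exponentials of operators\<close>

lemma mpow_eigenvector: "X *v v = \<theta> *s v \<Longrightarrow> mpow X k *v v = \<theta> ^ k *s v"
  by (induction k) (simp_all add: vec.scale mult.commute flip: matrix_vector_mul_assoc)

lemma norm_mpow_component_le:
  fixes X :: "complex^'m^'m"
  shows "norm (mpow X k $ i $ j) \<le> (\<Sum>i\<in>UNIV. \<Sum>j\<in>UNIV. norm (X $ i $ j)) ^ k"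
proof (induction k arbitrary: i)
  case (Suc k)
  let ?A = "\<Sum>i\<in>UNIV. \<Sum>j\<in>UNIV. norm (X $ i $ j)"
  have A: "?A \<ge> 0" by (intro sum_nonneg) auto
  have "norm (mpow X (Suc k) $ i $ j) \<le> (\<Sum>l\<in>UNIV. norm (X $ i $ l) * norm (mpow X k $ l $ j))"
    by (simp add: matrix_matrix_mult_def) (rule order_trans[OF norm_sum], simp add: norm_mult)
  also have "\<dots> \<le> (\<Sum>l\<in>UNIV. norm (X $ i $ l) * ?A ^ k)"
    by (intro sum_mono mult_left_mono Suc) auto
  also have "\<dots> = (\<Sum>l\<in>UNIV. norm (X $ i $ l)) * ?A ^ k" by (simp add: sum_distrib_right)
  also have "\<dots> \<le> ?A * ?A ^ k"
    by (intro mult_right_mono member_le_sum[where f = "\<lambda>i. \<Sum>l\<in>UNIV. norm (X $ i $ l)"])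
       (auto intro!: sum_nonneg zero_le_power)
  finally show ?case by simp
qed (simp add: mat_def)

lemma norm_matrix_le_sum: "norm A \<le> (\<Sum>i\<in>UNIV. \<Sum>j\<in>UNIV. norm (A $ i $ j))"
  for A :: "complex^'m^'k"
proof -
  have "norm A \<le> (\<Sum>i\<in>UNIV. norm (A $ i))"
    by (simp add: norm_vec_def L2_set_le_sum)
  also have "\<dots> \<le> (\<Sum>i\<in>UNIV. \<Sum>j\<in>UNIV. norm (A $ i $ j))"
    by (intro sum_mono) (simp add: norm_vec_def L2_set_le_sum)
  finally show ?thesis .
qed

lemma summable_op_qpow: "summable (\<lambda>k. (\<kappa> ^ k / fact k) *\<^sub>M mpow X k)"
  for X :: "complex^'m^'m"
proof (rule summable_comparison_test)
  let ?A = "\<Sum>i\<in>UNIV. \<Sum>j\<in>UNIV. norm (X $ i $ j)"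
  let ?N = "real (CARD('m)) * real (CARD('m))"
  show "summable (\<lambda>k. ?N * (inverse (fact k) * (norm \<kappa> * ?A) ^ k))"
    by (intro summable_mult summable_exp)
  have "norm ((\<kappa> ^ k / fact k) *\<^sub>M mpow X k) \<le> ?N * (inverse (fact k) * (norm \<kappa> * ?A) ^ k)" for k
  proof -
    have "norm ((\<kappa> ^ k / fact k) *\<^sub>M mpow X k)
        \<le> (\<Sum>i\<in>(UNIV::'m set). \<Sum>j\<in>(UNIV::'m set). norm (((\<kappa> ^ k / fact k) *\<^sub>M mpow X k) $ i $ j))"
      by (rule norm_matrix_le_sum)
    also have "\<dots> \<le> (\<Sum>i\<in>(UNIV::'m set). \<Sum>j\<in>(UNIV::'m set). norm (\<kappa> ^ k / fact k) * ?A ^ k)"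
      by (intro sum_mono, simp only: mscale_def vec_lambda_beta norm_mult)
         (intro mult_left_mono norm_mpow_component_le norm_ge_zero)
    also have "\<dots> = ?N * (inverse (fact k) * (norm \<kappa> * ?A) ^ k)"
      by (simp add: norm_divide norm_mult norm_power norm_inverse power_mult_distrib divide_inverse)
    finally show ?thesis .
  qed
  thus "\<exists>N. \<forall>k\<ge>N. norm ((\<kappa> ^ k / fact k) *\<^sub>M mpow X k) \<le> ?N * (inverse (fact k) * (norm \<kappa> * ?A) ^ k)"
    by blast
qed

text \<open>The exponential series converges absolutely, hence may be evaluated on a vector termwise.\<close>

lemma op_qpow_eigenvector:
  fixes X :: "complex^'m^'m"
  assumes "X *v v = \<theta> *s v"
  shows "op_qpow \<kappa> X *v v = qpow \<kappa> \<theta> *s v"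
proof -
  have "bounded_linear (\<lambda>A::complex^'m^'m. A *v v)"
    unfolding linear_conv_bounded_linear[symmetric]
    by (auto simp: linear_iff matrix_vector_mult_def vec_eq_iff scaleR_sum_right distrib_right sum.distrib)
  from bounded_linear.suminf[OF this summable_op_qpow]
  have "op_qpow \<kappa> X *v v = (\<Sum>k. ((\<kappa> ^ k / fact k) *\<^sub>M mpow X k) *v v)"
    by (simp add: op_qpow_def)
  also have "\<dots> = (\<Sum>k. ((\<kappa> * \<theta>) ^ k /\<^sub>R fact k) *s v)"
    by (simp add: mscale_mult_vec mpow_eigenvector[OF assms] power_mult_distrib scaleR_conv_of_real
        divide_inverse mult_ac)
  also have "\<dots> = exp (\<kappa> * \<theta>) *s v"
  proof -
    have "bounded_linear (\<lambda>c::complex. c *s v)"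
      unfolding linear_conv_bounded_linear[symmetric]
      by (auto simp: linear_iff vec_eq_iff algebra_simps)
    from bounded_linear.suminf[OF this summable_exp_generic]
    show ?thesis by (simp add: exp_def)
  qed
  finally show ?thesis by (simp add: qpow_def)
qed


section \<open>Quantum integers\<close>

text \<open>The quantum integer $[z]$ at complex \<open>z\<close>, as it occurs for eigenvalues of the Cartan generators.\<close>

definition qnum :: "complex \<Rightarrow> complex \<Rightarrow> complex"
  where "qnum \<kappa> z = (qpow \<kappa> z - qpow \<kappa> (- z)) / (exp \<kappa> - inverse (exp \<kappa>))"

lemma qpow_add: "qpow \<kappa> (a + b) = qpow \<kappa> a * qpow \<kappa> b"
  by (simp add: qpow_def exp_add distrib_left)

lemma qpow_minus: "qpow \<kappa> (- a) = inverse (qpow \<kappa> a)"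
  by (simp add: qpow_def exp_minus)

lemma qpow_diff: "qpow \<kappa> (a - b) = qpow \<kappa> a / qpow \<kappa> b"
  by (simp add: qpow_def exp_diff right_diff_distrib)

lemma qpow_nonzero [simp]: "qpow \<kappa> a \<noteq> 0"
  by (simp add: qpow_def)

lemma qpow_0 [simp]: "qpow \<kappa> 0 = 1" and qpow_1 [simp]: "qpow \<kappa> 1 = exp \<kappa>"
  by (simp_all add: qpow_def)

lemma qpow_of_nat: "qpow \<kappa> (of_nat k) = exp \<kappa> ^ k"
  by (simp add: qpow_def exp_of_nat2_mult)

lemma qint_eq_qnum: "qint \<kappa> k = qnum \<kappa> (of_nat k)"
  by (simp add: qint_def qnum_def qpow_minus qpow_of_nat power_inverse)

lemma qnum_0 [simp]: "qnum \<kappa> 0 = 0"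
  by (simp add: qnum_def)

text \<open>This identity is what makes the action on monomials compatible with the commutator of \<open>e\<^sub>i\<close> and
  \<open>f\<^sub>i\<close>, where $a=m_i$ and $b=m_{i+1}$.\<close>

lemma qnum_commutator:
  "qnum \<kappa> (a + 1) * qnum \<kappa> b + qnum \<kappa> (a - b) = qnum \<kappa> (b + 1) * qnum \<kappa> a"
proof (cases "exp \<kappa> - inverse (exp \<kappa>) = 0")
  case False
  define A B Q where "A = qpow \<kappa> a" and "B = qpow \<kappa> b" and "Q = exp \<kappa>"
  have nz: "A \<noteq> 0" "B \<noteq> 0" "Q \<noteq> 0" by (simp_all add: A_def B_def Q_def)
  have s: "Q - inverse Q \<noteq> 0" using False by (simp add: Q_def)
  have "(Q * A - inverse (Q * A)) * (B - inverse B) + (A / B - B / A) * (Q - inverse Q)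
      = (Q * B - inverse (Q * B)) * (A - inverse A)"
    using nz by (simp add: field_simps)
  moreover have "(A / B - B / A) / (Q - inverse Q)
      = (A / B - B / A) * (Q - inverse Q) / (Q - inverse Q)\<^sup>2"
    using s by (simp add: power2_eq_square)
  ultimately have "(Q * A - inverse (Q * A)) * (B - inverse B) / (Q - inverse Q)\<^sup>2
      + (A / B - B / A) / (Q - inverse Q)
      = (Q * B - inverse (Q * B)) * (A - inverse A) / (Q - inverse Q)\<^sup>2"
    by (simp flip: add_divide_distrib)
  moreover have "qnum \<kappa> (a + 1) = (Q * A - inverse (Q * A)) / (Q - inverse Q)"
      "qnum \<kappa> (b + 1) = (Q * B - inverse (Q * B)) / (Q - inverse Q)"
      "qnum \<kappa> a = (A - inverse A) / (Q - inverse Q)" "qnum \<kappa> b = (B - inverse B) / (Q - inverse Q)"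
      "qnum \<kappa> (a - b) = (A / B - B / A) / (Q - inverse Q)"
    unfolding qnum_def minus_diff_eq
    by (simp_all only: qpow_add qpow_minus qpow_diff qpow_1 A_def B_def Q_def mult.commute)
  ultimately show ?thesis by (simp only: times_divide_times_eq power2_eq_square)
qed (simp add: qnum_def)

text \<open>These identities turn the \<open>q\<close>-commutators that define the root vectors into a single power of \<open>q\<close>
  for each intermediate index.\<close>

lemma qnum_step:
  assumes "exp \<kappa> - inverse (exp \<kappa>) \<noteq> 0"
  shows "qnum \<kappa> (a + 1) - exp \<kappa> * qnum \<kappa> a = qpow \<kappa> (- a)"
    and "qnum \<kappa> (a + 1) - inverse (exp \<kappa>) * qnum \<kappa> a = qpow \<kappa> a"
proof -
  define A Q where "A = qpow \<kappa> a" and "Q = exp \<kappa>"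
  have nz: "A \<noteq> 0" "Q \<noteq> 0" by (simp_all add: A_def Q_def)
  have s: "Q - inverse Q \<noteq> 0" using assms by (simp add: Q_def)
  have q: "qnum \<kappa> (a + 1) = (Q * A - inverse (Q * A)) / (Q - inverse Q)"
       "qnum \<kappa> a = (A - inverse A) / (Q - inverse Q)" "qpow \<kappa> (- a) = inverse A"
    unfolding qnum_def
    by (simp_all only: qpow_add qpow_minus qpow_1 A_def Q_def mult.commute)
  have "(Q * A - inverse (Q * A)) - Q * (A - inverse A) = inverse A * (Q - inverse Q)"
    "(Q * A - inverse (Q * A)) - inverse Q * (A - inverse A) = A * (Q - inverse Q)"
    using nz by (simp_all add: field_simps)
  hence "((Q * A - inverse (Q * A)) - Q * (A - inverse A)) / (Q - inverse Q) = inverse A"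
    "((Q * A - inverse (Q * A)) - inverse Q * (A - inverse A)) / (Q - inverse Q) = A"
    using s by simp_all
  thus "qnum \<kappa> (a + 1) - exp \<kappa> * qnum \<kappa> a = qpow \<kappa> (- a)"
    "qnum \<kappa> (a + 1) - inverse (exp \<kappa>) * qnum \<kappa> a = qpow \<kappa> a"
    unfolding q Q_def[symmetric] A_def[symmetric] times_divide_eq_right
    by (simp_all only: diff_divide_distrib)
qed

locale not_root_of_unity =
  fixes \<kappa> :: complex
  assumes not_root_of_unity: "\<And>m. m > 0 \<Longrightarrow> exp \<kappa> ^ m \<noteq> 1"
begin

lemma q_diff_nonzero: "exp \<kappa> - inverse (exp \<kappa>) \<noteq> 0"
  using not_root_of_unity[of 2] by (auto simp: power2_eq_square field_simps)

lemma qnum_of_nat_nonzero: "k > 0 \<Longrightarrow> qnum \<kappa> (of_nat k) \<noteq> 0"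
  using not_root_of_unity[of "k + k"] q_diff_nonzero
  by (auto simp: qnum_def qpow_minus qpow_of_nat power_add field_simps)

end


section \<open>Monomial vectors of the quantum symmetric power\<close>

text \<open>A weight gives only the differences of an exponent; the degree fixes the remaining constant.\<close>

lemma determined_by_differences:
  fixes m m' :: "nat \<Rightarrow> 'a::{idom,ring_char_0}"
  assumes diff: "\<And>i. i \<in> {1..<n} \<Longrightarrow> m i - m (i + 1) = m' i - m' (i + 1)"
    and sum: "sum m {1..n} = sum m' {1..n}" and k: "k \<in> {1..n}"
  shows "m k = m' k"
proof -
  have const: "m j - m' j = m 1 - m' 1" if "j \<in> {1..n}" for j
    using that
  proof (induction j)
    case (Suc j)
    show ?case
    proof (cases "j = 0")
      case False
      hence "j \<in> {1..<n}" "j \<in> {1..n}" using Suc by auto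
      hence "m j - m' j = m 1 - m' 1" "m j - m (Suc j) = m' j - m' (Suc j)"
        using Suc diff[of j] by simp_all
      moreover have "m (Suc j) - m' (Suc j)
          = (m j - m' j) - ((m j - m (Suc j)) - (m' j - m' (Suc j)))"
        by (simp add: algebra_simps)
      ultimately show ?thesis by simp
    qed simp
  qed simp
  have "0 = (\<Sum>j\<in>{1..n}. m j - m' j)" using sum by (simp add: sum_subtractf)
  also have "\<dots> = (\<Sum>j\<in>{1..n}. m 1 - m' 1)" by (intro sum.cong const) auto
  finally have "m 1 - m' 1 = 0" using k by auto
  thus ?thesis using const[OF k] by simp
qed

text \<open>The generators of the quantum group act on the \<open>q\<close>-symmetric power, with a basis of monomials
  $x^m$ of degree \<open>N\<close>, by $e_i x^m=[m_{i+1}]x^{m+\epsilon_i-\epsilon_{i+1}}$ and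
  $f_i x^m=[m_i]x^{m-\epsilon_i+\epsilon_{i+1}}$.  The following relation is the submodule generated by
  $x_1^N\oplus v$ in the direct sum of this module with \<open>V\<close>, where \<open>v\<close> is the highest weight
  vector: the pairs of weight \<open>m\<close> are $c\,x^m\oplus x$.  It is generated by the lowering
  operators alone; closure under the raising operators is a consequence.  Irreducibility of \<open>V\<close>
  makes it the graph of a map, whose values on monomials are the vectors wanted in \<open>V\<close>.
  Exponents are integers here so that no boundary cases arise.\<close>

inductive monomial_graph ::
    "complex \<Rightarrow> nat \<Rightarrow> nat \<Rightarrow> 'd::finite action \<Rightarrow> complex^'d \<Rightarrow> (nat \<Rightarrow> int) \<Rightarrow> complex \<Rightarrow> complex^'d \<Rightarrow> bool"
  for \<kappa> n N V v where
  highest: "monomial_graph \<kappa> n N V v ((\<lambda>_. 0)(1 := int N)) 1 v"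
| lower: "monomial_graph \<kappa> n N V v m c x \<Longrightarrow> i \<in> {1..<n} \<Longrightarrow>
    monomial_graph \<kappa> n N V v (m(i := m i - 1, i + 1 := m (i + 1) + 1))
      (qnum \<kappa> (of_int (m i)) * c) (gen_f V i *v x)"
| zero: "monomial_graph \<kappa> n N V v m 0 0"
| add: "monomial_graph \<kappa> n N V v m c x \<Longrightarrow> monomial_graph \<kappa> n N V v m d z \<Longrightarrow>
    monomial_graph \<kappa> n N V v m (c + d) (x + z)"
| scale: "monomial_graph \<kappa> n N V v m c x \<Longrightarrow> monomial_graph \<kappa> n N V v m (b * c) (b *s x)"

text \<open>Shifting one unit of the exponent from \<open>j\<close> to \<open>i\<close>.\<close>

definition move_unit :: "nat \<Rightarrow> nat \<Rightarrow> (nat \<Rightarrow> nat) \<Rightarrow> nat \<Rightarrow> nat"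
  where "move_unit i j m = m(i := m i + 1, j := m j - 1)"

definition composition :: "nat \<Rightarrow> nat \<Rightarrow> (nat \<Rightarrow> nat) \<Rightarrow> bool"
  where "composition n N m \<longleftrightarrow> sum m {1..n} = N \<and> (\<forall>k. k \<notin> {1..n} \<longrightarrow> m k = 0)"

definition monomial_action :: "complex \<Rightarrow> nat \<Rightarrow> nat \<Rightarrow> 'd::finite action \<Rightarrow> ((nat \<Rightarrow> nat) \<Rightarrow> complex^'d) \<Rightarrow> bool"
  where "monomial_action \<kappa> n N V u \<longleftrightarrow>
    vec.span (range u) = UNIV
  \<and> (\<forall>m. \<not> composition n N m \<longrightarrow> u m = 0)
  \<and> (\<forall>i\<in>{1..<n}. \<forall>m.
       gen_e V i *v u m = qnum \<kappa> (of_nat (m (i + 1))) *s u (move_unit i (i + 1) m)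
     \<and> gen_f V i *v u m = qnum \<kappa> (of_nat (m i)) *s u (move_unit (i + 1) i m)
     \<and> gen_h V i *v u m = (of_nat (m i) - of_nat (m (i + 1))) *s u m)"

lemma finite_sum_fun_upd:
  fixes f :: "nat \<Rightarrow> 'a::ab_group_add"
  assumes "finite A" "a \<in> A"
  shows "sum (f(a := z)) A = sum f A - f a + z"
proof -
  have "sum (f(a := z)) (A - {a}) = sum f (A - {a})" by (rule sum.cong) auto
  thus ?thesis using assms by (simp add: sum.remove[of A a])
qed

lemma finite_sum_fun_upd2:
  fixes f :: "nat \<Rightarrow> 'a::ab_group_add"
  assumes "finite A" "a \<in> A" "b \<in> A" "a \<noteq> b"
  shows "sum (f(a := x, b := z)) A = sum f A - f a - f b + x + z"
proof -
  have "sum (f(a := x, b := z)) A = sum (f(a := x)) A - (f(a := x)) b + z"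
    by (rule finite_sum_fun_upd) (use assms in auto)
  also have "sum (f(a := x)) A = sum f A - f a + x"
    by (rule finite_sum_fun_upd) (use assms in auto)
  also have "(f(a := x)) b = f b" using assms by simp
  finally show ?thesis by (simp only: algebra_simps)
qed

lemma composition_move_unit:
  assumes "i \<in> {1..n}" "j \<in> {1..n}" "i \<noteq> j" "m j > 0"
  shows "composition n N (move_unit i j m) \<longleftrightarrow> composition n N m"
proof -
  have "int (sum (move_unit i j m) {1..n})
      = sum ((\<lambda>k. int (m k))(i := int (m i) + 1, j := int (m j) - 1)) {1..n}"
    unfolding of_nat_sum using assms by (intro sum.cong) (auto simp: move_unit_def of_nat_diff)
  also have "\<dots> = int (sum m {1..n})"
    using assms by (subst finite_sum_fun_upd2) auto
  finally have "sum (move_unit i j m) {1..n} = sum m {1..n}" by (simp only: of_nat_eq_iff)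
  moreover have "(\<forall>k. k \<notin> {1..n} \<longrightarrow> move_unit i j m k = 0) \<longleftrightarrow> (\<forall>k. k \<notin> {1..n} \<longrightarrow> m k = 0)"
    using assms by (auto simp: move_unit_def)
  ultimately show ?thesis by (simp add: composition_def)
qed

locale highest_weight_vector = not_root_of_unity +
  fixes n N :: nat and V :: "'d::finite action" and v :: "complex^'d"
  assumes n: "n \<ge> 2" and rep: "uq_rep n \<kappa> V" and irred: "irreducible_rep n V"
    and v_nonzero: "v \<noteq> 0"
    and v_weight: "v \<in> weight_space n V (\<lambda>i. if i = 1 then of_nat N else 0)"
    and v_highest: "\<And>i. i \<in> {1..<n} \<Longrightarrow> gen_e V i *v v = 0"
    and v_generates: "\<And>W. invariant_subspace n V W \<Longrightarrow> v \<in> W \<Longrightarrow> W = UNIV"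
begin

abbreviation graph :: "(nat \<Rightarrow> int) \<Rightarrow> complex \<Rightarrow> complex^'d \<Rightarrow> bool"
  where "graph \<equiv> monomial_graph \<kappa> n N V v"

abbreviation top_exponent :: "nat \<Rightarrow> int"
  where "top_exponent \<equiv> (\<lambda>_. 0)(1 := int N)"

lemma graph_weight:
  "graph m c x \<Longrightarrow> i \<in> {1..<n} \<Longrightarrow> gen_h V i *v x = of_int (m i - m (i + 1)) *s x"
proof (induction arbitrary: i rule: monomial_graph.induct)
  case highest
  thus ?case using v_weight by (auto simp: weight_space_def)
next
  case (lower m c x j)
  have "comm (gen_h V i) (gen_f V j) = (- cartan i j) *\<^sub>M gen_f V j"
    using rep lower unfolding uq_rep_def by blast
  from arg_cong[OF this, of "\<lambda>A. A *v x"]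
  have "gen_h V i *v (gen_f V j *v x) = gen_f V j *v (gen_h V i *v x) - cartan i j *s (gen_f V j *v x)"
    by (simp add: comm_apply op_simps algebra_simps)
  also have "gen_h V i *v x = of_int (m i - m (i + 1)) *s x" by (rule lower.IH) (rule lower.prems)
  finally have *: "gen_h V i *v (gen_f V j *v x) =
      (of_int (m i - m (i + 1)) - cartan i j) *s (gen_f V j *v x)"
    by (simp only: vec.scale vec.scale_left_diff_distrib)
  consider "i = j" | "i = j + 1" | "j = i + 1" | "i \<noteq> j" "i \<noteq> j + 1" "j \<noteq> i + 1" by blast
  thus ?case unfolding * by cases (simp_all add: cartan_def algebra_simps)
next
  case (scale m c x b)
  show ?case
    by (simp only: vec.scale scale.IH[OF scale.prems] vec.scale_scale mult.commute)
next
  case (add m c x d z)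
  show ?case
    using add.IH[OF add.prems] by (simp only: vec.add vector_add_ldistrib)
qed simp

text \<open>Each lowering operator increases $\sum_k k\,m_k$ by one, so in the weight of $x_1^N$ only the pairs
  $c\,(x_1^N\oplus v)$ occur.\<close>

lemma graph_exponent:
  "graph m c x \<Longrightarrow> c = 0 \<and> x = 0 \<or> sum m {1..n} = int N \<and> (\<Sum>k\<in>{1..n}. int k * m k) \<ge> int N
     \<and> (\<forall>k. k \<notin> {1..n} \<longrightarrow> m k = 0) \<and> (m = top_exponent \<longrightarrow> x = c *s v)"
proof (induction rule: monomial_graph.induct)
  case highest
  have "sum top_exponent {1..n} = int N"
    by (subst finite_sum_fun_upd) (use n in auto)
  moreover have "(\<Sum>k\<in>{1..n}. int k * top_exponent k) = (\<Sum>k\<in>{1..n}. top_exponent k)"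
    by (rule sum.cong) auto
  ultimately show ?case using n by auto
next
  case (lower m c x i)
  show ?case
  proof (cases "c = 0 \<and> x = 0")
    case False
    let ?m = "m(i := m i - 1, i + 1 := m (i + 1) + 1)"
    have total: "sum ?m {1..n} = sum m {1..n}"
      using lower.hyps by (subst finite_sum_fun_upd2) auto
    have depth: "(\<Sum>k\<in>{1..n}. int k * ?m k) = (\<Sum>k\<in>{1..n}. int k * m k) + 1"
    proof -
      have "(\<Sum>k\<in>{1..n}. int k * ?m k) =
          sum ((\<lambda>k. int k * m k)(i := int i * (m i - 1), i + 1 := int (i + 1) * (m (i + 1) + 1))) {1..n}"
        by (rule sum.cong) auto
      also have "\<dots> = (\<Sum>k\<in>{1..n}. int k * m k) + 1"
        using lower.hyps by (subst finite_sum_fun_upd2) (auto simp: algebra_simps)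
      finally show ?thesis .
    qed
    have not_top: "?m \<noteq> top_exponent"
    proof
      assume "?m = top_exponent"
      hence "(\<Sum>k\<in>{1..n}. int k * ?m k) = (\<Sum>k\<in>{1..n}. int k * top_exponent k)" by simp
      also have "\<dots> = (\<Sum>k\<in>{1..n}. top_exponent k)" by (rule sum.cong) auto
      also have "\<dots> = int N" by (subst finite_sum_fun_upd) (use n in auto)
      finally show False using depth lower.IH False by linarith
    qed
    have supp: "?m k = 0" if "k \<notin> {1..n}" for k
      using lower.IH False lower.hyps that by auto
    have "sum ?m {1..n} = int N" "(\<Sum>k\<in>{1..n}. int k * ?m k) \<ge> int N"
      using lower.IH False total depth by linarith+
    thus ?thesis using not_top supp by blast
  qed simp
qed (auto simp: algebra_simps)

lemma gen_e_gen_f: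
  assumes i: "i \<in> {1..<n}" and j: "j \<in> {1..<n}" and x: "gen_h V i *v x = a *s x"
  shows "gen_e V i *v (gen_f V j *v x) =
    gen_f V j *v (gen_e V i *v x) + (if i = j then qnum \<kappa> a else 0) *s x"
proof -
  have "comm (gen_e V i) (gen_f V j) = (if i = j
          then (1 / (exp \<kappa> - inverse (exp \<kappa>))) *\<^sub>M
                 (op_qpow \<kappa> (gen_h V i) - op_qpow \<kappa> (- gen_h V i)) else 0)"
    using rep i j unfolding uq_rep_def by blast
  from arg_cong[OF this, of "\<lambda>A. A *v x"]
  have "gen_e V i *v (gen_f V j *v x) - gen_f V j *v (gen_e V i *v x) = (if i = j
     then (1 / (exp \<kappa> - inverse (exp \<kappa>))) *s (op_qpow \<kappa> (gen_h V i) *v x - op_qpow \<kappa> (- gen_h V i) *v x) else 0)"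
    by (simp add: comm_apply op_simps)
  also have "op_qpow \<kappa> (gen_h V i) *v x = qpow \<kappa> a *s x"
    by (rule op_qpow_eigenvector[OF x])
  also have "op_qpow \<kappa> (- gen_h V i) *v x = qpow \<kappa> (- a) *s x"
    by (rule op_qpow_eigenvector) (simp add: op_simps x vec.scale_minus_left)
  also have "(if i = j then (1 / (exp \<kappa> - inverse (exp \<kappa>))) *s (qpow \<kappa> a *s x - qpow \<kappa> (- a) *s x) else 0)
      = (if i = j then qnum \<kappa> a else 0) *s x"
    by (simp add: qnum_def vec_eq_iff diff_divide_distrib left_diff_distrib)
  finally show ?thesis by (simp add: eq_diff_eq diff_eq_eq add.commute)
qed

text \<open>The induction moves \<open>e\<^sub>i\<close> to the right of the last lowering operator \<open>f\<^sub>j\<close>.  For \<open>i = j\<close> the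
  commutator contributes \<open>[m\<^sub>i - m\<^sub>i\<^sub>+\<^sub>1]\<close>, and the coefficients combine by the identity
  \<open>qnum_commutator\<close>.\<close>

lemma graph_raise:
  "graph m c x \<Longrightarrow> i \<in> {1..<n} \<Longrightarrow>
     graph (m(i := m i + 1, i + 1 := m (i + 1) - 1)) (qnum \<kappa> (of_int (m (i + 1))) * c) (gen_e V i *v x)"
proof (induction rule: monomial_graph.induct)
  case highest
  thus ?case using v_highest[of i] by (auto intro!: monomial_graph.zero)
next
  case (lower m c x j)
  let ?a = "of_int (m i - m (i + 1)) :: complex"
  let ?m = "m(i := m i + 1, i + 1 := m (i + 1) - 1)"
  let ?m' = "m(j := m j - 1, j + 1 := m (j + 1) + 1)"
  have wt: "gen_h V i *v x = ?a *s x" by (rule graph_weight) (use lower in auto)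
  note ef = gen_e_gen_f[OF lower.prems lower.hyps(2) wt]
  note IH = monomial_graph.lower[OF lower.IH[OF lower.prems] lower.hyps(2)]
  show ?case
  proof (cases "i = j")
    case True
    hence ij: "j = i" by simp
    have up: "?m(i := ?m i - 1, i + 1 := ?m (i + 1) + 1) = m" by (rule ext) simp
    have coeff: "of_int (?m i) = (of_int (m i) + 1 :: complex)" by simp
    have down: "(m(i := m i - 1, i + 1 := m (i + 1) + 1))
       (i := (m(i := m i - 1, i + 1 := m (i + 1) + 1)) i + 1,
        i + 1 := (m(i := m i - 1, i + 1 := m (i + 1) + 1)) (i + 1) - 1) = m" by (rule ext) simp
    have target: "of_int ((m(i := m i - 1, i + 1 := m (i + 1) + 1)) (i + 1)) = (of_int (m (i + 1)) + 1 :: complex)"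
      by simp
    have "graph m (qnum \<kappa> (of_int (m i) + 1) * (qnum \<kappa> (of_int (m (i + 1))) * c)) (gen_f V i *v (gen_e V i *v x))"
      using IH unfolding ij up coeff .
    from monomial_graph.add[OF this monomial_graph.scale[OF lower.hyps(1), of "qnum \<kappa> ?a"]]
    have "graph m ((qnum \<kappa> (of_int (m i) + 1) * qnum \<kappa> (of_int (m (i + 1))) + qnum \<kappa> ?a) * c)
        (gen_e V i *v (gen_f V i *v x))"
      using ef unfolding ij by (simp only: simp_thms if_True distrib_right mult.assoc)
    thus ?thesis
      using qnum_commutator[of \<kappa> "of_int (m i)" "of_int (m (i + 1))"]
      unfolding ij down target by (simp only: of_int_diff mult.assoc)
  next
    case False
    have m: "?m(j := ?m j - 1, j + 1 := ?m (j + 1) + 1) = ?m'(i := ?m' i + 1, i + 1 := ?m' (i + 1) - 1)"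
      using False by (auto simp: fun_eq_iff)
    have c: "qnum \<kappa> (of_int (?m j)) * (qnum \<kappa> (of_int (m (i + 1))) * c)
        = qnum \<kappa> (of_int (?m' (i + 1))) * (qnum \<kappa> (of_int (m j)) * c)"
    proof (cases "j = i + 1")
      case False
      hence "?m j = m j" "?m' (i + 1) = m (i + 1)" using \<open>i \<noteq> j\<close> by auto
      thus ?thesis by (simp only: mult.left_commute)
    qed simp
    have "gen_e V i *v (gen_f V j *v x) = gen_f V j *v (gen_e V i *v x)"
      using ef False by (simp only: if_False vec.scale_zero_left add_0_right)
    thus ?thesis using IH unfolding m c by (simp only:)
  qed
next
  case (add m c x d z)
  from monomial_graph.add[OF add.IH[OF add.prems]] show ?case
    by (simp only: vec.add distrib_left)
next
  case (scale m c x b)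
  from monomial_graph.scale[OF scale.IH[OF scale.prems], of b] show ?case
    by (simp only: vec.scale mult.left_commute)
qed (simp add: monomial_graph.zero)

text \<open>The kernel of the projection of the graph to the symmetric power is an invariant
  subspace of \<open>V\<close> without a component of highest weight, hence zero.\<close>

lemma graph_kernel:
  assumes "graph m 0 x"
  shows "x = 0"
proof -
  define E where "E = {x. \<exists>m. graph m 0 x}"
  have E: "gen_e V i *v x \<in> E" "gen_f V i *v x \<in> E" "gen_h V i *v x \<in> E"
    if i: "i \<in> {1..<n}" and x: "x \<in> E" for i x
  proof -
    obtain m where g: "graph m 0 x" using x unfolding E_def by blast
    show "gen_e V i *v x \<in> E" using graph_raise[OF g i] by (auto simp: E_def)
    show "gen_f V i *v x \<in> E" using monomial_graph.lower[OF g i] by (auto simp: E_def)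
    show "gen_h V i *v x \<in> E"
      using monomial_graph.scale[OF g, of "of_int (m i - m (i + 1))"]
      by (auto simp: E_def graph_weight[OF g i])
  qed
  have "invariant_subspace n V (vec.span E)"
    unfolding invariant_subspace_def
  proof (intro conjI ballI)
    fix i w assume i: "i \<in> {1..<n}" and w: "w \<in> vec.span E"
    have "A *v w \<in> vec.span E" if "\<And>x. x \<in> E \<Longrightarrow> A *v x \<in> E" for A
      using w by (induction rule: vec.span_induct_alt)
        (auto simp: vec.add op_simps intro!: vec.span_zero vec.span_add vec.span_scale that[THEN vec.span_base])
    thus "gen_e V i *v w \<in> vec.span E" "gen_f V i *v w \<in> vec.span E" "gen_h V i *v w \<in> vec.span E"
      using E i by blast+
  qed (rule vec.subspace_span)
  hence "vec.span E = {0} \<or> vec.span E = UNIV"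
    using irred unfolding irreducible_rep_def by blast
  moreover have "vec.span E \<noteq> UNIV"
  proof
    assume "vec.span E = UNIV"
    moreover have "\<exists>\<mu>. x \<in> joint_eigenspace {1..<n} (gen_h V) \<mu>" if "x \<in> E" for x
    proof -
      obtain m where "graph m 0 x" using \<open>x \<in> E\<close> unfolding E_def by blast
      thus ?thesis using graph_weight[of m 0 x] unfolding joint_eigenspace_def
        by (intro exI[of _ "\<lambda>i. of_int (m i - m (i + 1))"]) simp
    qed
    ultimately have sp: "eigen_spanning {1..<n} (gen_h V) E"
      unfolding eigen_spanning_def by blast
    let ?\<Lambda> = "\<lambda>i. if i = 1 then of_nat N else 0"
    have "v \<in> vec.span (E \<inter> joint_eigenspace {1..<n} (gen_h V) ?\<Lambda>)"
      using joint_eigenspace_subset_span[OF sp] v_weight unfolding weight_space_eq by blast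
    moreover have "E \<inter> joint_eigenspace {1..<n} (gen_h V) ?\<Lambda> \<subseteq> {0}"
    proof (rule ccontr)
      assume "\<not> ?thesis"
      then obtain x m where x: "x \<noteq> 0" "graph m 0 x"
          and wt: "x \<in> joint_eigenspace {1..<n} (gen_h V) ?\<Lambda>"
        by (auto simp: E_def)
      have sum: "sum m {1..n} = int N" and supp: "m = top_exponent \<longrightarrow> x = 0"
        using graph_exponent[OF x(2)] x(1) by auto
      have "m k = top_exponent k" if "k \<in> {1..n}" for k
      proof (rule determined_by_differences[OF _ _ that])
        show "m i - m (i + 1) = top_exponent i - top_exponent (i + 1)" if "i \<in> {1..<n}" for i
        proof -
          have "of_int (m i - m (i + 1)) = (if i = 1 then of_nat N else 0 :: complex)"
            by (rule joint_eigenvalue_unique[of x "{1..<n}" "gen_h V" "\<lambda>i. of_int (m i - m (i + 1))"])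
               (use x wt that graph_weight[OF x(2)] in \<open>auto simp: joint_eigenspace_def\<close>)
          also have "\<dots> = of_int (top_exponent i - top_exponent (i + 1))" using that by simp
          finally show ?thesis by (simp only: of_int_eq_iff)
        qed
        show "sum m {1..n} = sum top_exponent {1..n}"
          unfolding sum by (subst finite_sum_fun_upd) (use n in auto)
      qed
      moreover have "m k = 0" if "k \<notin> {1..n}" for k
        using graph_exponent[OF x(2)] x(1) that by blast
      moreover have "top_exponent k = 0" if "k \<notin> {1..n}" for k
        using n that by auto
      ultimately have "m = top_exponent" by (intro ext) metis
      thus False using supp x(1) by simp
    qed
    ultimately show False
      using v_nonzero vec.span_mono[of _ "{0}"] by auto
  qed
  moreover have "x \<in> vec.span E" using assms by (auto simp: E_def intro: vec.span_base)
  ultimately show ?thesis by auto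
qed

lemma graph_functional:
  assumes "graph m c x" "graph m c z"
  shows "x = z"
proof -
  have "graph m (c + - 1 * c) (x + (- 1) *s z)"
    by (intro monomial_graph.add monomial_graph.scale assms)
  hence "graph m 0 (x - z)" by simp
  from graph_kernel[OF this] show ?thesis by simp
qed

text \<open>A monomial with \<open>m\<^sub>i\<^sub>+\<^sub>1 > 0\<close> is reached by \<open>f\<^sub>i\<close> from a monomial closer to $x_1^N$, with a coefficient
  $[m_i+1]\neq 0$ since \<open>q\<close> is not a root of unity.\<close>

lemma graph_total: "composition n N m \<Longrightarrow> \<exists>x. graph (\<lambda>k. int (m k)) 1 x"
proof (induction "\<Sum>k\<in>{1..n}. k * m k" arbitrary: m rule: less_induct)
  case less
  show ?case
  proof (cases "\<exists>i\<in>{1..<n}. m (i + 1) > 0")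
    case False
    have zero: "m k = 0" if "k \<noteq> 1" for k
    proof (cases "k \<in> {1..n}")
      case True
      hence "k - 1 \<in> {1..<n}" "k - 1 + 1 = k" using that by auto
      thus ?thesis using False by (metis not_gr_zero)
    qed (use less.prems in \<open>auto simp: composition_def\<close>)
    hence "sum m {1..n} = (\<Sum>k\<in>{1}. m k)"
      using n by (intro sum.mono_neutral_right) auto
    hence "m 1 = N" using less.prems by (simp add: composition_def)
    hence "(\<lambda>k. int (m k)) = top_exponent" using zero by (auto simp: fun_eq_iff)
    thus ?thesis using monomial_graph.highest by metis
  next
    case True
    then obtain i where i: "i \<in> {1..<n}" and pos: "m (i + 1) > 0" by blast
    let ?m = "move_unit i (i + 1) m"
    have "composition n N ?m"
      using less.prems i pos by (subst composition_move_unit) auto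
    moreover have "(\<Sum>k\<in>{1..n}. k * ?m k) < (\<Sum>k\<in>{1..n}. k * m k)"
    proof -
      have "int (\<Sum>k\<in>{1..n}. k * ?m k) =
          sum ((\<lambda>k. int (k * m k))(i := int i * (int (m i) + 1), i + 1 := int (i + 1) * (int (m (i + 1)) - 1))) {1..n}"
        unfolding of_nat_sum using pos by (intro sum.cong) (auto simp: move_unit_def of_nat_diff)
      also have "\<dots> = int (\<Sum>k\<in>{1..n}. k * m k) - 1"
        using i by (subst finite_sum_fun_upd2) (auto simp: algebra_simps)
      finally show ?thesis by linarith
    qed
    ultimately obtain x where x: "graph (\<lambda>k. int (?m k)) 1 x" using less.hyps by blast
    have m: "(\<lambda>k. int (?m k))(i := int (?m i) - 1, i + 1 := int (?m (i + 1)) + 1) = (\<lambda>k. int (m k))"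
      using pos by (auto simp: move_unit_def fun_eq_iff of_nat_diff)
    have "graph (\<lambda>k. int (m k)) (qnum \<kappa> (of_int (int (?m i))) * 1) (gen_f V i *v x)"
      using monomial_graph.lower[OF x i] unfolding m .
    moreover have "?m i = m i + 1" by (simp add: move_unit_def)
    ultimately have "graph (\<lambda>k. int (m k)) (qnum \<kappa> (of_nat (m i + 1))) (gen_f V i *v x)"
      by simp
    from monomial_graph.scale[OF this, of "inverse (qnum \<kappa> (of_nat (m i + 1)))"]
    show ?thesis using qnum_of_nat_nonzero[of "m i + 1"] by auto
  qed
qed

theorem monomial_action_exists: "\<exists>u. monomial_action \<kappa> n N V u"
proof -
  define u where "u m = (if composition n N m then SOME x. graph (\<lambda>k. int (m k)) 1 x else 0)" for m
  have u: "graph (\<lambda>k. int (m k)) 1 (u m)" if "composition n N m" for m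
    using someI_ex[OF graph_total[OF that]] that by (simp add: u_def)
  have u0: "u m = 0" if "\<not> composition n N m" for m
    using that by (simp add: u_def)
  have e: "gen_e V i *v u m = qnum \<kappa> (of_nat (m (i + 1))) *s u (move_unit i (i + 1) m)"
    if i: "i \<in> {1..<n}" for i m
  proof (cases "composition n N m")
    case True
    note raised = graph_raise[OF u[OF True] i]
    show ?thesis
    proof (cases "m (i + 1) = 0")
      case True
      thus ?thesis using graph_kernel raised by simp
    next
      case pos: False
      let ?m = "move_unit i (i + 1) m"
      have "composition n N ?m" using True i pos by (subst composition_move_unit) auto
      note target = monomial_graph.scale[OF u[OF this], of "qnum \<kappa> (of_nat (m (i + 1)))"]
      have "(\<lambda>k. int (m k))(i := int (m i) + 1, i + 1 := int (m (i + 1)) - 1) = (\<lambda>k. int (?m k))"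
        using pos by (auto simp: move_unit_def fun_eq_iff of_nat_diff)
      hence "graph (\<lambda>k. int (?m k)) (qnum \<kappa> (of_nat (m (i + 1))) * 1) (gen_e V i *v u m)"
        using raised by simp
      thus ?thesis using target by (rule graph_functional)
    qed
  next
    case False
    have "qnum \<kappa> (of_nat (m (i + 1))) = 0 \<or> u (move_unit i (i + 1) m) = 0"
    proof (cases "m (i + 1) = 0")
      case pos: False
      thus ?thesis using False i by (intro disjI2 u0) (subst composition_move_unit, auto)
    qed simp
    thus ?thesis using False by (auto simp: u0)
  qed
  have f: "gen_f V i *v u m = qnum \<kappa> (of_nat (m i)) *s u (move_unit (i + 1) i m)"
    if i: "i \<in> {1..<n}" for i m
  proof (cases "composition n N m")
    case True
    note lowered = monomial_graph.lower[OF u[OF True] i]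
    show ?thesis
    proof (cases "m i = 0")
      case True
      thus ?thesis using graph_kernel lowered by simp
    next
      case pos: False
      let ?m = "move_unit (i + 1) i m"
      have "composition n N ?m" using True i pos by (subst composition_move_unit) auto
      note target = monomial_graph.scale[OF u[OF this], of "qnum \<kappa> (of_nat (m i))"]
      have "(\<lambda>k. int (m k))(i := int (m i) - 1, i + 1 := int (m (i + 1)) + 1) = (\<lambda>k. int (?m k))"
        using pos by (auto simp: move_unit_def fun_eq_iff of_nat_diff)
      hence "graph (\<lambda>k. int (?m k)) (qnum \<kappa> (of_nat (m i)) * 1) (gen_f V i *v u m)"
        using lowered by simp
      thus ?thesis using target by (rule graph_functional)
    qed
  next
    case False
    have "qnum \<kappa> (of_nat (m i)) = 0 \<or> u (move_unit (i + 1) i m) = 0"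
    proof (cases "m i = 0")
      case pos: False
      thus ?thesis using False i by (intro disjI2 u0) (subst composition_move_unit, auto)
    qed simp
    thus ?thesis using False by (auto simp: u0)
  qed
  have h: "gen_h V i *v u m = (of_nat (m i) - of_nat (m (i + 1))) *s u m"
    if i: "i \<in> {1..<n}" for i m
    using graph_weight[OF u i] u0[of m] by (cases "composition n N m") simp_all
  have "vec.span (range u) = UNIV"
  proof (rule v_generates)
    show "invariant_subspace n V (vec.span (range u))"
      unfolding invariant_subspace_def
    proof (intro conjI ballI)
      fix i w assume i: "i \<in> {1..<n}" and w: "w \<in> vec.span (range u)"
      have "A *v w \<in> vec.span (range u)" if A: "\<And>m. \<exists>c m'. A *v u m = c *s u m'" for A
        using w
      proof (induction rule: vec.span_induct_alt)
        case (step c x z)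
        then obtain m where "x = u m" by blast
        then obtain d m' where "A *v x = d *s u m'" using A by blast
        moreover have "d *s u m' \<in> vec.span (range u)"
          by (intro vec.span_scale vec.span_base) simp
        ultimately show ?case using step
          by (simp only: vec.add vec.scale vec.span_add vec.span_scale)
      qed (simp add: vec.span_zero)
      thus "gen_e V i *v w \<in> vec.span (range u)" "gen_f V i *v w \<in> vec.span (range u)"
          "gen_h V i *v w \<in> vec.span (range u)"
        using e[OF i] f[OF i] h[OF i] by blast+
    qed (rule vec.subspace_span)
    let ?t = "\<lambda>k. nat (top_exponent k)"
    have t: "(\<lambda>k. int (?t k)) = top_exponent" by auto
    have "sum ?t {1..n} = (\<Sum>k\<in>{1}. ?t k)"
      using n by (intro sum.mono_neutral_right) auto
    hence "composition n N ?t" using n by (auto simp: composition_def)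
    from u[OF this] have "u ?t = v"
      unfolding t using graph_functional monomial_graph.highest by blast
    thus "v \<in> vec.span (range u)" by (metis rangeI vec.span_base)
  qed
  thus ?thesis using u0 e f h unfolding monomial_action_def by blast
qed

end


section \<open>Root vectors on monomials\<close>

lemma move_unit_trans:
  assumes "i \<noteq> j" "j \<noteq> k" "i \<noteq> k"
  shows "move_unit i j (move_unit j k m) = move_unit i k m"
  using assms by (auto simp: move_unit_def fun_eq_iff)

lemma move_unit_trans':
  assumes "i \<noteq> j" "j \<noteq> k" "i \<noteq> k" "m j > 0"
  shows "move_unit j k (move_unit i j m) = move_unit i k m"
  using assms by (auto simp: move_unit_def fun_eq_iff)

lemma greaterThanLessThan_Suc_eq: "i < j \<Longrightarrow> {i<..<Suc j} = insert j {i<..<j}" for i j :: nat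
  by auto

text \<open>Both terms of the \<open>q\<close>-commutator in the recursion yield the same monomial.  The exponent \<open>m\<^sub>j\<close>
  enters one of them after and the other before it is increased, and the difference of the coefficients
  is $[m_j+1]-q[m_j]=q^{-m_j}$, respectively $[m_j+1]-q^{-1}[m_j]=q^{m_j}$ for the lowering operators.\<close>

lemma root_vectors_on_monomials:
  assumes u: "monomial_action \<kappa> n N V u" and q: "exp \<kappa> - inverse (exp \<kappa>) \<noteq> 0"
    and ij: "1 \<le> i" "i < j" "j \<le> n"
  shows "root_e \<kappa> V i j *v u m =
           (qpow \<kappa> (- (\<Sum>s\<in>{i<..<j}. of_nat (m s))) * qnum \<kappa> (of_nat (m j))) *s u (move_unit i j m)"
    and "root_f \<kappa> V i j *v u m =
           (qpow \<kappa> (\<Sum>s\<in>{i<..<j}. of_nat (m s)) * qnum \<kappa> (of_nat (m i))) *s u (move_unit j i m)"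
proof -
  have e: "gen_e V i *v u m = qnum \<kappa> (of_nat (m (i + 1))) *s u (move_unit i (i + 1) m)"
    and f: "gen_f V i *v u m = qnum \<kappa> (of_nat (m i)) *s u (move_unit (i + 1) i m)"
    if "i \<in> {1..<n}" for i m
    using u that unfolding monomial_action_def by blast+
  have "(\<forall>m. root_e \<kappa> V i j *v u m =
           (qpow \<kappa> (- (\<Sum>s\<in>{i<..<j}. of_nat (m s))) * qnum \<kappa> (of_nat (m j))) *s u (move_unit i j m))
    \<and> (\<forall>m. root_f \<kappa> V i j *v u m =
           (qpow \<kappa> (\<Sum>s\<in>{i<..<j}. of_nat (m s)) * qnum \<kappa> (of_nat (m i))) *s u (move_unit j i m))"
    using ij(2,3)
  proof (induction j)
    case (Suc j)
    show ?case
    proof (cases "j = i")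
      case True
      have empty: "{i<..<Suc i} = {}" by auto
      have "i \<in> {1..<n}" using Suc.prems ij by auto
      thus ?thesis using e[of i] f[of i] by (simp add: True empty)
    next
      case False
      hence ij': "i < j" "j \<in> {1..<n}" using Suc.prems ij by auto
      let ?S = "\<lambda>m. \<Sum>s\<in>{i<..<j}. of_nat (m s) :: complex"
      have IHe: "root_e \<kappa> V i j *v u m =
           (qpow \<kappa> (- ?S m) * qnum \<kappa> (of_nat (m j))) *s u (move_unit i j m)"
        and IHf: "root_f \<kappa> V i j *v u m =
           (qpow \<kappa> (?S m) * qnum \<kappa> (of_nat (m i))) *s u (move_unit j i m)" for m
        using Suc.IH ij' by auto
      have S_e: "?S (move_unit j (Suc j) m) = ?S m" for m
        by (rule sum.cong) (auto simp: move_unit_def)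
      have S_f: "?S (move_unit (Suc j) j m) = ?S m" for m
        by (rule sum.cong) (auto simp: move_unit_def)
      have S: "(\<Sum>s\<in>{i<..<Suc j}. of_nat (m s)) = of_nat (m j) + ?S m" for m
        using ij' by (simp add: greaterThanLessThan_Suc_eq)
      show ?thesis
      proof (intro conjI allI)
        fix m
        let ?t = "u (move_unit i (Suc j) m)"
        have 1: "root_e \<kappa> V i j *v (gen_e V j *v u m) =
            (qnum \<kappa> (of_nat (m (Suc j))) * (qpow \<kappa> (- ?S m) * qnum \<kappa> (of_nat (m j) + 1))) *s ?t"
        proof -
          have "of_nat (move_unit j (Suc j) m j) = (of_nat (m j) + 1 :: complex)"
            by (simp add: move_unit_def)
          moreover have "move_unit i j (move_unit j (Suc j) m) = move_unit i (Suc j) m"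
            using ij' by (intro move_unit_trans) auto
          ultimately show ?thesis
            by (simp only: e[OF ij'(2)] IHe S_e vec.scale vec.scale_scale Suc_eq_plus1[symmetric])
        qed
        have 2: "gen_e V j *v (root_e \<kappa> V i j *v u m) =
            (qnum \<kappa> (of_nat (m (Suc j))) * (qpow \<kappa> (- ?S m) * qnum \<kappa> (of_nat (m j)))) *s ?t"
        proof (cases "m j = 0")
          case False
          have "move_unit i j m (Suc j) = m (Suc j)" using ij' by (simp add: move_unit_def)
          moreover have "move_unit j (Suc j) (move_unit i j m) = move_unit i (Suc j) m"
            using ij' False by (intro move_unit_trans') auto
          ultimately show ?thesis
            by (simp only: e[OF ij'(2)] IHe vec.scale vec.scale_scale Suc_eq_plus1[symmetric] mult_ac)
        qed (simp add: IHe)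
        have "root_e \<kappa> V i (Suc j) *v u m =
            root_e \<kappa> V i j *v (gen_e V j *v u m) - exp \<kappa> *s (gen_e V j *v (root_e \<kappa> V i j *v u m))"
          using False by (simp add: matrix_vector_mult_diff_rdistrib mscale_mult_vec flip: matrix_vector_mul_assoc)
        also have "\<dots> = (qnum \<kappa> (of_nat (m (Suc j))) * qpow \<kappa> (- ?S m)
            * (qnum \<kappa> (of_nat (m j) + 1) - exp \<kappa> * qnum \<kappa> (of_nat (m j)))) *s ?t"
          unfolding 1 2 by (simp only: vec.scale_scale vec.scale_left_diff_distrib[symmetric] right_diff_distrib mult_ac)
        also have "\<dots> = (qpow \<kappa> (- (\<Sum>s\<in>{i<..<Suc j}. of_nat (m s))) * qnum \<kappa> (of_nat (m (Suc j)))) *s ?t"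
          unfolding qnum_step(1)[OF q] S minus_add_distrib qpow_add by (simp only: mult_ac)
        finally show "root_e \<kappa> V i (Suc j) *v u m = \<dots>" .
      next
        fix m
        let ?t = "u (move_unit (Suc j) i m)"
        have 1: "gen_f V j *v (root_f \<kappa> V i j *v u m) =
            (qnum \<kappa> (of_nat (m i)) * (qpow \<kappa> (?S m) * qnum \<kappa> (of_nat (m j) + 1))) *s ?t"
        proof -
          have "of_nat (move_unit j i m j) = (of_nat (m j) + 1 :: complex)"
            using ij' by (simp add: move_unit_def)
          moreover have "move_unit (Suc j) j (move_unit j i m) = move_unit (Suc j) i m"
            using ij' by (intro move_unit_trans) auto
          ultimately show ?thesis
            by (simp only: f[OF ij'(2)] IHf vec.scale vec.scale_scale Suc_eq_plus1[symmetric] mult_ac)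
        qed
        have 2: "root_f \<kappa> V i j *v (gen_f V j *v u m) =
            (qnum \<kappa> (of_nat (m i)) * (qpow \<kappa> (?S m) * qnum \<kappa> (of_nat (m j)))) *s ?t"
        proof (cases "m j = 0")
          case False
          have "move_unit (Suc j) j m i = m i" using ij' by (simp add: move_unit_def)
          moreover have "move_unit j i (move_unit (Suc j) j m) = move_unit (Suc j) i m"
            using ij' False by (intro move_unit_trans') auto
          ultimately show ?thesis
            by (simp only: f[OF ij'(2)] IHf S_f vec.scale vec.scale_scale Suc_eq_plus1[symmetric] mult_ac)
        qed (simp add: f[OF ij'(2)])
        have "root_f \<kappa> V i (Suc j) *v u m =
            gen_f V j *v (root_f \<kappa> V i j *v u m) - inverse (exp \<kappa>) *s (root_f \<kappa> V i j *v (gen_f V j *v u m))"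
          using False by (simp add: matrix_vector_mult_diff_rdistrib mscale_mult_vec flip: matrix_vector_mul_assoc)
        also have "\<dots> = (qnum \<kappa> (of_nat (m i)) * qpow \<kappa> (?S m)
            * (qnum \<kappa> (of_nat (m j) + 1) - inverse (exp \<kappa>) * qnum \<kappa> (of_nat (m j)))) *s ?t"
          unfolding 1 2 by (simp only: vec.scale_scale vec.scale_left_diff_distrib[symmetric] right_diff_distrib mult_ac)
        also have "\<dots> = (qpow \<kappa> (\<Sum>s\<in>{i<..<Suc j}. of_nat (m s)) * qnum \<kappa> (of_nat (m i))) *s ?t"
          unfolding qnum_step(2)[OF q] S qpow_add by (simp only: mult_ac)
        finally show "root_f \<kappa> V i (Suc j) *v u m = \<dots>" .
      qed
    qed
  qed simp
  thus "root_e \<kappa> V i j *v u m =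
           (qpow \<kappa> (- (\<Sum>s\<in>{i<..<j}. of_nat (m s))) * qnum \<kappa> (of_nat (m j))) *s u (move_unit i j m)"
    and "root_f \<kappa> V i j *v u m =
           (qpow \<kappa> (\<Sum>s\<in>{i<..<j}. of_nat (m s)) * qnum \<kappa> (of_nat (m i))) *s u (move_unit j i m)"
    by blast+
qed


section \<open>Cartan elements on weight vectors\<close>

text \<open>Weights are written as sequences \<open>\<nu>\<^sub>1, \<dots>, \<nu>\<^sub>n\<close> on which \<open>h\<^sub>i\<close> takes the value
  $\nu_i-\nu_{i+1}$; the invariant form is then the standard one on sequences with their average
  subtracted, and \<open>coweight\<close> gives the values of the dual elements \<open>h\<^sup>i\<close>.\<close>

definition weight_vector :: "nat \<Rightarrow> ('m::finite) action \<Rightarrow> (nat \<Rightarrow> complex) \<Rightarrow> complex^'m \<Rightarrow> bool"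
  where "weight_vector n a \<nu> w \<longleftrightarrow> w \<in> weight_space n a (\<lambda>i. \<nu> i - \<nu> (i + 1))"

definition weight_form :: "nat \<Rightarrow> (nat \<Rightarrow> complex) \<Rightarrow> (nat \<Rightarrow> complex) \<Rightarrow> complex"
  where "weight_form n \<mu> \<nu> = (\<Sum>s\<in>{1..n}. \<mu> s * \<nu> s) - sum \<mu> {1..n} * sum \<nu> {1..n} / of_nat n"

definition coweight :: "nat \<Rightarrow> (nat \<Rightarrow> complex) \<Rightarrow> nat \<Rightarrow> complex"
  where "coweight n \<nu> i = sum \<nu> {1..i} - of_nat i * sum \<nu> {1..n} / of_nat n"

lemma summation_by_parts:
  fixes c \<nu> :: "nat \<Rightarrow> complex"
  assumes "c 0 = 0" "c n = 0"
  shows "(\<Sum>j\<in>{1..<n}. c j * (\<nu> j - \<nu> (j + 1))) = (\<Sum>s\<in>{1..n}. \<nu> s * (c s - c (s - 1)))"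
proof (cases "n = 0")
  case False
  have "(\<Sum>j\<in>{1..<n}. c j * \<nu> j) = (\<Sum>s\<in>{1..n}. c s * \<nu> s)"
    using assms by (intro sum.mono_neutral_left) (auto simp: not_less le_antisym)
  moreover have "(\<Sum>j\<in>{1..<n}. c j * \<nu> (j + 1)) = (\<Sum>s\<in>{1..n}. c (s - 1) * \<nu> s)"
  proof -
    have "(\<Sum>j\<in>{1..<n}. c j * \<nu> (j + 1)) = (\<Sum>j\<in>{0..<n}. c j * \<nu> (j + 1))"
      using assms by (intro sum.mono_neutral_left) (auto simp: Suc_le_eq)
    also have "\<dots> = (\<Sum>s\<in>{1..n}. c (s - 1) * \<nu> s)"
      by (rule sum.reindex_bij_witness[of _ "\<lambda>s. s - 1" "\<lambda>j. j + 1"]) auto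
    finally show ?thesis .
  qed
  ultimately show ?thesis
    by (simp add: right_diff_distrib sum_subtractf mult.commute)
qed simp

lemma sum_coweight_differences:
  "(\<Sum>j\<in>{1..<n}. coweight n \<mu> j * (\<nu> j - \<nu> (j + 1))) = weight_form n \<nu> \<mu>"
proof (cases "n = 0")
  case False
  have "(\<Sum>j\<in>{1..<n}. coweight n \<mu> j * (\<nu> j - \<nu> (j + 1)))
      = (\<Sum>s\<in>{1..n}. \<nu> s * (coweight n \<mu> s - coweight n \<mu> (s - 1)))"
    by (rule summation_by_parts) (use False in \<open>auto simp: coweight_def\<close>)
  also have "\<dots> = (\<Sum>s\<in>{1..n}. \<nu> s * (\<mu> s - sum \<mu> {1..n} / of_nat n))"
  proof (rule sum.cong)
    fix s assume "s \<in> {1..n}"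
    then obtain t where t: "s = Suc t" by (cases s) auto
    show "\<nu> s * (coweight n \<mu> s - coweight n \<mu> (s - 1)) = \<nu> s * (\<mu> s - sum \<mu> {1..n} / of_nat n)"
      by (simp add: t coweight_def add_divide_distrib distrib_right)
  qed simp
  also have "\<dots> = weight_form n \<nu> \<mu>"
    unfolding weight_form_def right_diff_distrib sum_subtractf sum_distrib_right[symmetric]
    by (simp add: mult.commute)
  finally show ?thesis .
qed (simp add: weight_form_def)

lemma weight_vectorD:
  "weight_vector n a \<nu> w \<Longrightarrow> i \<in> {1..<n} \<Longrightarrow> gen_h a i *v w = (\<nu> i - \<nu> (i + 1)) *s w"
  by (simp add: weight_vector_def weight_space_def)

lemma sum_cartan_inv_differences:
  assumes i: "i \<in> {1..<n}"
  shows "(\<Sum>j\<in>{1..<n}. cartan_inv n i j * (\<nu> j - \<nu> (j + 1))) = coweight n \<nu> i"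
proof -
  have "(\<Sum>j\<in>{1..<n}. cartan_inv n i j * (\<nu> j - \<nu> (j + 1)))
      = (\<Sum>s\<in>{1..n}. \<nu> s * (cartan_inv n i s - cartan_inv n i (s - 1)))"
    by (rule summation_by_parts) (use i in \<open>auto simp: cartan_inv_def min_def\<close>)
  also have "\<dots> = (\<Sum>s\<in>{1..n}. \<nu> s * ((if s \<le> i then 1 else 0) - of_nat i / of_nat n))"
  proof (rule sum.cong)
    fix s assume "s \<in> {1..n}"
    then obtain t where t: "s = Suc t" by (cases s) auto
    have "of_nat (min i s) - of_nat (min i (s - 1)) = (if s \<le> i then 1 else 0 :: complex)"
      by (auto simp: t min_def)
    moreover have "of_nat (i * s) / of_nat n - of_nat (i * (s - 1)) / of_nat n = (of_nat i / of_nat n :: complex)"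
      by (simp add: t distrib_left add_divide_distrib)
    ultimately have "cartan_inv n i s - cartan_inv n i (s - 1) = (if s \<le> i then 1 else 0) - of_nat i / of_nat n"
      unfolding cartan_inv_def by (simp add: algebra_simps)
    thus "\<nu> s * (cartan_inv n i s - cartan_inv n i (s - 1)) = \<nu> s * ((if s \<le> i then 1 else 0) - of_nat i / of_nat n)"
      by simp
  qed simp
  also have "\<dots> = (\<Sum>s\<in>{1..n}. if s \<le> i then \<nu> s else 0) - sum \<nu> {1..n} * (of_nat i / of_nat n)"
    unfolding right_diff_distrib sum_subtractf sum_distrib_right[symmetric]
    by (intro arg_cong2[where f = "(-)"] sum.cong) auto
  also have "(\<Sum>s\<in>{1..n}. if s \<le> i then \<nu> s else 0) = sum \<nu> {1..i}"
    using i by (intro sum.mono_neutral_cong_right) auto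
  finally show ?thesis by (simp add: coweight_def mult.commute)
qed

lemma dual_h_weight_vector:
  assumes w: "weight_vector n a \<nu> w" and i: "i \<in> {1..<n}"
  shows "dual_h n a i *v w = coweight n \<nu> i *s w"
proof -
  have "dual_h n a i *v w = (\<Sum>j\<in>{1..<n}. cartan_inv n i j *s (gen_h a j *v w))"
    by (simp add: dual_h_def sum_mult_vec mscale_mult_vec)
  also have "\<dots> = (\<Sum>j\<in>{1..<n}. (cartan_inv n i j * (\<nu> j - \<nu> (j + 1))) *s w)"
    by (rule sum.cong[OF refl]) (simp only: weight_vectorD[OF w] vec.scale_scale)
  also have "\<dots> = (\<Sum>j\<in>{1..<n}. cartan_inv n i j * (\<nu> j - \<nu> (j + 1))) *s w"
    by (simp add: vec.scale_sum_left)
  finally show ?thesis by (simp only: sum_cartan_inv_differences[OF i])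
qed

lemma K_op_weight_vector:
  assumes "weight_vector n a \<mu> w" "weight_vector n b \<nu> w"
  shows "K_op n \<kappa> a b *v w = qpow \<kappa> (weight_form n \<mu> \<nu>) *s w"
  unfolding K_op_def
proof (rule op_qpow_eigenvector)
  have "(\<Sum>j\<in>{1..<n}. gen_h a j ** dual_h n b j) *v w
      = (\<Sum>j\<in>{1..<n}. (coweight n \<nu> j * (\<mu> j - \<mu> (j + 1))) *s w)"
    unfolding sum_mult_vec
    by (rule sum.cong[OF refl])
       (simp only: dual_h_weight_vector[OF assms(2)] weight_vectorD[OF assms(1)] vec.scale
         vec.scale_scale matrix_vector_mul_assoc[symmetric])
  also have "\<dots> = weight_form n \<mu> \<nu> *s w"
    by (simp only: sum_coweight_differences vec.scale_sum_left[symmetric])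
  finally show "(\<Sum>j\<in>{1..<n}. gen_h a j ** dual_h n b j) *v w = weight_form n \<mu> \<nu> *s w" .
qed

lemma B_op_weight_vector:
  assumes "weight_vector n a \<nu> w"
  shows "B_op n \<kappa> y a *v w = qpow \<kappa> (weight_form n \<nu> \<nu> + weight_form n y \<nu>) *s w"
  unfolding B_op_def
proof (rule op_qpow_eigenvector)
  have "(\<Sum>j\<in>{1..<n}. gen_h a j ** dual_h n a j - (y (j + 1) - y j) *\<^sub>M dual_h n a j) *v w
      = (\<Sum>j\<in>{1..<n}. (coweight n \<nu> j * (\<nu> j - \<nu> (j + 1)) + coweight n \<nu> j * (y j - y (j + 1))) *s w)"
    unfolding sum_mult_vec
  proof (rule sum.cong)
    fix j assume j: "j \<in> {1..<n}"
    have "(gen_h a j ** dual_h n a j - (y (j + 1) - y j) *\<^sub>M dual_h n a j) *v w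
        = (coweight n \<nu> j * (\<nu> j - \<nu> (j + 1))) *s w - ((y (j + 1) - y j) * coweight n \<nu> j) *s w"
      by (simp only: matrix_vector_mult_diff_rdistrib mscale_mult_vec matrix_vector_mul_assoc[symmetric]
          dual_h_weight_vector[OF assms j] weight_vectorD[OF assms j] vec.scale vec.scale_scale)
    thus "(gen_h a j ** dual_h n a j - (y (j + 1) - y j) *\<^sub>M dual_h n a j) *v w
        = (coweight n \<nu> j * (\<nu> j - \<nu> (j + 1)) + coweight n \<nu> j * (y j - y (j + 1))) *s w"
      by (simp add: vec_eq_iff algebra_simps)
  qed simp
  also have "\<dots> = (weight_form n \<nu> \<nu> + weight_form n y \<nu>) *s w"
    by (simp only: sum_coweight_differences sum.distrib vec.scale_sum_left[symmetric])
  finally show "(\<Sum>j\<in>{1..<n}. gen_h a j ** dual_h n a j - (y (j + 1) - y j) *\<^sub>M dual_h n a j) *v w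
      = (weight_form n \<nu> \<nu> + weight_form n y \<nu>) *s w" .
qed


section \<open>Ordered products over the positive roots\<close>

definition root_less :: "nat \<times> nat \<Rightarrow> nat \<times> nat \<Rightarrow> bool"
  where "root_less r s \<longleftrightarrow> fst r < fst s \<or> fst r = fst s \<and> snd r < snd s"

lemma set_pos_roots: "set (pos_roots n) = {(i, j). 1 \<le> i \<and> i < j \<and> j \<le> n}"
proof -
  have "(i, j) \<in> set (pos_roots n) \<longleftrightarrow> 1 \<le> i \<and> i < j \<and> j \<le> n" for i j
    by (auto simp: pos_roots_def image_iff simp del: upt_Suc)
  thus ?thesis by auto
qed

lemma sorted_pos_roots: "sorted_wrt root_less (pos_roots n)"
proof -
  have "sorted_wrt (<) xs \<Longrightarrow>
      sorted_wrt root_less (concat (map (\<lambda>i. map (\<lambda>j. (i, j)) [Suc i..<Suc n]) xs))" for xs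
  proof (induction xs)
    case (Cons i xs)
    have "sorted_wrt root_less (map (\<lambda>j. (i, j)) [Suc i..<Suc n])"
      unfolding sorted_wrt_map by (rule sorted_wrt_mono_rel[OF _ sorted_wrt_upt]) (simp add: root_less_def)
    moreover have "root_less r s" if "r \<in> set (map (\<lambda>j. (i, j)) [Suc i..<Suc n])"
        "s \<in> set (concat (map (\<lambda>i. map (\<lambda>j. (i, j)) [Suc i..<Suc n]) xs))" for r s
      using that Cons.prems by (auto simp: root_less_def simp del: upt_Suc)
    moreover have "sorted_wrt root_less (concat (map (\<lambda>i. map (\<lambda>j. (i, j)) [Suc i..<Suc n]) xs))"
      using Cons by simp
    ultimately show ?case by (simp only: list.map concat.simps sorted_wrt_append) blast
  qed simp
  thus ?thesis by (simp add: pos_roots_def del: upt_Suc)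
qed

lemma distinct_pos_roots: "distinct (pos_roots n)"
proof -
  have "sorted_wrt root_less xs \<Longrightarrow> distinct xs" for xs
    by (induction xs) (auto simp: root_less_def)
  thus ?thesis using sorted_pos_roots by blast
qed

definition ordered_product :: "'r list \<Rightarrow> ('r \<Rightarrow> complex^'m^'m) \<Rightarrow> complex^'m^'m"
  where "ordered_product xs X = foldr (\<lambda>r P. X r ** P) xs (mat 1)"

lemma prod_gt_eq: "prod_gt n X = ordered_product (rev (pos_roots n)) X"
  by (simp add: prod_gt_def ordered_product_def)

lemma ordered_product_Nil [simp]: "ordered_product [] X = mat 1"
  and ordered_product_Cons [simp]: "ordered_product (r # xs) X = X r ** ordered_product xs X"
  by (simp_all add: ordered_product_def)

lemma ordered_product_append:
  "ordered_product (xs @ ys) X = ordered_product xs X ** ordered_product ys X"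
  by (induction xs) (simp_all add: matrix_mul_assoc)

lemma ordered_product_one: "(\<And>r. r \<in> set xs \<Longrightarrow> X r = mat 1) \<Longrightarrow> ordered_product xs X = mat 1"
  by (induction xs) simp_all

lemma ordered_product_cong:
  "(\<And>r. r \<in> set xs \<Longrightarrow> X r = Y r) \<Longrightarrow> ordered_product xs X = ordered_product xs Y"
  by (induction xs) simp_all

lemma prod_gt_cong: "(\<And>r. r \<in> set (pos_roots n) \<Longrightarrow> X r = Y r) \<Longrightarrow> prod_gt n X = prod_gt n Y"
  unfolding prod_gt_eq by (rule ordered_product_cong) simp

lemma prod_gt_one: "(\<And>r. r \<in> set (pos_roots n) \<Longrightarrow> X r = mat 1) \<Longrightarrow> prod_gt n X = mat 1"
  unfolding prod_gt_eq by (rule ordered_product_one) simp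

text \<open>For multiplying a PBW element by the vector of a root beyond its support.\<close>

lemma prod_gt_split_largest:
  assumes r: "r \<in> set (pos_roots n)"
    and one: "\<And>s. s \<in> set (pos_roots n) \<Longrightarrow> root_less r s \<Longrightarrow> X s = mat 1"
  shows "prod_gt n X = X r ** prod_gt n (X(r := mat 1))"
proof -
  obtain xs ys where xy: "pos_roots n = xs @ r # ys" using r by (meson split_list)
  have ys: "root_less r s" if "s \<in> set ys" for s
    using sorted_pos_roots[of n] that unfolding xy by (simp add: sorted_wrt_append)
  have d: "r \<notin> set xs" "r \<notin> set ys" using distinct_pos_roots[of n] unfolding xy by auto
  have 1: "ordered_product (rev ys) X = mat 1"
    by (rule ordered_product_one) (use one ys xy in auto)
  have 2: "ordered_product (rev ys) (X(r := mat 1)) = mat 1"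
    by (rule ordered_product_one) (use one ys xy in auto)
  have 3: "ordered_product (rev xs) (X(r := mat 1)) = ordered_product (rev xs) X"
    by (rule ordered_product_cong) (use d in auto)
  show ?thesis unfolding prod_gt_eq xy
    by (simp add: ordered_product_append 1 2 3 flip: matrix_mul_assoc)
qed

lemma matrix_add_rdistrib: "(A + B) ** C = A ** C + B ** C" for A B :: "complex^'m^'m"
  by (simp add: matrix_eq op_simps flip: matrix_vector_mul_assoc)

text \<open>Together with the following one, this lemma evaluates the product $\hat R$ in the vector
  representation: when the terms annihilate each other in the order of the product, the product is
  linear in them; when they do so in the opposite order, its inverse is.\<close>

lemma ordered_product_nilpotent:
  assumes "distinct xs" "sorted_wrt (\<lambda>r s. Z r ** Z s = 0) xs"
  shows "ordered_product xs (\<lambda>r. mat 1 + Z r) = mat 1 + (\<Sum>r\<in>set xs. Z r)"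
  using assms
proof (induction xs)
  case (Cons r xs)
  have "Z r ** (\<Sum>s\<in>set xs. Z s) = (\<Sum>s\<in>set xs. Z r ** Z s)"
    by (simp add: matrix_eq sum_mult_vec vec.sum flip: matrix_vector_mul_assoc)
  also have "\<dots> = 0" using Cons.prems by simp
  finally have "(mat 1 + Z r) ** (mat 1 + (\<Sum>s\<in>set xs. Z s)) = mat 1 + (Z r + (\<Sum>s\<in>set xs. Z s))"
    by (simp add: matrix_add_ldistrib matrix_add_rdistrib add_ac)
  thus ?case using Cons by simp
qed simp

lemma ordered_product_inverse:
  assumes "distinct xs" "\<And>r. r \<in> set xs \<Longrightarrow> Z r ** Z r = 0"
    and "sorted_wrt (\<lambda>r s. Z s ** Z r = 0) xs"
  shows "ordered_product xs (\<lambda>r. mat 1 + Z r) ** (mat 1 - (\<Sum>r\<in>set xs. Z r)) = mat 1"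
  using assms
proof (induction xs)
  case (Cons r xs)
  let ?S = "\<Sum>s\<in>set xs. Z s"
  have "?S ** Z r = (\<Sum>s\<in>set xs. Z s ** Z r)"
    by (simp add: matrix_eq sum_mult_vec flip: matrix_vector_mul_assoc)
  also have "\<dots> = 0" using Cons.prems by simp
  finally have "mat 1 - (\<Sum>s\<in>set (r # xs). Z s) = (mat 1 - ?S) ** (mat 1 - Z r)"
    using Cons.prems(1) by (simp add: matrix_eq op_simps vec.diff flip: matrix_vector_mul_assoc)
  hence "ordered_product (r # xs) (\<lambda>r. mat 1 + Z r) ** (mat 1 - (\<Sum>s\<in>set (r # xs). Z s))
      = (mat 1 + Z r) ** (ordered_product xs (\<lambda>r. mat 1 + Z r) ** (mat 1 - ?S)) ** (mat 1 - Z r)"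
    by (simp add: matrix_mul_assoc)
  also have "\<dots> = (mat 1 + Z r) ** (mat 1 - Z r)" using Cons by simp
  also have "\<dots> = mat 1"
  proof -
    have "Z r *v (Z r *v x) = 0" for x
      using Cons.prems(2)[of r] by (simp add: matrix_vector_mul_assoc)
    thus ?thesis by (simp add: matrix_eq op_simps vec.diff flip: matrix_vector_mul_assoc)
  qed
  finally show ?case .
qed simp

lemma prod_gt_nilpotent:
  assumes "\<And>r s. r \<in> set (pos_roots n) \<Longrightarrow> s \<in> set (pos_roots n) \<Longrightarrow> root_less s r \<Longrightarrow> Z r ** Z s = 0"
  shows "prod_gt n (\<lambda>r. mat 1 + Z r) = mat 1 + (\<Sum>r\<in>set (pos_roots n). Z r)"
proof -
  have "sorted_wrt (\<lambda>r s. Z r ** Z s = 0) (rev (pos_roots n))"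
    unfolding sorted_wrt_rev
    by (rule sorted_wrt_mono_rel[OF _ sorted_pos_roots]) (use assms in auto)
  thus ?thesis
    using ordered_product_nilpotent[of "rev (pos_roots n)" Z] distinct_pos_roots
    by (simp add: prod_gt_eq)
qed

lemma prod_gt_inverse:
  assumes "\<And>r s. r \<in> set (pos_roots n) \<Longrightarrow> s \<in> set (pos_roots n) \<Longrightarrow> r = s \<or> root_less r s \<Longrightarrow> Z r ** Z s = 0"
  shows "prod_gt n (\<lambda>r. mat 1 + Z r) ** (mat 1 - (\<Sum>r\<in>set (pos_roots n). Z r)) = mat 1"
proof -
  have "sorted_wrt (\<lambda>r s. Z s ** Z r = 0) (rev (pos_roots n))"
    unfolding sorted_wrt_rev
    by (rule sorted_wrt_mono_rel[OF _ sorted_pos_roots]) (use assms in auto)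
  thus ?thesis
    using ordered_product_inverse[of "rev (pos_roots n)" Z] distinct_pos_roots assms
    by (simp add: prod_gt_eq)
qed

lemma qexp_square_zero:
  fixes Z :: "complex^'m^'m"
  assumes "Z ** Z = 0" "exp \<kappa> - inverse (exp \<kappa>) \<noteq> 0"
  shows "qexp \<kappa> Z = mat 1 + Z"
proof -
  have high: "mpow Z (Suc (Suc k)) = 0" for k
    using assms(1) by (simp add: matrix_mul_assoc)
  have "qexp \<kappa> Z = (\<Sum>m\<in>{0, 1}. (1 / qfact \<kappa> m) *\<^sub>M mpow Z m)"
    unfolding qexp_def
  proof (rule suminf_finite)
    fix m :: nat assume "m \<notin> {0, 1}"
    then obtain k where "m = Suc (Suc k)" by (cases m rule: nat.exhaust; cases "m - 1") auto
    thus "(1 / qfact \<kappa> m) *\<^sub>M mpow Z m = 0" unfolding \<open>m = _\<close> high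
      by (simp add: mscale_def vec_eq_iff)
  qed simp
  also have "\<dots> = mat 1 + Z"
    using assms(2) by (simp add: qfact_def qint_def mscale_def vec_eq_iff)
  finally show ?thesis .
qed


section \<open>Weights of Poincare-Birkhoff-Witt elements\<close>

definition shifts_weight :: "nat \<Rightarrow> ('m::finite) action \<Rightarrow> (nat \<Rightarrow> complex) \<Rightarrow> complex^'m^'m \<Rightarrow> bool"
  where "shifts_weight n a \<delta> A \<longleftrightarrow>
    (\<forall>\<mu>. \<forall>w\<in>weight_space n a \<mu>. A *v w \<in> weight_space n a (\<lambda>i. \<mu> i + \<delta> i))"

text \<open>The part of the relations which determines the weights of PBW elements; it also applies to the
  matrix representation, where it is checked on matrix units.\<close>

definition graded_action :: "nat \<Rightarrow> ('m::finite) action \<Rightarrow> bool"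
  where "graded_action n a \<longleftrightarrow> (\<forall>i\<in>{1..<n}. \<forall>j\<in>{1..<n}.
     comm (gen_h a i) (gen_e a j) = cartan i j *\<^sub>M gen_e a j
   \<and> comm (gen_h a i) (gen_f a j) = (- cartan i j) *\<^sub>M gen_f a j)"

lemma uq_rep_graded: "uq_rep n \<kappa> a \<Longrightarrow> graded_action n a"
  by (simp add: uq_rep_def graded_action_def)

lemma subspace_weight_space: "vec.subspace (weight_space n a \<mu>)"
  unfolding weight_space_eq by (rule subspace_joint_eigenspace)

lemma weight_space_cong:
  "(\<And>i. i \<in> {1..<n} \<Longrightarrow> \<mu> i = \<nu> i) \<Longrightarrow> weight_space n a \<mu> = weight_space n a \<nu>"
  unfolding weight_space_eq by (rule joint_eigenspace_cong)

lemma shifts_weight_comm: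
  assumes "\<And>i. i \<in> {1..<n} \<Longrightarrow> comm (gen_h a i) A = \<delta> i *\<^sub>M A"
  shows "shifts_weight n a \<delta> A"
  unfolding shifts_weight_def weight_space_def
proof safe
  fix \<mu> w i assume w: "\<forall>i\<in>{1..<n}. gen_h a i *v w = \<mu> i *s w" and i: "i \<in> {1..<n}"
  have "gen_h a i *v (A *v w) - A *v (gen_h a i *v w) = \<delta> i *s (A *v w)"
    using arg_cong[OF assms[OF i], of "\<lambda>X. X *v w"] by (simp only: comm_apply mscale_mult_vec)
  moreover have "A *v (gen_h a i *v w) = \<mu> i *s (A *v w)" using w i by (simp only: vec.scale)
  ultimately show "gen_h a i *v (A *v w) = (\<mu> i + \<delta> i) *s (A *v w)"
    by (simp only: vec.scale_left_distrib diff_eq_eq add.commute)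
qed

lemma shifts_weight_mat_1: "shifts_weight n a (\<lambda>_. 0) (mat 1)"
  by (simp add: shifts_weight_def)

lemma shifts_weight_mult:
  "shifts_weight n a \<delta> A \<Longrightarrow> shifts_weight n a \<epsilon> C \<Longrightarrow> shifts_weight n a (\<lambda>i. \<epsilon> i + \<delta> i) (A ** C)"
  unfolding shifts_weight_def by (simp add: add.assoc[symmetric] flip: matrix_vector_mul_assoc)

lemma shifts_weight_diff:
  "shifts_weight n a \<delta> A \<Longrightarrow> shifts_weight n a \<delta> C \<Longrightarrow> shifts_weight n a \<delta> (A - C)"
  unfolding shifts_weight_def
  by (simp add: matrix_vector_mult_diff_rdistrib vec.subspace_diff[OF subspace_weight_space])

lemma shifts_weight_mscale: "shifts_weight n a \<delta> A \<Longrightarrow> shifts_weight n a \<delta> (c *\<^sub>M A)"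
  unfolding shifts_weight_def
  by (simp add: mscale_mult_vec vec.subspace_scale[OF subspace_weight_space])

lemma shifts_weight_cong:
  "shifts_weight n a \<delta> A \<Longrightarrow> (\<And>i. \<delta> i = \<epsilon> i) \<Longrightarrow> shifts_weight n a \<epsilon> A"
  by (metis ext)

lemma shifts_weight_mpow: "shifts_weight n a \<delta> A \<Longrightarrow> shifts_weight n a (\<lambda>i. of_nat k * \<delta> i) (mpow A k)"
proof (induction k)
  case (Suc k)
  from shifts_weight_mult[OF Suc.prems Suc.IH[OF Suc.prems]] show ?case
    by (auto simp: algebra_simps intro: shifts_weight_cong)
qed (simp add: shifts_weight_mat_1)

lemma shifts_weight_root_vectors:
  assumes a: "graded_action n a" and ij: "1 \<le> i" "i < j" "j \<le> n"
  shows "shifts_weight n a (\<lambda>s. \<Sum>k\<in>{i..<j}. cartan s k) (root_e \<kappa> a i j)"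
    and "shifts_weight n a (\<lambda>s. - (\<Sum>k\<in>{i..<j}. cartan s k)) (root_f \<kappa> a i j)"
proof -
  have e: "shifts_weight n a (\<lambda>s. cartan s k) (gen_e a k)"
    and f: "shifts_weight n a (\<lambda>s. - cartan s k) (gen_f a k)" if "k \<in> {1..<n}" for k
    using a that by (auto simp: graded_action_def intro!: shifts_weight_comm)
  have "shifts_weight n a (\<lambda>s. \<Sum>k\<in>{i..<j}. cartan s k) (root_e \<kappa> a i j)
      \<and> shifts_weight n a (\<lambda>s. - (\<Sum>k\<in>{i..<j}. cartan s k)) (root_f \<kappa> a i j)"
    using ij(2,3)
  proof (induction j)
    case (Suc j)
    have j: "j \<in> {1..<n}" using Suc.prems ij by auto
    show ?case
    proof (cases "j = i")
      case True
      thus ?thesis using e[OF j] f[OF j] by simp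
    next
      case False
      hence IH: "shifts_weight n a (\<lambda>s. \<Sum>k\<in>{i..<j}. cartan s k) (root_e \<kappa> a i j)"
        "shifts_weight n a (\<lambda>s. - (\<Sum>k\<in>{i..<j}. cartan s k)) (root_f \<kappa> a i j)"
        using Suc by auto
      have S: "(\<Sum>k\<in>{i..<Suc j}. cartan s k) = (\<Sum>k\<in>{i..<j}. cartan s k) + cartan s j" for s
        using Suc.prems by (intro sum.atLeastLessThan_Suc) simp
      show ?thesis using False
        by (auto simp only: root_e.simps root_f.simps if_False S minus_add_distrib add_ac
            intro!: shifts_weight_diff shifts_weight_mscale
              shifts_weight_cong[OF shifts_weight_mult[OF e[OF j] IH(1)]]
              shifts_weight_cong[OF shifts_weight_mult[OF IH(1) e[OF j]]]
              shifts_weight_cong[OF shifts_weight_mult[OF f[OF j] IH(2)]]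
              shifts_weight_cong[OF shifts_weight_mult[OF IH(2) f[OF j]]])
    qed
  qed simp
  thus "shifts_weight n a (\<lambda>s. \<Sum>k\<in>{i..<j}. cartan s k) (root_e \<kappa> a i j)"
    and "shifts_weight n a (\<lambda>s. - (\<Sum>k\<in>{i..<j}. cartan s k)) (root_f \<kappa> a i j)" by auto
qed

lemma shifts_weight_prod_gt:
  assumes "\<And>r. r \<in> set (pos_roots n) \<Longrightarrow> shifts_weight n a (\<delta> r) (X r)"
  shows "shifts_weight n a (\<lambda>s. \<Sum>r\<in>set (pos_roots n). \<delta> r s) (prod_gt n X)"
proof -
  have "shifts_weight n a (\<lambda>s. \<Sum>r\<in>set xs. \<delta> r s) (ordered_product xs X)"
    if "distinct xs" "set xs \<subseteq> set (pos_roots n)" for xs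
    using that
  proof (induction xs)
    case (Cons r xs)
    hence "shifts_weight n a (\<lambda>s. (\<Sum>r\<in>set xs. \<delta> r s) + \<delta> r s) (X r ** ordered_product xs X)"
      by (intro shifts_weight_mult assms) auto
    thus ?case using Cons.prems by (simp add: add.commute)
  qed (simp add: shifts_weight_mat_1)
  from this[of "rev (pos_roots n)"] show ?thesis by (simp add: prod_gt_eq distinct_pos_roots)
qed

text \<open>A root is the sum of the simple roots of its interval; exchanging the two summations collects them.\<close>

lemma sum_over_roots_eq_pbw_weight:
  "(\<Sum>(i, j)\<in>set (pos_roots n). of_nat (p (i, j)) * (\<Sum>k\<in>{i..<j}. c k))
     = (\<Sum>k\<in>{1..<n}. of_nat (pbw_weight n p k) * (c k :: complex))"
proof -
  let ?R = "set (pos_roots n)"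
  have "(\<Sum>(i, j)\<in>?R. of_nat (p (i, j)) * (\<Sum>k\<in>{i..<j}. c k))
      = (\<Sum>r\<in>?R. \<Sum>k\<in>{1..<n}. if fst r \<le> k \<and> k < snd r then of_nat (p r) * c k else 0)"
  proof (rule sum.cong)
    fix r assume "r \<in> ?R"
    hence r: "1 \<le> fst r" "snd r \<le> n" by (auto simp: set_pos_roots)
    have "of_nat (p r) * (\<Sum>k\<in>{fst r..<snd r}. c k)
        = (\<Sum>k\<in>{1..<n}. if fst r \<le> k \<and> k < snd r then of_nat (p r) * c k else 0)"
      unfolding sum_distrib_left by (rule sum.mono_neutral_cong_left) (use r in auto)
    thus "(case r of (i, j) \<Rightarrow> of_nat (p (i, j)) * (\<Sum>k\<in>{i..<j}. c k))
        = (\<Sum>k\<in>{1..<n}. if fst r \<le> k \<and> k < snd r then of_nat (p r) * c k else 0)"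
      by (cases r) simp
  qed simp
  also have "\<dots> = (\<Sum>k\<in>{1..<n}. \<Sum>r\<in>?R. if fst r \<le> k \<and> k < snd r then of_nat (p r) * c k else 0)"
    by (rule sum.swap)
  also have "\<dots> = (\<Sum>k\<in>{1..<n}. of_nat (pbw_weight n p k) * c k)"
  proof (rule sum.cong)
    fix k
    have "(\<Sum>r\<in>?R. if fst r \<le> k \<and> k < snd r then of_nat (p r) * c k else 0)
        = (\<Sum>r\<in>{(i, j). (i, j) \<in> ?R \<and> i \<le> k \<and> k < j}. of_nat (p r) * c k)"
      by (rule sum.mono_neutral_cong_right) auto
    also have "\<dots> = of_nat (pbw_weight n p k) * c k"
      by (simp add: pbw_weight_def sum_distrib_right case_prod_beta cong: sum.cong)
    finally show "(\<Sum>r\<in>?R. if fst r \<le> k \<and> k < snd r then of_nat (p r) * c k else 0)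
        = of_nat (pbw_weight n p k) * c k" .
  qed simp
  finally show ?thesis .
qed

lemma shifts_weight_pbw:
  assumes a: "graded_action n a"
  shows "shifts_weight n a (\<lambda>s. \<Sum>k\<in>{1..<n}. of_nat (pbw_weight n p k) * cartan s k) (pbw_e n \<kappa> a p)"
    and "shifts_weight n a (\<lambda>s. - (\<Sum>k\<in>{1..<n}. of_nat (pbw_weight n p k) * cartan s k)) (pbw_f n \<kappa> a p)"
proof -
  have "shifts_weight n a (\<lambda>s. \<Sum>r\<in>set (pos_roots n). of_nat (p r) * (\<Sum>k\<in>{fst r..<snd r}. cartan s k)) (pbw_e n \<kappa> a p)"
    unfolding pbw_e_def
    by (rule shifts_weight_prod_gt)
       (auto simp: set_pos_roots intro!: shifts_weight_mpow shifts_weight_root_vectors a)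
  thus "shifts_weight n a (\<lambda>s. \<Sum>k\<in>{1..<n}. of_nat (pbw_weight n p k) * cartan s k) (pbw_e n \<kappa> a p)"
    using sum_over_roots_eq_pbw_weight[of p _ n] by (simp add: case_prod_beta)
  have "shifts_weight n a (\<lambda>s. \<Sum>r\<in>set (pos_roots n). of_nat (p r) * - (\<Sum>k\<in>{fst r..<snd r}. cartan s k)) (pbw_f n \<kappa> a p)"
    unfolding pbw_f_def
    by (rule shifts_weight_prod_gt)
       (auto simp: set_pos_roots intro!: shifts_weight_mpow[of n a "\<lambda>s. - (\<Sum>k\<in>{_..<_}. cartan s k)", simplified]
         shifts_weight_root_vectors a)
  thus "shifts_weight n a (\<lambda>s. - (\<Sum>k\<in>{1..<n}. of_nat (pbw_weight n p k) * cartan s k)) (pbw_f n \<kappa> a p)"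
    using sum_over_roots_eq_pbw_weight[of p _ n] by (simp add: case_prod_beta sum_negf)
qed

lemma pbw_zero: "pbw_e n \<kappa> a (\<lambda>_. 0) = mat 1" "pbw_f n \<kappa> a (\<lambda>_. 0) = mat 1"
  unfolding pbw_e_def pbw_f_def by (rule prod_gt_one; auto)+

text \<open>A root \<open>(ij)\<close> contributes its exponent to the coefficient of $\alpha_i$, and all contributions are
  nonnegative.\<close>

lemma pbw_weight_zero_imp:
  assumes p: "p \<in> pbw_exponents n" and "\<And>k. k \<in> {1..<n} \<Longrightarrow> pbw_weight n p k = 0"
  shows "p = (\<lambda>_. 0)"
proof
  fix r
  show "p r = 0"
  proof (cases "r \<in> set (pos_roots n)")
    case True
    then obtain i j where r: "r = (i, j)" "1 \<le> i" "i < j" "j \<le> n" by (auto simp: set_pos_roots)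
    let ?R = "{(i', j). (i', j) \<in> set (pos_roots n) \<and> i' \<le> i \<and> i < j}"
    have "finite ?R" by (rule finite_subset[of _ "set (pos_roots n)"]) auto
    moreover have "pbw_weight n p i = 0" using assms(2) r by auto
    moreover have "(i, j) \<in> ?R" using True r by auto
    ultimately show ?thesis unfolding pbw_weight_def r by (auto simp: case_prod_beta)
  qed (use p in \<open>unfold pbw_exponents_def, blast\<close>)
qed

lemma pbw_single:
  assumes "(i, j) \<in> set (pos_roots n)"
  shows "pbw_e n \<kappa> a ((\<lambda>_. 0)((i, j) := 1)) = root_e \<kappa> a i j"
    and "pbw_f n \<kappa> a ((\<lambda>_. 0)((i, j) := 1)) = root_f \<kappa> a i j"
proof -
  have single: "prod_gt n X = X (i, j)"
    if "\<And>r. r \<in> set (pos_roots n) \<Longrightarrow> r \<noteq> (i, j) \<Longrightarrow> X r = mat 1" for X :: "nat \<times> nat \<Rightarrow> complex^'a^'a"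
  proof -
    have "prod_gt n X = X (i, j) ** prod_gt n (X((i, j) := mat 1))"
      by (rule prod_gt_split_largest[OF assms]) (use that in \<open>auto simp: root_less_def\<close>)
    also have "prod_gt n (X((i, j) := mat 1)) = mat 1"
      by (rule prod_gt_one) (use that in auto)
    finally show ?thesis by simp
  qed
  show "pbw_e n \<kappa> a ((\<lambda>_. 0)((i, j) := 1)) = root_e \<kappa> a i j"
    and "pbw_f n \<kappa> a ((\<lambda>_. 0)((i, j) := 1)) = root_f \<kappa> a i j"
    unfolding pbw_e_def pbw_f_def by (subst single; auto split: if_splits)+
qed


section \<open>Tensor products\<close>

definition tensor_vec :: "complex^'n \<Rightarrow> complex^'d \<Rightarrow> complex^('n::finite \<times> 'd::finite)"
  where "tensor_vec x w = (\<chi> s. x $ fst s * w $ snd s)"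

lemma tensor_op_vec: "tensor_op A C *v tensor_vec x w = tensor_vec (A *v x) (C *v w)"
  by (simp add: tensor_op_def tensor_vec_def matrix_vector_mult_def vec_eq_iff sum_product
      sum.cartesian_product case_prod_beta mult_ac flip: UNIV_Times_UNIV)

lemma tensor_op_mult: "tensor_op A C ** tensor_op A' C' = tensor_op (A ** A') (C ** C')"
  by (simp add: tensor_op_def matrix_matrix_mult_def vec_eq_iff sum_product
      sum.cartesian_product case_prod_beta mult_ac flip: UNIV_Times_UNIV)

lemma tensor_op_one: "tensor_op (mat 1) (mat 1) = mat 1"
  by (auto simp: tensor_op_def mat_def vec_eq_iff prod_eq_iff)

lemma tensor_op_diff:
  "tensor_op (A - A') C = tensor_op A C - tensor_op A' C"
  "tensor_op A (C - C') = tensor_op A C - tensor_op A C'"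
  by (simp_all add: tensor_op_def vec_eq_iff algebra_simps)

lemma tensor_op_mscale:
  "tensor_op (c *\<^sub>M A) C = c *\<^sub>M tensor_op A C"
  "tensor_op A (c *\<^sub>M C) = c *\<^sub>M tensor_op A C"
  by (simp_all add: tensor_op_def mscale_def vec_eq_iff)

lemma mscale_zero: "x *\<^sub>M 0 = 0"
  by (simp add: mscale_def vec_eq_iff)

lemma root_vectors_legs:
  "1 \<le> i \<Longrightarrow> i < j \<Longrightarrow> root_e \<kappa> (first_leg a) i j = tensor_op (root_e \<kappa> a i j) (mat 1)"
  "1 \<le> i \<Longrightarrow> i < j \<Longrightarrow> root_f \<kappa> (first_leg a) i j = tensor_op (root_f \<kappa> a i j) (mat 1)"
  "1 \<le> i \<Longrightarrow> i < j \<Longrightarrow> root_e \<kappa> (second_leg V) i j = tensor_op (mat 1) (root_e \<kappa> V i j)"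
  "1 \<le> i \<Longrightarrow> i < j \<Longrightarrow> root_f \<kappa> (second_leg V) i j = tensor_op (mat 1) (root_f \<kappa> V i j)"
  by (induction j; auto simp: first_leg_def second_leg_def tensor_op_mult tensor_op_diff
      tensor_op_mscale less_Suc_eq)+

lemma mpow_tensor:
  "mpow (tensor_op A (mat 1)) k = tensor_op (mpow A k) (mat 1)"
  "mpow (tensor_op (mat 1) C) k = tensor_op (mat 1) (mpow C k)"
  by (induction k) (simp_all add: tensor_op_one tensor_op_mult)

lemma prod_gt_tensor:
  "prod_gt n (\<lambda>r. tensor_op (X r) (mat 1)) = tensor_op (prod_gt n X) (mat 1)"
  "prod_gt n (\<lambda>r. tensor_op (mat 1) (Y r)) = tensor_op (mat 1) (prod_gt n Y)"
proof -
  have "ordered_product xs (\<lambda>r. tensor_op (X r) (mat 1)) = tensor_op (ordered_product xs X) (mat 1)"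
    "ordered_product xs (\<lambda>r. tensor_op (mat 1) (Y r)) = tensor_op (mat 1) (ordered_product xs Y)" for xs
    by (induction xs) (simp_all add: tensor_op_one tensor_op_mult)
  thus "prod_gt n (\<lambda>r. tensor_op (X r) (mat 1)) = tensor_op (prod_gt n X) (mat 1)"
    "prod_gt n (\<lambda>r. tensor_op (mat 1) (Y r)) = tensor_op (mat 1) (prod_gt n Y)"
    by (simp_all add: prod_gt_eq)
qed

lemma pbw_legs:
  "pbw_e n \<kappa> (first_leg a) p = tensor_op (pbw_e n \<kappa> a p) (mat 1)"
  "pbw_f n \<kappa> (first_leg a) p = tensor_op (pbw_f n \<kappa> a p) (mat 1)"
  "pbw_e n \<kappa> (second_leg V) p = tensor_op (mat 1) (pbw_e n \<kappa> V p)"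
  "pbw_f n \<kappa> (second_leg V) p = tensor_op (mat 1) (pbw_f n \<kappa> V p)"
  unfolding pbw_e_def pbw_f_def prod_gt_tensor[symmetric]
  by (rule prod_gt_cong; clarsimp simp: root_vectors_legs mpow_tensor set_pos_roots)+

lemma component_add: "component k (x + z) = component k x + component k z"
  and component_diff: "component k (x - z) = component k x - component k z"
  and component_scale: "component k (c *s x) = c *s component k x"
  and component_zero [simp]: "component k 0 = 0"
  by (simp_all add: component_def vec_eq_iff)

lemma component_sum: "component k (\<Sum>i\<in>I. f i) = (\<Sum>i\<in>I. component k (f i))"
  by (induction I rule: infinite_finite_induct) (simp_all add: component_add)


section \<open>The vector representation\<close>

lemma idx_mono: "a < b \<Longrightarrow> idx a < idx b"
proof -
  assume "a < b"
  hence "b \<in> {c. c \<le> b} - {c. c \<le> a}" "{c. c \<le> a} \<subseteq> {c. c \<le> b}" by auto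
  hence "{c. c \<le> a} \<subset> {c. c \<le> b}" by blast
  thus ?thesis unfolding idx_def by (intro psubset_card_mono) auto
qed

lemma bij_idx: "bij_betw idx (UNIV :: 'n::{finite,linorder} set) {1..CARD('n)}"
proof -
  have inj: "inj (idx :: 'n \<Rightarrow> nat)"
    by (rule injI) (metis idx_mono less_irrefl linorder_less_linear)
  have "range (idx :: 'n \<Rightarrow> nat) \<subseteq> {1..CARD('n)}"
  proof safe
    fix a :: 'n
    have "idx a \<le> CARD('n)" unfolding idx_def by (rule card_mono) auto
    moreover have "idx a > 0" unfolding idx_def by (auto simp: card_gt_0_iff)
    ultimately show "idx a \<in> {1..CARD('n)}" by simp
  qed
  hence "range (idx :: 'n \<Rightarrow> nat) = {1..CARD('n)}"
    by (intro card_subset_eq) (simp_all add: card_image inj)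
  thus ?thesis using inj by (simp add: bij_betw_def)
qed

locale vector_tensor = not_root_of_unity +
  fixes n :: nat and V :: "'d::finite action" and ty :: "'n::{finite,linorder} itself"
  assumes n_card: "n = CARD('n)"
begin

text \<open>Basis vectors of the vector representation and components along them are addressed by the positions
  \<open>1, \<dots>, n\<close>: \<open>tb i w\<close> is $v_i\otimes w$, and \<open>coord i x\<close> is the component of \<open>x\<close> along \<open>v\<^sub>i\<close>.\<close>

definition pos :: "nat \<Rightarrow> 'n" where "pos = the_inv idx"

abbreviation A :: "('n \<times> 'd) action" where "A \<equiv> first_leg matrix_rep"
abbreviation B :: "('n \<times> 'd) action" where "B \<equiv> second_leg V"

definition unit_vec :: "nat \<Rightarrow> (complex, 'n) vec" where "unit_vec i = axis (pos i) 1"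

definition tb :: "nat \<Rightarrow> complex^'d \<Rightarrow> complex^('n \<times> 'd)" where "tb i w = tensor_basis (pos i) w"

definition coord :: "nat \<Rightarrow> complex^('n \<times> 'd) \<Rightarrow> complex^'d" where "coord i x = component (pos i) x"

lemma idx_pos: "i \<in> {1..n} \<Longrightarrow> idx (pos i) = i"
  using bij_idx[where 'n = 'n] unfolding pos_def n_card
  by (metis bij_betw_def f_the_inv_into_f)

lemma pos_idx: "pos (idx k) = k"
  using bij_idx[where 'n = 'n] unfolding pos_def by (simp add: bij_betw_def the_inv_f_f)

lemma pos_eq_iff: "i \<in> {1..n} \<Longrightarrow> j \<in> {1..n} \<Longrightarrow> pos i = pos j \<longleftrightarrow> i = j"
  by (metis idx_pos)

lemma sum_pos: "(\<Sum>k\<in>UNIV. g k) = (\<Sum>i\<in>{1..n}. g (pos i))"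
proof -
  have "(\<Sum>i\<in>{1..n}. g (pos i)) = (\<Sum>k\<in>(UNIV :: 'n set). g (pos (idx k)))"
    unfolding n_card using sum.reindex_bij_betw[OF bij_idx[where 'n = 'n], of "\<lambda>i. g (pos i)"] by (rule sym)
  thus ?thesis by (simp add: pos_idx)
qed

lemma mat_unit_mult:
  assumes "j \<in> {1..n}" "k \<in> {1..n}"
  shows "mat_unit i j ** (mat_unit k l :: ((complex, 'n) vec, 'n) vec) = (if j = k then mat_unit i l else 0)"
proof -
  have "(mat_unit i j ** (mat_unit k l :: ((complex, 'n) vec, 'n) vec)) $ a $ b
      = (if idx a = i \<and> idx b = l \<and> j = k then 1 else 0)" for a b
  proof -
    have "(mat_unit i j ** (mat_unit k l :: ((complex, 'n) vec, 'n) vec)) $ a $ b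
      = (\<Sum>c\<in>UNIV. if c = pos j then (if idx a = i \<and> idx b = l \<and> j = k then 1 else 0) else 0)"
      unfolding matrix_matrix_mult_def mat_unit_def
      unfolding vec_lambda_beta
      by (rule sum.cong[OF refl]) (use assms in \<open>auto simp: idx_pos pos_idx\<close>)
    thus ?thesis by simp
  qed
  thus ?thesis by (auto simp: vec_eq_iff mat_unit_def)
qed

lemma mat_unit_unit_vec:
  assumes "i \<in> {1..n}" "k \<in> {1..n}"
  shows "mat_unit i j *v unit_vec k = (if j = k then unit_vec i else 0)"
proof -
  have "(mat_unit i j *v unit_vec k) $ a = (\<Sum>c\<in>UNIV. if c = pos k then (if idx a = i \<and> idx c = j then 1 else 0) else 0)" for a
    unfolding matrix_vector_mult_def mat_unit_def unit_vec_def axis_def vec_lambda_beta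
    by (rule sum.cong[OF refl]) auto
  thus ?thesis using assms
    by (auto simp: vec_eq_iff unit_vec_def axis_def idx_pos pos_idx)
qed

lemma gen_matrix_rep:
  "gen_e matrix_rep i = mat_unit i (i + 1)" "gen_f matrix_rep i = mat_unit (i + 1) i"
  "gen_h matrix_rep i = mat_unit i i - mat_unit (i + 1) (i + 1)"
  by (simp_all add: matrix_rep_def)

lemma matrix_rep_root_vectors:
  assumes "1 \<le> i" "i < j" "j \<le> n"
  shows "root_e \<kappa> matrix_rep i j = (mat_unit i j :: ((complex, 'n) vec, 'n) vec)"
    and "root_f \<kappa> matrix_rep i j = (mat_unit j i :: ((complex, 'n) vec, 'n) vec)"
proof -
  have "root_e \<kappa> matrix_rep i j = (mat_unit i j :: ((complex, 'n) vec, 'n) vec)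
      \<and> root_f \<kappa> matrix_rep i j = (mat_unit j i :: ((complex, 'n) vec, 'n) vec)"
    using assms(2,3)
  proof (induction j)
    case (Suc j)
    show ?case
    proof (cases "j = i")
      case False
      hence *: "i < j" "i \<in> {1..n}" "j \<in> {1..n}" "Suc j \<in> {1..n}" using Suc.prems assms by auto
      thus ?thesis using Suc False
        by (simp add: gen_matrix_rep mat_unit_mult mscale_zero)
    qed (simp add: gen_matrix_rep)
  qed simp
  thus "root_e \<kappa> matrix_rep i j = (mat_unit i j :: ((complex, 'n) vec, 'n) vec)"
    and "root_f \<kappa> matrix_rep i j = (mat_unit j i :: ((complex, 'n) vec, 'n) vec)" by auto
qed

lemma tb_eq: "tb i w = tensor_vec (unit_vec i) w"
  by (auto simp: tb_def tensor_basis_def tensor_vec_def unit_vec_def axis_def vec_eq_iff)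

lemma tb_add: "tb i (w + w') = tb i w + tb i w'"
  and tb_diff: "tb i (w - w') = tb i w - tb i w'"
  and tb_scale: "tb i (c *s w) = c *s tb i w"
  and tb_zero [simp]: "tb i 0 = 0"
  by (simp_all add: tb_def tensor_basis_def vec_eq_iff)

lemma tb_sum: "tb i (\<Sum>k\<in>I. f k) = (\<Sum>k\<in>I. tb i (f k))"
  by (induction I rule: infinite_finite_induct) (simp_all add: tb_add)

lemma coord_tb: "i \<in> {1..n} \<Longrightarrow> j \<in> {1..n} \<Longrightarrow> coord i (tb j w) = (if i = j then w else 0)"
  by (auto simp: coord_def component_def tb_def tensor_basis_def vec_eq_iff pos_eq_iff)

lemma coord_add: "coord i (x + z) = coord i x + coord i z"
  and coord_diff: "coord i (x - z) = coord i x - coord i z"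
  and coord_scale: "coord i (b *s x) = b *s coord i x"
  and coord_zero [simp]: "coord i 0 = 0"
  and coord_sum: "coord i (\<Sum>k\<in>I. f k) = (\<Sum>k\<in>I. coord i (f k))"
  by (simp_all add: coord_def component_add component_diff component_scale component_sum)

lemmas coord_simps = coord_add coord_diff coord_scale coord_zero coord_sum

lemma tb_expansion: "x = (\<Sum>i\<in>{1..n}. tb i (coord i x))"
proof -
  have "(\<Sum>k\<in>UNIV. tensor_basis k (component k x)) = x"
    by (auto simp: vec_eq_iff tensor_basis_def component_def)
  thus ?thesis by (simp add: sum_pos tb_def coord_def)
qed

lemma eq_if_coords_eq: "(\<And>i. i \<in> {1..n} \<Longrightarrow> coord i x = coord i z) \<Longrightarrow> x = z"
  using tb_expansion[of x] tb_expansion[of z] by (metis (no_types, lifting) sum.cong)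

lemma span_tb:
  assumes "vec.span W = UNIV"
  shows "vec.span {tb i w | i w. i \<in> {1..n} \<and> w \<in> W} = UNIV"
proof -
  let ?S = "vec.span {tb i w | i w. i \<in> {1..n} \<and> w \<in> W}"
  have "tb i w \<in> ?S" if i: "i \<in> {1..n}" for i w
  proof -
    have "w \<in> vec.span W" using assms by simp
    thus ?thesis
    proof (induction rule: vec.span_induct_alt)
      case (step c x y)
      have "tb i x \<in> ?S" using step i by (intro vec.span_base) blast
      thus ?case using step by (simp add: tb_add tb_scale vec.span_add vec.span_scale)
    qed (simp add: vec.span_zero)
  qed
  hence "x \<in> ?S" for x by (subst tb_expansion[of x]) (rule vec.span_sum, auto)
  thus ?thesis by auto
qed

lemma tensor_op_tb:
  "tensor_op (mat 1) C *v tb k w = tb k (C *v w)"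
  "i \<in> {1..n} \<Longrightarrow> k \<in> {1..n} \<Longrightarrow> tensor_op (mat_unit i j) (mat 1) *v tb k w = (if j = k then tb i w else 0)"
  by (simp_all add: tb_eq tensor_op_vec mat_unit_unit_vec) (simp_all add: tensor_vec_def vec_eq_iff)

lemma root_vectors_tb:
  assumes "1 \<le> i" "i < j" "j \<le> n" "k \<in> {1..n}"
  shows "root_e \<kappa> A i j *v tb k w = (if j = k then tb i w else 0)"
    and "root_f \<kappa> A i j *v tb k w = (if i = k then tb j w else 0)"
    and "root_e \<kappa> B i j *v tb k w = tb k (root_e \<kappa> V i j *v w)"
    and "root_f \<kappa> B i j *v tb k w = tb k (root_f \<kappa> V i j *v w)"
  using assms
  by (simp_all add: root_vectors_legs matrix_rep_root_vectors tensor_op_tb)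

text \<open>The weight $\epsilon_k$ of \<open>v\<^sub>k\<close>.\<close>

definition unit_weight :: "nat \<Rightarrow> nat \<Rightarrow> complex" where "unit_weight k i = (if i = k then 1 else 0)"

lemma unit_vec_weight: "k \<in> {1..n} \<Longrightarrow> weight_vector n matrix_rep (unit_weight k) (unit_vec k)"
  by (auto simp: weight_vector_def weight_space_def matrix_rep_def unit_weight_def
      matrix_vector_mult_diff_rdistrib mat_unit_unit_vec)

lemma tb_weight_A: "k \<in> {1..n} \<Longrightarrow> weight_vector n A (unit_weight k) (tb k w)"
  using unit_vec_weight[of k]
  by (simp add: weight_vector_def weight_space_def first_leg_def tb_eq tensor_op_vec
) (simp add: tensor_vec_def vec_eq_iff algebra_simps)

lemma tb_weight_B: "w \<in> weight_space n V \<mu> \<Longrightarrow> tb k w \<in> weight_space n B \<mu>"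
  by (auto simp: weight_space_def second_leg_def tensor_op_tb tb_scale)

lemma tb_weight_vector_B: "weight_vector n V \<nu> w \<Longrightarrow> weight_vector n B \<nu> (tb k w)"
  unfolding weight_vector_def by (rule tb_weight_B)

definition c :: complex where "c = exp \<kappa> - inverse (exp \<kappa>)"

lemma sum_roots_second:
  fixes g :: "nat \<Rightarrow> 'x::comm_monoid_add"
  assumes "k \<le> n"
  shows "(\<Sum>r\<in>set (pos_roots n). if snd r = k then g (fst r) else 0) = (\<Sum>i\<in>{1..<k}. g i)"
proof -
  have "(\<Sum>r\<in>set (pos_roots n). if snd r = k then g (fst r) else 0)
      = (\<Sum>r\<in>(\<lambda>i. (i, k)) ` {1..<k}. g (fst r))"
    by (rule sum.mono_neutral_cong_right[OF finite_set]) (use assms in \<open>auto simp: set_pos_roots\<close>)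
  also have "\<dots> = (\<Sum>i\<in>{1..<k}. g i)" by (subst sum.reindex) (auto simp: inj_on_def)
  finally show ?thesis .
qed

lemma sum_roots_first:
  fixes g :: "nat \<Rightarrow> 'x::comm_monoid_add"
  assumes "k \<ge> 1"
  shows "(\<Sum>r\<in>set (pos_roots n). if fst r = k then g (snd r) else 0) = (\<Sum>j\<in>{k<..n}. g j)"
proof -
  have "(\<Sum>r\<in>set (pos_roots n). if fst r = k then g (snd r) else 0)
      = (\<Sum>r\<in>(\<lambda>j. (k, j)) ` {k<..n}. g (snd r))"
    by (rule sum.mono_neutral_cong_right[OF finite_set]) (use assms in \<open>auto simp: set_pos_roots\<close>)
  also have "\<dots> = (\<Sum>j\<in>{k<..n}. g j)" by (subst sum.reindex) (auto simp: inj_on_def)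
  finally show ?thesis .
qed

text \<open>In the vector representation both \<open>R\<close>-matrices collapse: products of matrix units
  $E_{ij}E_{kl}$ vanish in the order in which they occur in $\hat R_{12}$, and the products of
  $E_{ji}$ vanish in the opposite order, in which they occur in the inverse of $\hat R_{21}$.\<close>

definition upper_term :: "nat \<times> nat \<Rightarrow> complex^('n \<times> 'd)^('n \<times> 'd)"
  where "upper_term r = c *\<^sub>M (root_e \<kappa> A (fst r) (snd r) ** root_f \<kappa> B (fst r) (snd r))"

definition lower_term :: "nat \<times> nat \<Rightarrow> complex^('n \<times> 'd)^('n \<times> 'd)"
  where "lower_term r = c *\<^sub>M (root_e \<kappa> B (fst r) (snd r) ** root_f \<kappa> A (fst r) (snd r))"

lemma upper_term_tb:
  "r \<in> set (pos_roots n) \<Longrightarrow> k \<in> {1..n} \<Longrightarrow>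
    upper_term r *v tb k w = (if snd r = k then c *s tb (fst r) (root_f \<kappa> V (fst r) k *v w) else 0)"
  by (auto simp: upper_term_def set_pos_roots mscale_mult_vec root_vectors_tb simp flip: matrix_vector_mul_assoc)

lemma lower_term_tb:
  "r \<in> set (pos_roots n) \<Longrightarrow> k \<in> {1..n} \<Longrightarrow>
    lower_term r *v tb k w = (if fst r = k then c *s tb (snd r) (root_e \<kappa> V k (snd r) *v w) else 0)"
  by (auto simp: lower_term_def set_pos_roots mscale_mult_vec root_vectors_tb simp flip: matrix_vector_mul_assoc)

lemma matrix_eq_on_tb:
  assumes "\<And>k w. k \<in> {1..n} \<Longrightarrow> X *v tb k w = Y *v tb k w"
  shows "X = (Y :: complex^('n \<times> 'd)^('n \<times> 'd))"
  by (rule matrix_eq_on_spanning[OF span_tb[of UNIV]]) (use assms in auto)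

lemma upper_terms_vanish:
  assumes "r \<in> set (pos_roots n)" "s \<in> set (pos_roots n)" "r = s \<or> root_less s r"
  shows "upper_term r ** upper_term s = 0"
proof (rule matrix_eq_on_tb)
  fix k w assume k: "k \<in> {1..n}"
  show "(upper_term r ** upper_term s) *v tb k w = 0 *v tb k w"
  proof (cases "snd s = k")
    case True
    have "fst s \<in> {1..n}" "snd r \<noteq> fst s"
      using assms by (auto simp: set_pos_roots root_less_def)
    thus ?thesis using assms k
      by (simp add: upper_term_tb vec.scale flip: matrix_vector_mul_assoc)
  qed (use assms k in \<open>simp add: upper_term_tb flip: matrix_vector_mul_assoc\<close>)
qed

lemma lower_terms_vanish:
  assumes "r \<in> set (pos_roots n)" "s \<in> set (pos_roots n)" "r = s \<or> root_less r s"
  shows "lower_term r ** lower_term s = 0"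
proof (rule matrix_eq_on_tb)
  fix k w assume k: "k \<in> {1..n}"
  show "(lower_term r ** lower_term s) *v tb k w = 0 *v tb k w"
  proof (cases "fst s = k")
    case True
    have "snd s \<in> {1..n}" "fst r \<noteq> snd s"
      using assms by (auto simp: set_pos_roots root_less_def)
    thus ?thesis using assms k
      by (simp add: lower_term_tb vec.scale flip: matrix_vector_mul_assoc)
  qed (use assms k in \<open>simp add: lower_term_tb flip: matrix_vector_mul_assoc\<close>)
qed

lemma R_hat_upper_tb:
  assumes k: "k \<in> {1..n}"
  shows "R_hat n \<kappa> A B *v tb k w = tb k w + c *s (\<Sum>i\<in>{1..<k}. tb i (root_f \<kappa> V i k *v w))"
proof -
  have "R_hat n \<kappa> A B = prod_gt n (\<lambda>r. mat 1 + upper_term r)"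
    unfolding R_hat_def c_def[symmetric]
  proof (rule prod_gt_cong)
    fix r assume r: "r \<in> set (pos_roots n)"
    have "qexp \<kappa> (upper_term r) = mat 1 + upper_term r"
      by (rule qexp_square_zero[OF upper_terms_vanish q_diff_nonzero]) (use r in auto)
    thus "(case r of (i, j) \<Rightarrow> qexp \<kappa> (c *\<^sub>M (root_e \<kappa> A i j ** root_f \<kappa> B i j))) = mat 1 + upper_term r"
      by (simp add: upper_term_def case_prod_beta)
  qed
  also have "\<dots> = mat 1 + (\<Sum>r\<in>set (pos_roots n). upper_term r)"
    by (rule prod_gt_nilpotent) (use upper_terms_vanish in auto)
  finally have "R_hat n \<kappa> A B *v tb k w = tb k w + (\<Sum>r\<in>set (pos_roots n). upper_term r *v tb k w)"
    by (simp add: op_simps)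
  also have "(\<Sum>r\<in>set (pos_roots n). upper_term r *v tb k w)
      = (\<Sum>r\<in>set (pos_roots n). if snd r = k then c *s tb (fst r) (root_f \<kappa> V (fst r) k *v w) else 0)"
    using upper_term_tb k by (intro sum.cong) auto
  also have "\<dots> = (\<Sum>i\<in>{1..<k}. c *s tb i (root_f \<kappa> V i k *v w))"
    using k by (intro sum_roots_second) auto
  finally show ?thesis by (simp only: vec.scale_sum_right)
qed

definition R_hat_lower_inv :: "complex^('n \<times> 'd)^('n \<times> 'd)"
  where "R_hat_lower_inv = mat 1 - (\<Sum>r\<in>set (pos_roots n). lower_term r)"

lemma R_hat_lower_inverse:
  "R_hat n \<kappa> B A ** R_hat_lower_inv = mat 1" "R_hat_lower_inv ** R_hat n \<kappa> B A = mat 1"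
proof -
  have "R_hat n \<kappa> B A = prod_gt n (\<lambda>r. mat 1 + lower_term r)"
    unfolding R_hat_def c_def[symmetric]
  proof (rule prod_gt_cong)
    fix r assume r: "r \<in> set (pos_roots n)"
    have "qexp \<kappa> (lower_term r) = mat 1 + lower_term r"
      by (rule qexp_square_zero[OF lower_terms_vanish q_diff_nonzero]) (use r in auto)
    thus "(case r of (i, j) \<Rightarrow> qexp \<kappa> (c *\<^sub>M (root_e \<kappa> B i j ** root_f \<kappa> A i j))) = mat 1 + lower_term r"
      by (simp add: lower_term_def case_prod_beta)
  qed
  thus "R_hat n \<kappa> B A ** R_hat_lower_inv = mat 1"
    unfolding R_hat_lower_inv_def using prod_gt_inverse[of n lower_term] lower_terms_vanish by simp
  thus "R_hat_lower_inv ** R_hat n \<kappa> B A = mat 1"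
    by (simp add: matrix_left_right_inverse)
qed

lemma R_hat_lower_inv_tb:
  assumes k: "k \<in> {1..n}"
  shows "R_hat_lower_inv *v tb k w = tb k w - c *s (\<Sum>j\<in>{k<..n}. tb j (root_e \<kappa> V k j *v w))"
proof -
  have "R_hat_lower_inv *v tb k w = tb k w - (\<Sum>r\<in>set (pos_roots n). lower_term r *v tb k w)"
    by (simp add: R_hat_lower_inv_def op_simps)
  also have "(\<Sum>r\<in>set (pos_roots n). lower_term r *v tb k w)
      = (\<Sum>r\<in>set (pos_roots n). if fst r = k then c *s tb (snd r) (root_e \<kappa> V k (snd r) *v w) else 0)"
    using lower_term_tb k by (intro sum.cong) auto
  also have "\<dots> = (\<Sum>j\<in>{k<..n}. c *s tb j (root_e \<kappa> V k j *v w))"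
    using k by (intro sum_roots_first) auto
  finally show ?thesis by (simp only: vec.scale_sum_right)
qed

end


section \<open>Operators in coordinates\<close>

lemma invertible_on_eigenvectors:
  fixes M :: "complex^'m^'m"
  assumes E: "vec.span E = UNIV" and ev: "\<And>x. x \<in> E \<Longrightarrow> M *v x = \<beta> x *s x \<and> \<beta> x \<noteq> 0"
  shows "M ** matrix_inv M = mat 1" "matrix_inv M ** M = mat 1"
proof -
  have "z \<in> range ((*v) M)" for z
  proof -
    have "z \<in> vec.span E" using E by simp
    thus ?thesis
    proof (induction rule: vec.span_induct_alt)
      case base
      thus ?case by (metis rangeI vec.zero)
    next
      case (step d x y)
      obtain y' where y: "y = M *v y'" using step by blast
      have "M *v ((d * inverse (\<beta> x)) *s x + y') = d *s x + y"
        using ev[OF step(1)] by (simp add: vec.add vec.scale y)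
      thus ?case by (metis rangeI)
    qed
  qed
  hence "surj ((*v) M)" by auto
  then obtain M' where M': "M ** M' = mat 1"
    using matrix_right_invertible_surjective by blast
  hence "M' ** M = mat 1" by (simp add: matrix_left_right_inverse)
  with M' show "M ** matrix_inv M = mat 1" "matrix_inv M ** M = mat 1"
    using matrix_inv_unique by metis+
qed

lemma conjugation_eq_iff:
  fixes R F M :: "complex^'m^'m"
  assumes M: "M ** matrix_inv M = mat 1" "matrix_inv M ** M = mat 1"
  shows "R ** F = M ** F ** matrix_inv M \<longleftrightarrow> R ** F ** M = M ** F"
proof
  assume "R ** F = M ** F ** matrix_inv M"
  hence "R ** F ** M = M ** F ** (matrix_inv M ** M)" by (metis matrix_mul_assoc)
  thus "R ** F ** M = M ** F" unfolding M(2) matrix_mul_rid .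
next
  assume "R ** F ** M = M ** F"
  hence "R ** F ** (M ** matrix_inv M) = M ** F ** matrix_inv M" by (metis matrix_mul_assoc)
  thus "R ** F = M ** F ** matrix_inv M" unfolding M(1) matrix_mul_rid .
qed

lemma weight_vector_zero: "weight_vector n a \<nu> 0"
  by (simp add: weight_vector_def weight_space_def)

lemma weight_vector_scale: "weight_vector n a \<nu> w \<Longrightarrow> weight_vector n a \<nu> (b *s w)"
  unfolding weight_vector_def by (rule vec.subspace_scale[OF subspace_weight_space])

context vector_tensor
begin

text \<open>The eigenvalue of the operator \<open>B\<close> in the shift equation on vectors of weight \<open>\<nu>\<close>.\<close>

definition twist :: "(nat \<Rightarrow> complex) \<Rightarrow> (nat \<Rightarrow> complex) \<Rightarrow> complex"
  where "twist y \<nu> = qpow \<kappa> (weight_form n \<nu> \<nu> + weight_form n y \<nu>)"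

lemma twist_nonzero: "twist y \<nu> \<noteq> 0"
  by (simp add: twist_def)

lemma sum_unit_weight: "k \<in> {1..n} \<Longrightarrow> (\<Sum>s\<in>{1..n}. unit_weight k s) = 1"
  by (simp add: unit_weight_def)

lemma sum_mult_unit_weight: "k \<in> {1..n} \<Longrightarrow> (\<Sum>s\<in>{1..n}. f s * unit_weight k s) = f k"
proof -
  assume k: "k \<in> {1..n}"
  have "(\<Sum>s\<in>{1..n}. f s * unit_weight k s) = (\<Sum>s\<in>{1..n}. if s = k then f s else 0)"
    by (rule sum.cong[OF refl]) (simp add: unit_weight_def)
  thus ?thesis using k by simp
qed

text \<open>The weight obtained from \<open>\<nu>\<close> by subtracting the root $\epsilon_i-\epsilon_k$.\<close>

definition shifted :: "nat \<Rightarrow> nat \<Rightarrow> (nat \<Rightarrow> complex) \<Rightarrow> nat \<Rightarrow> complex"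
  where "shifted k i \<nu> s = \<nu> s + unit_weight k s - unit_weight i s"

lemma sum_shifted: "i \<in> {1..n} \<Longrightarrow> k \<in> {1..n} \<Longrightarrow> sum (shifted k i \<nu>) {1..n} = sum \<nu> {1..n}"
  unfolding shifted_def sum.distrib sum_subtractf
  by (simp only: sum_unit_weight add_diff_cancel)

text \<open>Subtracting the root $\epsilon_i-\epsilon_k$ changes the quadratic term of the exponent by
  $2(\nu_k-\nu_i)+2$ and the linear one by $y_k-y_i$.\<close>

lemma twist_shifted:
  assumes "i \<in> {1..n}" "k \<in> {1..n}" "i \<noteq> k"
  shows "twist y (shifted k i \<nu>) = qpow \<kappa> (2 * \<nu> k - 2 * \<nu> i + 2 + y k - y i) * twist y \<nu>"
proof -
  have "(\<Sum>s\<in>{1..n}. shifted k i \<nu> s * shifted k i \<nu> s)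
      = (\<Sum>s\<in>{1..n}. \<nu> s * \<nu> s + (2 * \<nu> s + 1) * unit_weight k s - (2 * \<nu> s - 1) * unit_weight i s)"
    by (rule sum.cong[OF refl]) (use assms in \<open>auto simp: shifted_def unit_weight_def algebra_simps\<close>)
  also have "\<dots> = (\<Sum>s\<in>{1..n}. \<nu> s * \<nu> s) + (2 * \<nu> k + 1) - (2 * \<nu> i - 1)"
    by (simp only: sum.distrib sum_subtractf sum_mult_unit_weight[OF assms(1)] sum_mult_unit_weight[OF assms(2)])
  finally have "weight_form n (shifted k i \<nu>) (shifted k i \<nu>) = weight_form n \<nu> \<nu> + 2 * \<nu> k - 2 * \<nu> i + 2"
    unfolding weight_form_def sum_shifted[OF assms(1,2)] by (simp add: algebra_simps)
  moreover have "(\<Sum>s\<in>{1..n}. y s * shifted k i \<nu> s) = (\<Sum>s\<in>{1..n}. y s * \<nu> s) + y k - y i"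
    unfolding shifted_def
    by (simp only: right_diff_distrib distrib_left sum.distrib sum_subtractf
        sum_mult_unit_weight[OF assms(1)] sum_mult_unit_weight[OF assms(2)])
  hence "weight_form n y (shifted k i \<nu>) = weight_form n y \<nu> + y k - y i"
    unfolding weight_form_def sum_shifted[OF assms(1,2)] by simp
  ultimately have "weight_form n (shifted k i \<nu>) (shifted k i \<nu>) + weight_form n y (shifted k i \<nu>)
      = (2 * \<nu> k - 2 * \<nu> i + 2 + y k - y i) + (weight_form n \<nu> \<nu> + weight_form n y \<nu>)"
    by simp
  thus ?thesis unfolding twist_def by (simp only: qpow_add)
qed

lemma twist_unit_weight:
  assumes "i \<in> {1..n}" "k \<in> {1..n}"
  shows "twist y (unit_weight k) = qpow \<kappa> (y k - y i) * twist y (unit_weight i)"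
proof -
  have "weight_form n (unit_weight j) (unit_weight j) + weight_form n y (unit_weight j)
      = 1 - 1 / of_nat n + y j - sum y {1..n} / of_nat n" if j: "j \<in> {1..n}" for j
    unfolding weight_form_def sum_mult_unit_weight[OF j] sum_unit_weight[OF j] by (simp add: unit_weight_def)
  from this[OF assms(1)] this[OF assms(2)]
  have "weight_form n (unit_weight k) (unit_weight k) + weight_form n y (unit_weight k)
      = (y k - y i) + (weight_form n (unit_weight i) (unit_weight i) + weight_form n y (unit_weight i))"
    by simp
  thus ?thesis unfolding twist_def by (simp only: qpow_add)
qed

lemma coord_expand:
  "coord i (X *v x) = (\<Sum>j\<in>{1..n}. coord i (X *v tb j (coord j x)))"
proof -
  have "X *v x = (\<Sum>j\<in>{1..n}. X *v tb j (coord j x))"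
    using arg_cong[OF tb_expansion[of x], of "(*v) X"] unfolding vec.sum .
  thus ?thesis unfolding coord_def component_sum[symmetric] by (rule arg_cong)
qed

lemma coord_R_hat_upper:
  assumes i: "i \<in> {1..n}"
  shows "coord i (R_hat n \<kappa> A B *v x) = coord i x + c *s (\<Sum>j\<in>{i<..n}. root_f \<kappa> V i j *v coord j x)"
proof -
  have "coord i (R_hat n \<kappa> A B *v tb j (coord j x))
      = (if j = i then coord i x else 0) + c *s (if i < j then root_f \<kappa> V i j *v coord j x else 0)"
    if j: "j \<in> {1..n}" for j
  proof -
    have "coord i (\<Sum>i'\<in>{1..<j}. tb i' (root_f \<kappa> V i' j *v coord j x))
        = (\<Sum>i'\<in>{1..<j}. if i' = i then root_f \<kappa> V i j *v coord j x else 0)"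
      unfolding coord_simps by (rule sum.cong[OF refl]) (use i j in \<open>auto simp: coord_tb\<close>)
    also have "\<dots> = (if i < j then root_f \<kappa> V i j *v coord j x else 0)"
      using i by simp
    finally show ?thesis using i j by (simp add: R_hat_upper_tb coord_simps coord_tb)
  qed
  hence "coord i (R_hat n \<kappa> A B *v x) = (\<Sum>j\<in>{1..n}. (if j = i then coord i x else 0)
      + c *s (if i < j then root_f \<kappa> V i j *v coord j x else 0))"
    by (rule trans[OF coord_expand sum.cong[OF refl]])
  also have "\<dots> = coord i x + c *s (\<Sum>j\<in>{1..n}. if i < j then root_f \<kappa> V i j *v coord j x else 0)"
    using i by (simp add: sum.distrib flip: vec.scale_sum_right)
  also have "(\<Sum>j\<in>{1..n}. if i < j then root_f \<kappa> V i j *v coord j x else 0)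
      = (\<Sum>j\<in>{i<..n}. root_f \<kappa> V i j *v coord j x)"
    using i by (intro sum.mono_neutral_cong_right) auto
  finally show ?thesis .
qed

text \<open>Block unitriangular operators $1+\sum_{i<j}E_{ji}\otimes Z_{ij}$.\<close>

definition lower_op :: "(nat \<Rightarrow> nat \<Rightarrow> complex^'d^'d) \<Rightarrow> complex^('n \<times> 'd)^('n \<times> 'd)"
  where "lower_op Z = mat 1 + (\<Sum>r\<in>set (pos_roots n). tensor_op (mat 1) (Z (fst r) (snd r)) ** root_f \<kappa> A (fst r) (snd r))"

lemma lower_op_tb:
  assumes k: "k \<in> {1..n}"
  shows "lower_op Z *v tb k w = tb k w + (\<Sum>j\<in>{k<..n}. tb j (Z k j *v w))"
proof -
  have "lower_op Z *v tb k w = tb k w + (\<Sum>r\<in>set (pos_roots n).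
      (tensor_op (mat 1) (Z (fst r) (snd r)) ** root_f \<kappa> A (fst r) (snd r)) *v tb k w)"
    by (simp add: lower_op_def op_simps)
  also have "(\<Sum>r\<in>set (pos_roots n).
      (tensor_op (mat 1) (Z (fst r) (snd r)) ** root_f \<kappa> A (fst r) (snd r)) *v tb k w)
      = (\<Sum>r\<in>set (pos_roots n). if fst r = k then tb (snd r) (Z k (snd r) *v w) else 0)"
    using k by (intro sum.cong[OF refl])
      (auto simp: set_pos_roots root_vectors_tb tensor_op_tb simp flip: matrix_vector_mul_assoc)
  also have "\<dots> = (\<Sum>j\<in>{k<..n}. tb j (Z k j *v w))"
    using k by (intro sum_roots_first) auto
  finally show ?thesis .
qed

lemma coord_lower_op:
  assumes i: "i \<in> {1..n}"
  shows "coord i (lower_op Z *v x) = coord i x + (\<Sum>j\<in>{1..<i}. Z j i *v coord j x)"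
proof -
  have "coord i (lower_op Z *v tb j (coord j x))
      = (if j = i then coord i x else 0) + (if j < i then Z j i *v coord j x else 0)"
    if j: "j \<in> {1..n}" for j
  proof -
    have "coord i (\<Sum>i'\<in>{j<..n}. tb i' (Z j i' *v coord j x))
        = (\<Sum>i'\<in>{j<..n}. if i' = i then Z j i *v coord j x else 0)"
      unfolding coord_simps by (rule sum.cong[OF refl]) (use i j in \<open>auto simp: coord_tb\<close>)
    also have "\<dots> = (if j < i then Z j i *v coord j x else 0)"
      using i by simp
    finally show ?thesis using i j by (simp add: lower_op_tb coord_simps coord_tb)
  qed
  hence "coord i (lower_op Z *v x) = (\<Sum>j\<in>{1..n}. (if j = i then coord i x else 0)
      + (if j < i then Z j i *v coord j x else 0))"
    by (rule trans[OF coord_expand sum.cong[OF refl]])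
  also have "\<dots> = coord i x + (\<Sum>j\<in>{1..n}. if j < i then Z j i *v coord j x else 0)"
    using i by (simp add: sum.distrib)
  also have "(\<Sum>j\<in>{1..n}. if j < i then Z j i *v coord j x else 0) = (\<Sum>j\<in>{1..<i}. Z j i *v coord j x)"
    using i by (intro sum.mono_neutral_cong_right) auto
  finally show ?thesis .
qed

lemma tb_minus: "tb i (- w) = - tb i w"
  using tb_diff[of i 0 w] by simp

lemma R_hat_lower_inv_eq: "R_hat_lower_inv = lower_op (\<lambda>i j. (- c) *\<^sub>M root_e \<kappa> V i j)"
proof (rule matrix_eq_on_tb)
  fix k w assume k: "k \<in> {1..n}"
  show "R_hat_lower_inv *v tb k w = lower_op (\<lambda>i j. (- c) *\<^sub>M root_e \<kappa> V i j) *v tb k w"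
    unfolding R_hat_lower_inv_tb[OF k] lower_op_tb[OF k]
    by (simp only: mscale_mult_vec tb_scale vec.scale_minus_left tb_minus sum_negf vec.scale_sum_right diff_conv_add_uminus)
qed

lemma coord_twist_B:
  assumes "\<And>j. j \<in> {1..n} \<Longrightarrow> weight_vector n V (\<nu> j) (coord j x)" and i: "i \<in> {1..n}"
  shows "coord i (B_op n \<kappa> y B *v x) = twist y (\<nu> i) *s coord i x"
proof -
  have "coord i (B_op n \<kappa> y B *v x) = (\<Sum>j\<in>{1..n}. if j = i then twist y (\<nu> i) *s coord i x else 0)"
  proof (rule trans[OF coord_expand sum.cong[OF refl]])
    fix j assume j: "j \<in> {1..n}"
    show "coord i (B_op n \<kappa> y B *v tb j (coord j x)) = (if j = i then twist y (\<nu> i) *s coord i x else 0)"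
      using B_op_weight_vector[OF tb_weight_vector_B[OF assms(1)[OF j]], of \<kappa> y j] i j
      by (simp add: coord_simps coord_tb flip: twist_def)
  qed
  thus ?thesis using i by simp
qed

lemma twist_A_tb: "k \<in> {1..n} \<Longrightarrow> B_op n \<kappa> y A *v tb k w = twist y (unit_weight k) *s tb k w"
  using B_op_weight_vector[OF tb_weight_A, of k \<kappa> y w] by (simp add: twist_def)

lemma coord_twist_A:
  assumes i: "i \<in> {1..n}"
  shows "coord i (B_op n \<kappa> y A *v x) = twist y (unit_weight i) *s coord i x"
proof -
  have "coord i (B_op n \<kappa> y A *v x) = (\<Sum>j\<in>{1..n}. if j = i then twist y (unit_weight i) *s coord i x else 0)"
  proof (rule trans[OF coord_expand sum.cong[OF refl]])
    fix j assume j: "j \<in> {1..n}"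
    show "coord i (B_op n \<kappa> y A *v tb j (coord j x)) = (if j = i then twist y (unit_weight i) *s coord i x else 0)"
      using twist_A_tb[OF j] i j by (simp add: coord_simps coord_tb)
  qed
  thus ?thesis using i by simp
qed

lemma twist_A_invertible:
  "B_op n \<kappa> y A ** matrix_inv (B_op n \<kappa> y A) = mat 1" "matrix_inv (B_op n \<kappa> y A) ** B_op n \<kappa> y A = mat 1"
proof -
  have E: "vec.span {tb i w | i w. i \<in> {1..n} \<and> w \<in> UNIV} = UNIV" by (rule span_tb) simp
  have "\<exists>\<beta>. \<forall>x\<in>{tb i w | i w. i \<in> {1..n} \<and> w \<in> UNIV}. B_op n \<kappa> y A *v x = \<beta> x *s x \<and> \<beta> x \<noteq> 0"
    using twist_A_tb twist_nonzero by (intro bchoice) blast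
  thus "B_op n \<kappa> y A ** matrix_inv (B_op n \<kappa> y A) = mat 1" "matrix_inv (B_op n \<kappa> y A) ** B_op n \<kappa> y A = mat 1"
    using invertible_on_eigenvectors[OF E] by blast+
qed


section \<open>Triangularity of shifts\<close>

lemma gen_h_matrix_rep_component:
  "s \<in> {1..<n} \<Longrightarrow> i \<in> {1..n} \<Longrightarrow> (gen_h matrix_rep s *v x) $ pos i = (unit_weight i s - unit_weight i (s + 1)) * x $ pos i"
proof -
  assume s: "s \<in> {1..<n}" and i: "i \<in> {1..n}"
  have diag: "(mat_unit t t *v x) $ pos i = unit_weight i t * x $ pos i" if "t \<in> {1..n}" for t
  proof -
    have "(mat_unit t t *v x) $ pos i = (\<Sum>b\<in>UNIV. if b = pos t then (if i = t then x $ pos t else 0) else 0)"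
      unfolding matrix_vector_mult_def mat_unit_def vec_lambda_beta
      by (rule sum.cong[OF refl]) (use i that in \<open>auto simp: idx_pos pos_idx\<close>)
    thus ?thesis by (auto simp: unit_weight_def)
  qed
  show ?thesis using s
    by (simp add: gen_matrix_rep matrix_vector_mult_diff_rdistrib diag left_diff_distrib)
qed

text \<open>A matrix element of a homogeneous operator in the vector representation determines its
  weight: it is the difference of the weights $\epsilon_i$ and $\epsilon_k$ of the basis vectors.  The
  inverse Cartan matrix recovers from it the coefficients of the simple roots.\<close>

lemma matrix_element_weight:
  assumes X: "shifts_weight n matrix_rep (\<lambda>s. \<sigma> * (\<Sum>t\<in>{1..<n}. of_nat (w t) * cartan s t)) X"
    and ik: "i \<in> {1..n}" "k \<in> {1..n}" and nz: "(X *v unit_vec k) $ pos i \<noteq> 0"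
  shows "\<And>s. s \<in> {1..<n} \<Longrightarrow> unit_weight i s - unit_weight i (s + 1)
            = unit_weight k s - unit_weight k (s + 1) + \<sigma> * (\<Sum>t\<in>{1..<n}. of_nat (w t) * cartan s t)"
    and "\<And>t. t \<in> {1..<n} \<Longrightarrow> \<sigma> * of_nat (w t) = (if i \<le> t then 1 else 0) - (if k \<le> t then 1 else 0)"
proof -
  have "X *v unit_vec k \<in> weight_space n matrix_rep (\<lambda>s. unit_weight k s - unit_weight k (s + 1)
      + \<sigma> * (\<Sum>t\<in>{1..<n}. of_nat (w t) * cartan s t))"
    by (rule X[unfolded shifts_weight_def, rule_format, OF unit_vec_weight[OF ik(2), unfolded weight_vector_def]])
  hence eig: "(gen_h matrix_rep s *v (X *v unit_vec k)) $ pos i = (unit_weight k s - unit_weight k (s + 1)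
      + \<sigma> * (\<Sum>t\<in>{1..<n}. of_nat (w t) * cartan s t)) * (X *v unit_vec k) $ pos i" if "s \<in> {1..<n}" for s
    using that by (simp add: weight_space_def distrib_right left_diff_distrib)
  show *: "unit_weight i s - unit_weight i (s + 1)
            = unit_weight k s - unit_weight k (s + 1) + \<sigma> * (\<Sum>t\<in>{1..<n}. of_nat (w t) * cartan s t)"
    if "s \<in> {1..<n}" for s
    using trans[OF gen_h_matrix_rep_component[OF that ik(1), symmetric] eig[OF that]]
    unfolding mult_right_cancel[OF nz] .
  fix t assume t: "t \<in> {1..<n}"
  have cw: "coweight n (unit_weight j) t = (if j \<le> t then 1 else 0) - of_nat t / of_nat n" if "j \<in> {1..n}" for j
  proof -
    have "sum (unit_weight j) {1..t} = (if j \<le> t then 1 else 0)"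
      using that by (simp add: unit_weight_def)
    thus ?thesis unfolding coweight_def sum_unit_weight[OF that] by simp
  qed
  have "coweight n (unit_weight i) t - coweight n (unit_weight k) t
      = (\<Sum>s\<in>{1..<n}. cartan_inv n t s * (unit_weight i s - unit_weight i (s + 1)))
        - (\<Sum>s\<in>{1..<n}. cartan_inv n t s * (unit_weight k s - unit_weight k (s + 1)))"
    by (simp only: sum_cartan_inv_differences[OF t])
  also have "\<dots> = (\<Sum>s\<in>{1..<n}. cartan_inv n t s * (\<sigma> * (\<Sum>t'\<in>{1..<n}. of_nat (w t') * cartan s t')))"
    unfolding sum_subtractf[symmetric] right_diff_distrib[symmetric]
  proof (rule sum.cong[OF refl])
    fix s assume s: "s \<in> {1..<n}"
    show "cartan_inv n t s * (unit_weight i s - unit_weight i (s + 1) - (unit_weight k s - unit_weight k (s + 1)))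
        = cartan_inv n t s * (\<sigma> * (\<Sum>t'\<in>{1..<n}. of_nat (w t') * cartan s t'))"
      unfolding *[OF s] by simp
  qed
  also have "\<dots> = (\<Sum>s\<in>{1..<n}. \<Sum>t'\<in>{1..<n}. \<sigma> * of_nat (w t') * (cartan_inv n t s * cartan s t'))"
    unfolding sum_distrib_left by (intro sum.cong[OF refl]) (simp only: mult_ac)
  also have "\<dots> = (\<Sum>t'\<in>{1..<n}. \<sigma> * of_nat (w t') * (\<Sum>s\<in>{1..<n}. cartan_inv n t s * cartan s t'))"
    by (subst sum.swap) (simp only: sum_distrib_left)
  also have "\<dots> = (\<Sum>t'\<in>{1..<n}. if t' = t then \<sigma> * of_nat (w t') else 0)"
    by (rule sum.cong[OF refl]) (simp only: cartan_inv_dual[OF t], auto)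
  also have "\<dots> = \<sigma> * of_nat (w t)" using t by simp
  finally show "\<sigma> * of_nat (w t) = (if i \<le> t then 1 else 0) - (if k \<le> t then 1 else 0)"
    by (simp add: cw[OF ik(1)] cw[OF ik(2)])
qed

lemma graded_matrix_rep: "graded_action n (matrix_rep :: 'n action)"
proof -
  have h_e: "comm (gen_h matrix_rep i) (gen_e matrix_rep j) = cartan i j *\<^sub>M (gen_e matrix_rep j :: ((complex, 'n) vec, 'n) vec)"
   and h_f: "comm (gen_h matrix_rep i) (gen_f matrix_rep j) = (- cartan i j) *\<^sub>M (gen_f matrix_rep j :: ((complex, 'n) vec, 'n) vec)"
    if ij: "i \<in> {1..<n}" "j \<in> {1..<n}" for i j
  proof -
    have *: "i \<in> {1..n}" "i + 1 \<in> {1..n}" "j \<in> {1..n}" "j + 1 \<in> {1..n}" using ij by auto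
    have diff: "(P - Q) ** C = P ** C - Q ** C" "C ** (P - Q) = C ** P - C ** Q"
      for P Q C :: "((complex, 'n) vec, 'n) vec"
      by (simp_all add: matrix_eq op_simps vec.diff flip: matrix_vector_mul_assoc)
    show "comm (gen_h matrix_rep i) (gen_e matrix_rep j) = cartan i j *\<^sub>M (gen_e matrix_rep j :: ((complex, 'n) vec, 'n) vec)"
      "comm (gen_h matrix_rep i) (gen_f matrix_rep j) = (- cartan i j) *\<^sub>M (gen_f matrix_rep j :: ((complex, 'n) vec, 'n) vec)"
      unfolding comm_def gen_matrix_rep diff mat_unit_mult[OF *(1) *(3)] mat_unit_mult[OF *(2) *(3)]
        mat_unit_mult[OF *(4) *(1)] mat_unit_mult[OF *(4) *(2)] mat_unit_mult[OF *(3) *(1)] mat_unit_mult[OF *(3) *(2)]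
        mat_unit_mult[OF *(1) *(4)] mat_unit_mult[OF *(2) *(4)]
      by (auto simp: cartan_def mscale_def vec_eq_iff)
  qed
  thus ?thesis unfolding graded_action_def by blast
qed

end


lemma pbw_weight_eq_zero_iff:
  "p \<in> pbw_exponents n \<Longrightarrow> (\<forall>k\<in>{1..<n}. pbw_weight n p k = 0) \<longleftrightarrow> p = (\<lambda>_. 0)"
  using pbw_weight_zero_imp[of p n] by (auto simp: pbw_weight_def)

lemma shift_formE:
  assumes "shift_form n \<kappa> a b F"
  obtains S \<phi> where "finite S" "(\<lambda>_. 0, \<lambda>_. 0) \<in> S"
    "\<And>p r. (p, r) \<in> S \<Longrightarrow> p \<in> pbw_exponents n \<and> r \<in> pbw_exponents n
            \<and> (\<forall>k\<in>{1..<n}. pbw_weight n p k = pbw_weight n r k) \<and> cartan_function n b (\<phi> p r)"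
    "\<phi> (\<lambda>_. 0) (\<lambda>_. 0) = mat 1"
    "F = (\<Sum>(p, r)\<in>S. pbw_e n \<kappa> a p ** pbw_f n \<kappa> b r ** \<phi> p r)"
proof -
  from assms[unfolded shift_form_def] obtain S \<phi> where S: "finite S" "(\<lambda>_. 0, \<lambda>_. 0) \<in> S"
    and pr: "\<forall>(p, r)\<in>S. p \<in> pbw_exponents n \<and> r \<in> pbw_exponents n
            \<and> (\<forall>k\<in>{1..<n}. pbw_weight n p k = pbw_weight n r k) \<and> cartan_function n b (\<phi> p r)"
    and \<phi>: "\<phi> (\<lambda>_. 0) (\<lambda>_. 0) = mat 1"
    and F: "F = (\<Sum>(p, r)\<in>S. pbw_e n \<kappa> a p ** pbw_f n \<kappa> b r ** \<phi> p r)"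
    by (elim exE conjE) (rule that)
  show thesis
  proof (rule that[OF S _ \<phi> F])
    fix p r assume "(p, r) \<in> S"
    from bspec[OF pr this] show "p \<in> pbw_exponents n \<and> r \<in> pbw_exponents n
            \<and> (\<forall>k\<in>{1..<n}. pbw_weight n p k = pbw_weight n r k) \<and> cartan_function n b (\<phi> p r)"
      unfolding prod.case .
  qed
qed

context vector_tensor
begin

lemma coord_pbw_tb:
  assumes "k \<in> {1..n}" "i \<in> {1..n}"
  shows "coord i ((pbw_e n \<kappa> A p ** pbw_f n \<kappa> B r) *v tb k w)
           = ((pbw_e n \<kappa> matrix_rep p *v unit_vec k) $ pos i) *s (pbw_f n \<kappa> V r *v w)"
    and "coord i ((pbw_e n \<kappa> B p ** pbw_f n \<kappa> A r) *v tb k w)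
           = ((pbw_f n \<kappa> matrix_rep r *v unit_vec k) $ pos i) *s (pbw_e n \<kappa> V p *v w)"
proof -
  have "coord i (tensor_vec x z) = x $ pos i *s z" for x z
    by (simp add: coord_def component_def tensor_vec_def vec_eq_iff)
  thus "coord i ((pbw_e n \<kappa> A p ** pbw_f n \<kappa> B r) *v tb k w)
           = ((pbw_e n \<kappa> matrix_rep p *v unit_vec k) $ pos i) *s (pbw_f n \<kappa> V r *v w)"
    "coord i ((pbw_e n \<kappa> B p ** pbw_f n \<kappa> A r) *v tb k w)
           = ((pbw_f n \<kappa> matrix_rep r *v unit_vec k) $ pos i) *s (pbw_e n \<kappa> V p *v w)"
    by (simp_all add: pbw_legs tensor_op_mult tb_eq tensor_op_vec)
qed

text \<open>The weight $\epsilon_i-\epsilon_k$ is a nonnegative combination of simple roots only for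
  \<open>i \<le> k\<close>, and it vanishes only for \<open>i = k\<close>, where a PBW element must be trivial.\<close>

lemma pbw_matrix_element:
  assumes p: "p \<in> pbw_exponents n" and ik: "i \<in> {1..n}" "k \<in> {1..n}"
  shows "(pbw_e n \<kappa> matrix_rep p *v unit_vec k) $ pos i \<noteq> 0 \<Longrightarrow> i \<le> k \<and> (i = k \<longrightarrow> p = (\<lambda>_. 0))"
    and "(pbw_f n \<kappa> matrix_rep p *v unit_vec k) $ pos i \<noteq> 0 \<Longrightarrow> k \<le> i \<and> (i = k \<longrightarrow> p = (\<lambda>_. 0))"
proof -
  let ?w = "pbw_weight n p"
  assume nz: "(pbw_e n \<kappa> matrix_rep p *v unit_vec k) $ pos i \<noteq> 0"
  have w: "of_nat (?w t) = (if i \<le> t then 1 else 0) - (if k \<le> t then 1 else 0 :: complex)" if "t \<in> {1..<n}" for t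
    using matrix_element_weight(2)[of 1 ?w, OF _ ik nz that] shifts_weight_pbw(1)[OF graded_matrix_rep] by simp
  have "i \<le> k"
  proof (rule ccontr)
    assume "\<not> i \<le> k"
    hence "of_nat (?w k) = (- 1 :: complex)" using w[of k] ik by simp
    from arg_cong[OF this, of Re] show False by simp
  qed
  moreover have "p = (\<lambda>_. 0)" if "i = k"
    using w that pbw_weight_eq_zero_iff[OF p] by auto
  ultimately show "i \<le> k \<and> (i = k \<longrightarrow> p = (\<lambda>_. 0))" by blast
next
  let ?w = "pbw_weight n p"
  assume nz: "(pbw_f n \<kappa> matrix_rep p *v unit_vec k) $ pos i \<noteq> 0"
  have w: "- of_nat (?w t) = (if i \<le> t then 1 else 0) - (if k \<le> t then 1 else 0 :: complex)" if "t \<in> {1..<n}" for t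
    using matrix_element_weight(2)[of "- 1" ?w, OF _ ik nz that] shifts_weight_pbw(2)[OF graded_matrix_rep] by simp
  have "k \<le> i"
  proof (rule ccontr)
    assume "\<not> k \<le> i"
    hence "- of_nat (?w i) = (1 :: complex)" using w[of i] ik by simp
    from arg_cong[OF this, of Re] show False by simp
  qed
  moreover have "p = (\<lambda>_. 0)" if "i = k"
    using w that pbw_weight_eq_zero_iff[OF p] by auto
  ultimately show "k \<le> i \<and> (i = k \<longrightarrow> p = (\<lambda>_. 0))" by blast
qed

text \<open>In the expansion of a shift, a pair of PBW elements of equal weight is trivial as soon as one of its
  members is.  So on the diagonal of the vector representation only the term $1\otimes1$ remains, and
  the other terms lie on one side of it.\<close>

lemma shift_form_lower:
  assumes F: "shift_form n \<kappa> B A F" and k: "k \<in> {1..n}"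
  shows "\<And>i. i \<in> {1..n} \<Longrightarrow> i < k \<Longrightarrow> coord i (F *v tb k w) = 0"
    and "coord k (F *v tb k w) = w"
proof -
  obtain S \<phi> where S: "finite S" "(\<lambda>_. 0, \<lambda>_. 0) \<in> S"
    and pr: "\<And>p r. (p, r) \<in> S \<Longrightarrow> p \<in> pbw_exponents n \<and> r \<in> pbw_exponents n
            \<and> (\<forall>k\<in>{1..<n}. pbw_weight n p k = pbw_weight n r k) \<and> cartan_function n A (\<phi> p r)"
    and \<phi>0: "\<phi> (\<lambda>_. 0) (\<lambda>_. 0) = mat 1"
    and F_eq: "F = (\<Sum>(p, r)\<in>S. pbw_e n \<kappa> B p ** pbw_f n \<kappa> A r ** \<phi> p r)"
    by (fact shift_formE[OF F])
  have "\<exists>g. \<phi> p r *v tb k w = g *s tb k w" if "(p, r) \<in> S" for p r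
    using pr[OF that] tb_weight_A[OF k, of w] unfolding cartan_function_def weight_vector_def by blast
  then obtain g where g: "\<And>p r. (p, r) \<in> S \<Longrightarrow> \<phi> p r *v tb k w = g p r *s tb k w" by metis
  have exp: "coord i (F *v tb k w) = (\<Sum>(p, r)\<in>S.
      (g p r * (pbw_f n \<kappa> matrix_rep r *v unit_vec k) $ pos i) *s (pbw_e n \<kappa> V p *v w))"
    if i: "i \<in> {1..n}" for i
    unfolding F_eq sum_mult_vec coord_sum
  proof (rule sum.cong[OF refl])
    fix x assume x: "x \<in> S"
    obtain p r where x_eq: "x = (p, r)" by fastforce
    let ?P = "pbw_e n \<kappa> B p ** pbw_f n \<kappa> A r"
    have "(?P ** \<phi> p r) *v tb k w = g p r *s (?P *v tb k w)"
      unfolding matrix_vector_mul_assoc[of ?P, symmetric] g[OF x[unfolded x_eq]] by (rule vec.scale)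
    thus "coord i ((case x of (p, r) \<Rightarrow> pbw_e n \<kappa> B p ** pbw_f n \<kappa> A r ** \<phi> p r) *v tb k w)
        = (case x of (p, r) \<Rightarrow> (g p r * (pbw_f n \<kappa> matrix_rep r *v unit_vec k) $ pos i) *s (pbw_e n \<kappa> V p *v w))"
      unfolding x_eq prod.case by (simp only: coord_scale coord_pbw_tb[OF k i] vec.scale_scale)
  qed
  show "coord i (F *v tb k w) = 0" if i: "i \<in> {1..n}" "i < k" for i
    unfolding exp[OF i(1)]
    by (rule sum.neutral) (use pr pbw_matrix_element(2)[OF _ i(1) k] i(2) in fastforce)
  have "coord k (F *v tb k w) = (\<Sum>x\<in>S. if x = (\<lambda>_. 0, \<lambda>_. 0) then w else 0)"
    unfolding exp[OF k]
  proof (rule sum.cong[OF refl])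
    fix x assume x: "x \<in> S"
    obtain p r where x_eq: "x = (p, r)" by fastforce
    note pr' = pr[OF x[unfolded x_eq]]
    show "(case x of (p, r) \<Rightarrow> (g p r * (pbw_f n \<kappa> matrix_rep r *v unit_vec k) $ pos k) *s (pbw_e n \<kappa> V p *v w))
        = (if x = (\<lambda>_. 0, \<lambda>_. 0) then w else 0)"
    proof (cases "r = (\<lambda>_. 0)")
      case True
      have p0: "p = (\<lambda>_. 0)"
        using pr' pbw_weight_eq_zero_iff[of p n] pbw_weight_eq_zero_iff[of r n] True by auto
      have "g p r *s tb k w = tb k w"
        using g[OF x[unfolded x_eq]] by (simp add: p0 True \<phi>0)
      hence "g p r *s w = w" using coord_tb[OF k k] by (metis coord_scale)
      moreover have "unit_vec k $ pos k = 1" by (simp add: unit_vec_def)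
      ultimately show ?thesis by (simp add: x_eq p0 True pbw_zero)
    next
      case False
      hence "(pbw_f n \<kappa> matrix_rep r *v unit_vec k) $ pos k = 0"
        using pbw_matrix_element(2)[OF _ k k] pr' by blast
      thus ?thesis using False by (simp add: x_eq)
    qed
  qed
  thus "coord k (F *v tb k w) = w" using S by simp
qed

text \<open>Here the PBW element in the first factor is read off the matrix element, and its weight gives the
  weight of the one acting on \<open>V\<close>.\<close>

lemma shift_form_upper:
  assumes F: "shift_form n \<kappa> A B F" and k: "k \<in> {1..n}" and V: "graded_action n V"
    and w: "weight_vector n V \<nu> w"
  shows "\<And>i. i \<in> {1..n} \<Longrightarrow> k < i \<Longrightarrow> coord i (F *v tb k w) = 0"
    and "coord k (F *v tb k w) = w"
    and "\<And>i. i \<in> {1..n} \<Longrightarrow> weight_vector n V (shifted k i \<nu>) (coord i (F *v tb k w))"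
proof -
  obtain S \<phi> where S: "finite S" "(\<lambda>_. 0, \<lambda>_. 0) \<in> S"
    and pr: "\<And>p r. (p, r) \<in> S \<Longrightarrow> p \<in> pbw_exponents n \<and> r \<in> pbw_exponents n
            \<and> (\<forall>k\<in>{1..<n}. pbw_weight n p k = pbw_weight n r k) \<and> cartan_function n B (\<phi> p r)"
    and \<phi>0: "\<phi> (\<lambda>_. 0) (\<lambda>_. 0) = mat 1"
    and F_eq: "F = (\<Sum>(p, r)\<in>S. pbw_e n \<kappa> A p ** pbw_f n \<kappa> B r ** \<phi> p r)"
    by (fact shift_formE[OF F])
  have "\<exists>g. \<phi> p r *v tb k w = g *s tb k w" if "(p, r) \<in> S" for p r
    using pr[OF that] tb_weight_vector_B[OF w, of k] unfolding cartan_function_def weight_vector_def by blast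
  then obtain g where g: "\<And>p r. (p, r) \<in> S \<Longrightarrow> \<phi> p r *v tb k w = g p r *s tb k w" by metis
  have exp: "coord i (F *v tb k w) = (\<Sum>(p, r)\<in>S.
      (g p r * (pbw_e n \<kappa> matrix_rep p *v unit_vec k) $ pos i) *s (pbw_f n \<kappa> V r *v w))"
    if i: "i \<in> {1..n}" for i
    unfolding F_eq sum_mult_vec coord_sum
  proof (rule sum.cong[OF refl])
    fix x assume x: "x \<in> S"
    obtain p r where x_eq: "x = (p, r)" by fastforce
    let ?P = "pbw_e n \<kappa> A p ** pbw_f n \<kappa> B r"
    have "(?P ** \<phi> p r) *v tb k w = g p r *s (?P *v tb k w)"
      unfolding matrix_vector_mul_assoc[of ?P, symmetric] g[OF x[unfolded x_eq]] by (rule vec.scale)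
    thus "coord i ((case x of (p, r) \<Rightarrow> pbw_e n \<kappa> A p ** pbw_f n \<kappa> B r ** \<phi> p r) *v tb k w)
        = (case x of (p, r) \<Rightarrow> (g p r * (pbw_e n \<kappa> matrix_rep p *v unit_vec k) $ pos i) *s (pbw_f n \<kappa> V r *v w))"
      unfolding x_eq prod.case by (simp only: coord_scale coord_pbw_tb[OF k i] vec.scale_scale)
  qed
  show "coord i (F *v tb k w) = 0" if i: "i \<in> {1..n}" "k < i" for i
    unfolding exp[OF i(1)]
    by (rule sum.neutral) (use pr pbw_matrix_element(1)[OF _ i(1) k] i(2) in fastforce)
  have "coord k (F *v tb k w) = (\<Sum>x\<in>S. if x = (\<lambda>_. 0, \<lambda>_. 0) then w else 0)"
    unfolding exp[OF k]
  proof (rule sum.cong[OF refl])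
    fix x assume x: "x \<in> S"
    obtain p r where x_eq: "x = (p, r)" by fastforce
    note pr' = pr[OF x[unfolded x_eq]]
    show "(case x of (p, r) \<Rightarrow> (g p r * (pbw_e n \<kappa> matrix_rep p *v unit_vec k) $ pos k) *s (pbw_f n \<kappa> V r *v w))
        = (if x = (\<lambda>_. 0, \<lambda>_. 0) then w else 0)"
    proof (cases "p = (\<lambda>_. 0)")
      case True
      have r0: "r = (\<lambda>_. 0)"
        using pr' pbw_weight_eq_zero_iff[of p n] pbw_weight_eq_zero_iff[of r n] True by auto
      have "g p r *s tb k w = tb k w"
        using g[OF x[unfolded x_eq]] by (simp add: r0 True \<phi>0)
      hence "g p r *s w = w" using coord_tb[OF k k] by (metis coord_scale)
      moreover have "unit_vec k $ pos k = 1" by (simp add: unit_vec_def)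
      ultimately show ?thesis by (simp add: x_eq r0 True pbw_zero)
    next
      case False
      hence "(pbw_e n \<kappa> matrix_rep p *v unit_vec k) $ pos k = 0"
        using pbw_matrix_element(1)[OF _ k k] pr' by blast
      thus ?thesis using False by (simp add: x_eq)
    qed
  qed
  thus "coord k (F *v tb k w) = w" using S by simp
  show "weight_vector n V (shifted k i \<nu>) (coord i (F *v tb k w))" if i: "i \<in> {1..n}" for i
    unfolding exp[OF i] weight_vector_def
  proof (rule vec.subspace_sum[OF subspace_weight_space])
    fix x assume x: "x \<in> S"
    obtain p r where x_eq: "x = (p, r)" by fastforce
    note pr' = pr[OF x[unfolded x_eq]]
    show "(case x of (p, r) \<Rightarrow> (g p r * (pbw_e n \<kappa> matrix_rep p *v unit_vec k) $ pos i) *s (pbw_f n \<kappa> V r *v w))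
        \<in> weight_space n V (\<lambda>s. shifted k i \<nu> s - shifted k i \<nu> (s + 1))"
    proof (cases "(pbw_e n \<kappa> matrix_rep p *v unit_vec k) $ pos i = 0")
      case True
      thus ?thesis by (simp add: x_eq vec.subspace_0[OF subspace_weight_space])
    next
      case False
      have *: "unit_weight i s - unit_weight i (s + 1)
            = unit_weight k s - unit_weight k (s + 1) + 1 * (\<Sum>t\<in>{1..<n}. of_nat (pbw_weight n p t) * cartan s t)"
        if "s \<in> {1..<n}" for s
        by (rule matrix_element_weight(1)[OF _ i k False that])
           (use shifts_weight_pbw(1)[OF graded_matrix_rep] in simp)
      have "pbw_f n \<kappa> V r *v w \<in> weight_space n V (\<lambda>s. \<nu> s - \<nu> (s + 1)
          + - (\<Sum>t\<in>{1..<n}. of_nat (pbw_weight n r t) * cartan s t))"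
        by (rule shifts_weight_pbw(2)[OF V, unfolded shifts_weight_def, rule_format, OF w[unfolded weight_vector_def]])
      also have "weight_space n V (\<lambda>s. \<nu> s - \<nu> (s + 1)
          + - (\<Sum>t\<in>{1..<n}. of_nat (pbw_weight n r t) * cartan s t))
          = weight_space n V (\<lambda>s. shifted k i \<nu> s - shifted k i \<nu> (s + 1))"
      proof (rule weight_space_cong)
        fix s assume s: "s \<in> {1..<n}"
        have "(\<Sum>t\<in>{1..<n}. of_nat (pbw_weight n r t) * cartan s t)
            = (\<Sum>t\<in>{1..<n}. of_nat (pbw_weight n p t) * cartan s t)"
          by (rule sum.cong[OF refl]) (use pr' in simp)
        also have "\<dots> = unit_weight i s - unit_weight i (s + 1) - (unit_weight k s - unit_weight k (s + 1))"
          using *[OF s] by simp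
        finally show "\<nu> s - \<nu> (s + 1) + - (\<Sum>t\<in>{1..<n}. of_nat (pbw_weight n r t) * cartan s t)
            = shifted k i \<nu> s - shifted k i \<nu> (s + 1)"
          by (simp add: shifted_def)
      qed
      finally show ?thesis
        by (simp add: x_eq vec.subspace_scale[OF subspace_weight_space])
    qed
  qed
qed

end


section \<open>The shift with raising operators in the vector representation\<close>

lemma composition_le: "composition n N m \<Longrightarrow> i \<in> {1..n} \<Longrightarrow> m i \<le> N"
  unfolding composition_def by (metis finite_atLeastAtMost member_le_sum zero_le)

locale monomial_tensor = vector_tensor \<kappa> n V ty
  for \<kappa> n and V :: "'d::finite action" and ty :: "'n::{finite,linorder} itself" +
  fixes N :: nat and u :: "(nat \<Rightarrow> nat) \<Rightarrow> complex^'d"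
  assumes act: "monomial_action \<kappa> n N V u" and graded: "graded_action n V"
begin

text \<open>The exponent of a monomial as a weight.\<close>

definition mw :: "(nat \<Rightarrow> nat) \<Rightarrow> nat \<Rightarrow> complex" where "mw m s = of_nat (m s)"

definition e_coeff :: "nat \<Rightarrow> nat \<Rightarrow> (nat \<Rightarrow> nat) \<Rightarrow> complex"
  where "e_coeff i j m = qpow \<kappa> (- (\<Sum>s\<in>{i<..<j}. of_nat (m s))) * qnum \<kappa> (of_nat (m j))"

definition f_coeff :: "nat \<Rightarrow> nat \<Rightarrow> (nat \<Rightarrow> nat) \<Rightarrow> complex"
  where "f_coeff i j m = qpow \<kappa> (\<Sum>s\<in>{i<..<j}. of_nat (m s)) * qnum \<kappa> (of_nat (m i))"

lemma root_e_u: "1 \<le> i \<Longrightarrow> i < j \<Longrightarrow> j \<le> n \<Longrightarrow> root_e \<kappa> V i j *v u m = e_coeff i j m *s u (move_unit i j m)"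
  and root_f_u: "1 \<le> i \<Longrightarrow> i < j \<Longrightarrow> j \<le> n \<Longrightarrow> root_f \<kappa> V i j *v u m = f_coeff i j m *s u (move_unit j i m)"
  using root_vectors_on_monomials[OF act q_diff_nonzero] unfolding e_coeff_def f_coeff_def by blast+

lemma u_zero: "\<not> composition n N m \<Longrightarrow> u m = 0"
  using act unfolding monomial_action_def by blast

lemma u_span: "vec.span (range u) = UNIV"
  using act unfolding monomial_action_def by blast

lemma u_weight: "weight_vector n V (mw m) (u m)"
  using act unfolding monomial_action_def weight_vector_def weight_space_def mw_def by blast

lemma shifted_same: "shifted k k \<nu> = \<nu>"
  by (simp add: shifted_def fun_eq_iff)

lemma u_moved_weight:
  assumes m: "composition n N m" and ik: "i \<in> {1..n}" "k \<in> {1..n}" "i \<noteq> k"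
  shows "weight_vector n V (shifted k i (mw m)) (u (move_unit k i m))"
proof (cases "m i = 0")
  case True
  have "move_unit k i m = m(k := m k + 1)" using True ik by (auto simp: move_unit_def fun_eq_iff)
  moreover have "sum (m(k := m k + 1)) {1..n} = N + 1"
  proof -
    have "sum (m(k := m k + 1)) {1..n} = (m(k := m k + 1)) k + sum (m(k := m k + 1)) ({1..n} - {k})"
      by (rule sum.remove) (use ik in auto)
    moreover have "sum (m(k := m k + 1)) ({1..n} - {k}) = sum m ({1..n} - {k})"
      by (rule sum.cong) auto
    moreover have "sum m {1..n} = m k + sum m ({1..n} - {k})"
      by (rule sum.remove) (use ik in auto)
    moreover have "sum m {1..n} = N" using m by (simp add: composition_def)
    ultimately show ?thesis by (simp only: fun_upd_same)
  qed
  ultimately have "u (move_unit k i m) = 0" by (intro u_zero) (simp add: composition_def)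
  thus ?thesis by (simp add: weight_vector_zero)
next
  case False
  then obtain d where d: "m i = Suc d" using not0_implies_Suc by blast
  have "mw (move_unit k i m) s = shifted k i (mw m) s" for s
    using ik d by (cases "s = k"; cases "s = i") (simp_all add: mw_def move_unit_def shifted_def unit_weight_def)
  hence "mw (move_unit k i m) = shifted k i (mw m)" by (rule ext)
  thus ?thesis using u_weight by metis
qed

text \<open>Points avoiding the hypersurfaces on which the shift equations degenerate.  The bound comes from
  the numbers $2m_k-2m_i+2$ with \<open>0 \<le> m\<^sub>i, m\<^sub>k \<le> N\<close>.\<close>

definition admissible :: "(nat \<Rightarrow> complex) \<Rightarrow> bool"
  where "admissible y \<longleftrightarrow> (\<forall>i\<in>{1..n}. \<forall>j\<in>{1..n}. \<forall>t::int. i \<noteq> j \<and> \<bar>t\<bar> \<le> 2 * int N + 2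
      \<longrightarrow> qpow \<kappa> (y i - y j + of_int t) \<noteq> 1)"

text \<open>The factor by which the twist on the monomial reached from $v_k\otimes u_m$ by $E_{ik}\otimes f_{ik}$
  differs from the twist on \<open>u\<^sub>m\<close>.\<close>

definition ratio :: "(nat \<Rightarrow> complex) \<Rightarrow> nat \<Rightarrow> nat \<Rightarrow> (nat \<Rightarrow> nat) \<Rightarrow> complex"
  where "ratio y i k m = qpow \<kappa> (2 * mw m k - 2 * mw m i + 2 + y k - y i)"

lemma ratio_neq_1:
  assumes y: "admissible y" and m: "composition n N m" and ik: "i \<in> {1..n}" "k \<in> {1..n}" "i \<noteq> k"
  shows "ratio y i k m \<noteq> 1"
proof -
  let ?t = "2 * int (m k) - 2 * int (m i) + 2"
  have "m i \<le> N" "m k \<le> N" using composition_le[OF m] ik by auto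
  hence "\<bar>?t\<bar> \<le> 2 * int N + 2" by linarith
  hence "qpow \<kappa> (y k - y i + of_int ?t) \<noteq> 1"
    using y ik unfolding admissible_def by (metis (no_types, lifting))
  moreover have "y k - y i + of_int ?t = 2 * mw m k - 2 * mw m i + 2 + y k - y i"
    by (simp add: mw_def)
  ultimately show ?thesis unfolding ratio_def by metis
qed

text \<open>The solution acts on $v_k\otimes u_m$ by coefficients satisfying a triangular recursion.  All
  of them carry the factor $[m_i]$ of $f_{ik}$, so that on \<open>V\<close>, whose weight spaces are at
  most one-dimensional, the PBW elements $e_{ik}\otimes f_{ik}$ suffice.\<close>

function up_coeff :: "(nat \<Rightarrow> complex) \<Rightarrow> nat \<Rightarrow> nat \<Rightarrow> (nat \<Rightarrow> nat) \<Rightarrow> complex" where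
  "up_coeff y i k m = c / (ratio y i k m - 1)
     * (f_coeff i k m + (\<Sum>j\<in>{i<..<k}. f_coeff i j m * up_coeff y j k m))"
  by pat_completeness auto
termination by (relation "Wellfounded.measure (\<lambda>(y, i, k, m). k - i)") auto

declare up_coeff.simps [simp del]

lemma up_coeff_zero: "m i = 0 \<Longrightarrow> up_coeff y i k m = 0"
  by (subst up_coeff.simps) (simp add: f_coeff_def)

lemma f_coeff_nonzero: "m i > 0 \<Longrightarrow> f_coeff i k m \<noteq> 0"
  using qnum_of_nat_nonzero[of "m i"] by (simp add: f_coeff_def)

lemma eigen_spanning_B:
  "eigen_spanning {1..<n} (gen_h B) {tb k w | k w. k \<in> {1..n} \<and> w \<in> range u}"
proof -
  have "\<exists>\<mu>. x \<in> joint_eigenspace {1..<n} (gen_h B) \<mu>"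
    if x: "x \<in> {tb k w | k w. k \<in> {1..n} \<and> w \<in> range u}" for x
  proof -
    obtain k m where x: "x = tb k (u m)" using x by blast
    show ?thesis
      using tb_weight_vector_B[OF u_weight[of m], of k] unfolding x weight_vector_def weight_space_eq by blast
  qed
  thus ?thesis using span_tb[OF u_span] unfolding eigen_spanning_def by blast
qed

lemma matrix_eq_on_tb_u:
  assumes "\<And>k m. k \<in> {1..n} \<Longrightarrow> composition n N m \<Longrightarrow> X *v tb k (u m) = Y *v tb k (u m)"
  shows "X = (Y :: complex^('n \<times> 'd)^('n \<times> 'd))"
proof (rule matrix_eq_on_spanning[OF span_tb[OF u_span]])
  fix x assume "x \<in> {tb k w | k w. k \<in> {1..n} \<and> w \<in> range u}"
  then obtain k m where x: "x = tb k (u m)" "k \<in> {1..n}" by blast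
  show "X *v x = Y *v x"
    using assms[OF x(2), of m] u_zero[of m] by (cases "composition n N m") (simp_all add: x)
qed

lemma composition_determined:
  assumes "composition n N m" "composition n N m'"
    and "\<And>i. i \<in> {1..<n} \<Longrightarrow> mw m i - mw m (i + 1) = mw m' i - mw m' (i + 1)"
  shows "m = m'"
proof
  fix k
  show "m k = m' k"
  proof (cases "k \<in> {1..n}")
    case True
    have "sum (mw m) {1..n} = sum (mw m') {1..n}"
      using assms(1,2) unfolding mw_def composition_def by (simp flip: of_nat_sum)
    hence "mw m k = mw m' k" using determined_by_differences[of n "mw m" "mw m'" k] assms(3) True by blast
    thus ?thesis unfolding mw_def by (simp only: of_nat_eq_iff)
  qed (use assms(1,2) in \<open>simp add: composition_def\<close>)
qed

text \<open>Distinct monomials have distinct weights, so every function of the exponent is a function of the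
  Cartan generators.\<close>

lemma cartan_function_on_monomials:
  "\<exists>\<Phi>. cartan_function n B \<Phi> \<and> (\<forall>k\<in>{1..n}. \<forall>m. \<Phi> *v tb k (u m) = \<phi> m *s tb k (u m))"
proof -
  define P where "P \<mu> m \<longleftrightarrow> composition n N m \<and> (\<forall>i\<in>{1..<n}. \<mu> i = mw m i - mw m (i + 1))" for \<mu> m
  define g where "g \<mu> = \<phi> (SOME m. P \<mu> m)" for \<mu>
  have g_cong: "g \<mu> = g \<nu>" if "\<And>i. i \<in> {1..<n} \<Longrightarrow> \<mu> i = \<nu> i" for \<mu> \<nu>
  proof -
    have "P \<mu> = P \<nu>" using that unfolding P_def by (simp add: fun_eq_iff)
    thus ?thesis unfolding g_def by simp
  qed
  obtain \<Phi> where \<Phi>: "\<And>\<mu> x. x \<in> joint_eigenspace {1..<n} (gen_h B) \<mu> \<Longrightarrow> \<Phi> *v x = g \<mu> *s x"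
    using diagonal_operator_exists[OF eigen_spanning_B, of g] g_cong by metis
  have "\<Phi> *v tb k (u m) = \<phi> m *s tb k (u m)" if k: "k \<in> {1..n}" for k m
  proof (cases "composition n N m")
    case True
    have "P (\<lambda>i. mw m i - mw m (i + 1)) m" using True by (simp add: P_def)
    moreover have "m' = m" if "P (\<lambda>i. mw m i - mw m (i + 1)) m'" for m'
      using that True unfolding P_def by (intro composition_determined) auto
    ultimately have "(SOME m'. P (\<lambda>i. mw m i - mw m (i + 1)) m') = m" by (rule some_equality)
    hence "g (\<lambda>i. mw m i - mw m (i + 1)) = \<phi> m" by (simp add: g_def)
    moreover have "tb k (u m) \<in> joint_eigenspace {1..<n} (gen_h B) (\<lambda>i. mw m i - mw m (i + 1))"
      using tb_weight_vector_B[OF u_weight[of m], of k] unfolding weight_vector_def weight_space_eq .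
    ultimately show ?thesis using \<Phi> by metis
  qed (simp add: u_zero)
  moreover have "cartan_function n B \<Phi>"
    unfolding cartan_function_def weight_space_eq using \<Phi> by blast
  ultimately show ?thesis by blast
qed

text \<open>The quotient is the coefficient still missing after the action of \<open>f\<^sub>i\<^sub>j\<close>.  For \<open>m\<^sub>i = 0\<close> it is
  \<open>0 / 0 = 0\<close>, as it should be, both coefficients being zero.\<close>

definition up_cartan :: "(nat \<Rightarrow> complex) \<Rightarrow> nat \<times> nat \<Rightarrow> complex^('n \<times> 'd)^('n \<times> 'd)"
  where "up_cartan y r = (SOME \<Phi>. cartan_function n B \<Phi> \<and> (\<forall>k\<in>{1..n}. \<forall>m. \<Phi> *v tb k (u m)
      = (up_coeff y (fst r) (snd r) m / f_coeff (fst r) (snd r) m) *s tb k (u m)))"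

lemma up_cartan:
  "cartan_function n B (up_cartan y r)"
  "k \<in> {1..n} \<Longrightarrow> up_cartan y r *v tb k (u m)
      = (up_coeff y (fst r) (snd r) m / f_coeff (fst r) (snd r) m) *s tb k (u m)"
  using someI_ex[OF cartan_function_on_monomials[of "\<lambda>m. up_coeff y (fst r) (snd r) m / f_coeff (fst r) (snd r) m"]]
  unfolding up_cartan_def by blast+

definition F_up :: "(nat \<Rightarrow> complex) \<Rightarrow> complex^('n \<times> 'd)^('n \<times> 'd)"
  where "F_up y = mat 1 + (\<Sum>r\<in>set (pos_roots n).
     root_e \<kappa> A (fst r) (snd r) ** root_f \<kappa> B (fst r) (snd r) ** up_cartan y r)"

lemma F_up_tb:
  assumes k: "k \<in> {1..n}"
  shows "F_up y *v tb k (u m) = tb k (u m) + (\<Sum>i\<in>{1..<k}. tb i (up_coeff y i k m *s u (move_unit k i m)))"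
proof -
  have "F_up y *v tb k (u m) = tb k (u m) + (\<Sum>r\<in>set (pos_roots n).
      (root_e \<kappa> A (fst r) (snd r) ** root_f \<kappa> B (fst r) (snd r) ** up_cartan y r) *v tb k (u m))"
    unfolding F_up_def by (simp only: matrix_vector_mult_add_rdistrib matrix_vector_mul_lid sum_mult_vec)
  also have "(\<Sum>r\<in>set (pos_roots n).
      (root_e \<kappa> A (fst r) (snd r) ** root_f \<kappa> B (fst r) (snd r) ** up_cartan y r) *v tb k (u m))
      = (\<Sum>r\<in>set (pos_roots n). if snd r = k then tb (fst r) (up_coeff y (fst r) k m *s u (move_unit k (fst r) m)) else 0)"
  proof (rule sum.cong[OF refl])
    fix r assume "r \<in> set (pos_roots n)"
    then obtain i j where r: "r = (i, j)" "1 \<le> i" "i < j" "j \<le> n" by (auto simp: set_pos_roots)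
    have "(root_e \<kappa> A i j ** root_f \<kappa> B i j ** up_cartan y r) *v tb k (u m)
        = root_e \<kappa> A i j *v (root_f \<kappa> B i j *v (up_cartan y r *v tb k (u m)))"
      by (simp only: matrix_vector_mul_assoc matrix_mul_assoc)
    also have "\<dots> = (up_coeff y i j m / f_coeff i j m) *s (if j = k then tb i (f_coeff i j m *s u (move_unit j i m)) else 0)"
      unfolding up_cartan(2)[OF k] vec.scale root_vectors_tb(4)[OF r(2-4) k] root_vectors_tb(1)[OF r(2-4) k]
        root_f_u[OF r(2-4)] r(1) by simp
    also have "\<dots> = (if j = k then tb i (up_coeff y i j m *s u (move_unit j i m)) else 0)"
    proof -
      have "up_coeff y i j m / f_coeff i j m * f_coeff i j m = up_coeff y i j m"
        using up_coeff_zero[of m i y j] f_coeff_nonzero[of m i j] by (cases "m i = 0") auto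
      thus ?thesis
        by (cases "j = k") (simp_all only: tb_scale vec.scale_scale simp_thms if_True if_False vec.scale_zero_right)
    qed
    finally show "(root_e \<kappa> A (fst r) (snd r) ** root_f \<kappa> B (fst r) (snd r) ** up_cartan y r) *v tb k (u m)
        = (if snd r = k then tb (fst r) (up_coeff y (fst r) k m *s u (move_unit k (fst r) m)) else 0)"
      using r by auto
  qed
  also have "\<dots> = (\<Sum>i\<in>{1..<k}. tb i (up_coeff y i k m *s u (move_unit k i m)))"
    using k by (intro sum_roots_second) auto
  finally show ?thesis .
qed

lemma coord_F_up:
  assumes k: "k \<in> {1..n}" and i: "i \<in> {1..n}"
  shows "coord i (F_up y *v tb k (u m))
     = (if i = k then u m else if i < k then up_coeff y i k m *s u (move_unit k i m) else 0)"
proof -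
  have "coord i (\<Sum>j\<in>{1..<k}. tb j (up_coeff y j k m *s u (move_unit k j m)))
      = (\<Sum>j\<in>{1..<k}. if j = i then up_coeff y i k m *s u (move_unit k i m) else 0)"
    unfolding coord_sum
  proof (rule sum.cong[OF refl])
    fix j assume "j \<in> {1..<k}"
    hence j: "j \<in> {1..n}" using k by auto
    show "coord i (tb j (up_coeff y j k m *s u (move_unit k j m)))
        = (if j = i then up_coeff y i k m *s u (move_unit k i m) else 0)"
      unfolding coord_tb[OF i j] by simp
  qed
  also have "\<dots> = (if i < k then up_coeff y i k m *s u (move_unit k i m) else 0)" using i by simp
  finally show ?thesis unfolding F_up_tb[OF k] coord_add coord_tb[OF i k] by auto
qed

lemma twist_B_tb:
  "B_op n \<kappa> y B *v tb k (u m) = twist y (mw m) *s tb k (u m)"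
  using B_op_weight_vector[OF tb_weight_vector_B[OF u_weight]] unfolding twist_def by blast

lemma twist_B_invertible:
  "B_op n \<kappa> y B ** matrix_inv (B_op n \<kappa> y B) = mat 1" "matrix_inv (B_op n \<kappa> y B) ** B_op n \<kappa> y B = mat 1"
proof -
  let ?E = "{tb k w | k w. k \<in> {1..n} \<and> w \<in> range u}"
  have "\<forall>x\<in>?E. \<exists>\<beta>. B_op n \<kappa> y B *v x = \<beta> *s x \<and> \<beta> \<noteq> 0"
  proof
    fix x assume "x \<in> ?E"
    then obtain k m where x: "x = tb k (u m)" by blast
    show "\<exists>\<beta>. B_op n \<kappa> y B *v x = \<beta> *s x \<and> \<beta> \<noteq> 0"
      unfolding x using twist_B_tb twist_nonzero by blast
  qed
  then obtain \<beta> where "\<And>x. x \<in> ?E \<Longrightarrow> B_op n \<kappa> y B *v x = \<beta> x *s x \<and> \<beta> x \<noteq> 0"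
    by (metis (no_types, lifting))
  thus "B_op n \<kappa> y B ** matrix_inv (B_op n \<kappa> y B) = mat 1" "matrix_inv (B_op n \<kappa> y B) ** B_op n \<kappa> y B = mat 1"
    using invertible_on_eigenvectors[OF span_tb[OF u_span]] by blast+
qed

lemma up_recursion:
  assumes y: "admissible y" and m: "composition n N m" and ik: "i \<in> {1..n}" "k \<in> {1..n}" "i < k"
  shows "up_coeff y i k m + c * (f_coeff i k m + (\<Sum>j\<in>{i<..<k}. f_coeff i j m * up_coeff y j k m))
     = ratio y i k m * up_coeff y i k m"
proof -
  have nz: "ratio y i k m - 1 \<noteq> 0" using ratio_neq_1[OF y m ik(1,2)] ik(3) by simp
  have "(ratio y i k m - 1) * up_coeff y i k m
      = c * (f_coeff i k m + (\<Sum>j\<in>{i<..<k}. f_coeff i j m * up_coeff y j k m))"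
    using nz by (subst up_coeff.simps) simp
  hence "ratio y i k m * up_coeff y i k m - up_coeff y i k m
      = c * (f_coeff i k m + (\<Sum>j\<in>{i<..<k}. f_coeff i j m * up_coeff y j k m))"
    by (simp only: left_diff_distrib mult_1_left)
  thus ?thesis by (metis add.commute diff_add_cancel)
qed

text \<open>Moving a unit from \<open>j\<close> to \<open>k\<close> changes neither \<open>m\<^sub>i\<close> nor the exponents strictly between \<open>i\<close>
  and \<open>j\<close>.  For \<open>m\<^sub>j = 0\<close>, where no unit can be moved, the coefficient vanishes.\<close>

lemma f_on_moved:
  assumes "1 \<le> i" "i < j" "j < k" "k \<le> n"
  shows "root_f \<kappa> V i j *v (up_coeff y j k m *s u (move_unit k j m))
      = (f_coeff i j m * up_coeff y j k m) *s u (move_unit k i m)"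
proof (cases "m j = 0")
  case False
  have "f_coeff i j (move_unit k j m) = f_coeff i j m"
  proof -
    have "(\<Sum>s\<in>{i<..<j}. of_nat (move_unit k j m s)) = (\<Sum>s\<in>{i<..<j}. of_nat (m s) :: complex)"
      by (rule sum.cong[OF refl]) (use assms in \<open>auto simp: move_unit_def\<close>)
    moreover have "move_unit k j m i = m i" using assms by (simp add: move_unit_def)
    ultimately show ?thesis unfolding f_coeff_def by (simp only:)
  qed
  moreover have "move_unit j i (move_unit k j m) = move_unit k i m"
    using assms False by (intro move_unit_trans') auto
  moreover have "root_f \<kappa> V i j *v u (move_unit k j m)
      = f_coeff i j (move_unit k j m) *s u (move_unit j i (move_unit k j m))"
    using assms by (intro root_f_u) auto
  ultimately show ?thesis by (simp only: vec.scale vec.scale_scale mult.commute)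
qed (simp add: up_coeff_zero)

text \<open>On $v_k\otimes u_m$ the component along \<open>v\<^sub>i\<close> of the shift equation is the recursion for
  \<open>up_coeff\<close>, since the twist acts on that component by \<open>ratio\<close> times its value on \<open>u\<^sub>m\<close>.\<close>

lemma F_up_equation:
  assumes y: "admissible y"
  shows "R_hat n \<kappa> A B ** F_up y = B_op n \<kappa> y B ** F_up y ** matrix_inv (B_op n \<kappa> y B)"
  unfolding conjugation_eq_iff[OF twist_B_invertible]
proof (rule matrix_eq_on_tb_u)
  fix k m assume k: "k \<in> {1..n}" and m: "composition n N m"
  define x where "x = F_up y *v tb k (u m)"
  have x: "coord i x = (if i = k then u m else if i < k then up_coeff y i k m *s u (move_unit k i m) else 0)"
    if "i \<in> {1..n}" for i
    unfolding x_def by (rule coord_F_up[OF k that])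
  have wt: "weight_vector n V (shifted k i (mw m)) (coord i x)" if i: "i \<in> {1..n}" for i
    using u_weight[of m] u_moved_weight[OF m i k] unfolding x[OF i]
    by (auto simp: shifted_same intro: weight_vector_scale weight_vector_zero)
  have "twist y (mw m) *s (R_hat n \<kappa> A B *v x) = B_op n \<kappa> y B *v x"
  proof (rule eq_if_coords_eq)
    fix i assume i: "i \<in> {1..n}"
    have Rx: "coord i (R_hat n \<kappa> A B *v x) = coord i x + c *s (\<Sum>j\<in>{i<..n}. root_f \<kappa> V i j *v coord j x)"
      by (rule coord_R_hat_upper[OF i])
    have Bx: "coord i (B_op n \<kappa> y B *v x) = twist y (shifted k i (mw m)) *s coord i x"
      by (rule coord_twist_B[OF wt i])
    show "coord i (twist y (mw m) *s (R_hat n \<kappa> A B *v x)) = coord i (B_op n \<kappa> y B *v x)"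
    proof (cases "i < k")
      case True
      have "(\<Sum>j\<in>{i<..n}. root_f \<kappa> V i j *v coord j x) = (\<Sum>j\<in>insert k {i<..<k}. root_f \<kappa> V i j *v coord j x)"
        using k True by (intro sum.mono_neutral_right) (auto simp: x)
      also have "\<dots> = root_f \<kappa> V i k *v coord k x + (\<Sum>j\<in>{i<..<k}. root_f \<kappa> V i j *v coord j x)"
        by (rule sum.insert) auto
      also have "(\<Sum>j\<in>{i<..<k}. root_f \<kappa> V i j *v coord j x)
          = (\<Sum>j\<in>{i<..<k}. (f_coeff i j m * up_coeff y j k m) *s u (move_unit k i m))"
      proof (rule sum.cong[OF refl])
        fix j assume "j \<in> {i<..<k}"
        hence j: "i < j" "j < k" "j \<in> {1..n}" "j \<noteq> k" using i k by auto
        show "root_f \<kappa> V i j *v coord j x = (f_coeff i j m * up_coeff y j k m) *s u (move_unit k i m)"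
          using f_on_moved[of i j k y m] i j k by (simp add: x)
      qed
      also have "root_f \<kappa> V i k *v coord k x = f_coeff i k m *s u (move_unit k i m)"
        using root_f_u[of i k m] i k True by (simp add: x)
      finally have S: "(\<Sum>j\<in>{i<..n}. root_f \<kappa> V i j *v coord j x)
          = (f_coeff i k m + (\<Sum>j\<in>{i<..<k}. f_coeff i j m * up_coeff y j k m)) *s u (move_unit k i m)"
        by (simp only: vec.scale_sum_left vec.scale_left_distrib)
      have xi: "coord i x = up_coeff y i k m *s u (move_unit k i m)" using x[OF i] True by simp
      have tw: "twist y (shifted k i (mw m)) = ratio y i k m * twist y (mw m)"
        unfolding ratio_def using True by (intro twist_shifted i k) simp
      show ?thesis
        unfolding coord_scale Rx Bx S xi tw vec.scale_scale vec.scale_left_distrib[symmetric]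
          up_recursion[OF y m i k True] by (simp only: mult_ac)
    next
      case False
      have "(\<Sum>j\<in>{i<..n}. root_f \<kappa> V i j *v coord j x) = 0"
        using False i by (intro sum.neutral) (auto simp: x)
      thus ?thesis using False
        unfolding coord_scale Rx Bx by (cases "i = k") (simp_all add: shifted_same x[OF i])
    qed
  qed
  thus "(R_hat n \<kappa> A B ** F_up y ** B_op n \<kappa> y B) *v tb k (u m) = (B_op n \<kappa> y B ** F_up y) *v tb k (u m)"
    unfolding matrix_vector_mul_assoc[symmetric] twist_B_tb vec.scale x_def .
qed

text \<open>The pairs of PBW elements are $(e_{ij}, f_{ij})$ and the trivial one.\<close>

lemma shift_form_F_up: "shift_form n \<kappa> A B (F_up y)"
proof -
  define \<delta> :: "nat \<times> nat \<Rightarrow> nat \<times> nat \<Rightarrow> nat" where "\<delta> r = (\<lambda>_. 0)(r := 1)" for r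
  define \<phi> where "\<phi> p (r :: nat \<times> nat \<Rightarrow> nat) = (if p = (\<lambda>_. 0) then mat 1 else up_cartan y (SOME r. p = \<delta> r))" for p r
  let ?R = "set (pos_roots n)"
  let ?S = "insert (\<lambda>_. 0, \<lambda>_. 0) ((\<lambda>r. (\<delta> r, \<delta> r)) ` ?R)"
  have inj: "r = r'" if "\<delta> r = \<delta> r'" for r r'
    using fun_cong[OF that, of r] by (auto simp: \<delta>_def split: if_splits)
  have \<delta>0: "\<delta> r \<noteq> (\<lambda>_. 0)" for r
  proof
    assume "\<delta> r = (\<lambda>_. 0)" from fun_cong[OF this, of r] show False by (simp add: \<delta>_def)
  qed
  have \<phi>\<delta>: "\<phi> (\<delta> r) (\<delta> r) = up_cartan y r" for r
  proof -
    have "(SOME r'. \<delta> r = \<delta> r') = r" by (rule some_equality) (auto dest: inj)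
    thus ?thesis using \<delta>0 by (simp add: \<phi>_def)
  qed
  have "(\<Sum>(p, r)\<in>?S. pbw_e n \<kappa> A p ** pbw_f n \<kappa> B r ** \<phi> p r)
      = mat 1 + (\<Sum>(p, r)\<in>(\<lambda>r. (\<delta> r, \<delta> r)) ` ?R. pbw_e n \<kappa> A p ** pbw_f n \<kappa> B r ** \<phi> p r)"
    using \<delta>0 \<delta>0[symmetric] by (subst sum.insert) (auto simp: pbw_zero \<phi>_def)
  also have "(\<Sum>(p, r)\<in>(\<lambda>r. (\<delta> r, \<delta> r)) ` ?R. pbw_e n \<kappa> A p ** pbw_f n \<kappa> B r ** \<phi> p r)
      = (\<Sum>r\<in>?R. pbw_e n \<kappa> A (\<delta> r) ** pbw_f n \<kappa> B (\<delta> r) ** \<phi> (\<delta> r) (\<delta> r))"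
    by (subst sum.reindex) (auto simp: inj_on_def dest: inj)
  also have "\<dots> = (\<Sum>r\<in>?R. root_e \<kappa> A (fst r) (snd r) ** root_f \<kappa> B (fst r) (snd r) ** up_cartan y r)"
  proof (rule sum.cong[OF refl])
    fix r assume "r \<in> ?R"
    thus "pbw_e n \<kappa> A (\<delta> r) ** pbw_f n \<kappa> B (\<delta> r) ** \<phi> (\<delta> r) (\<delta> r)
        = root_e \<kappa> A (fst r) (snd r) ** root_f \<kappa> B (fst r) (snd r) ** up_cartan y r"
      using pbw_single(1)[of "fst r" "snd r" n \<kappa> A] pbw_single(2)[of "fst r" "snd r" n \<kappa> B]
      by (simp add: \<phi>\<delta>) (simp add: \<delta>_def)
  qed
  finally have F: "F_up y = (\<Sum>(p, r)\<in>?S. pbw_e n \<kappa> A p ** pbw_f n \<kappa> B r ** \<phi> p r)"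
    by (simp add: F_up_def)
  have "\<delta> r \<in> pbw_exponents n" if "r \<in> ?R" for r
    using that by (auto simp: pbw_exponents_def \<delta>_def)
  moreover have "(\<lambda>_. 0) \<in> pbw_exponents n" by (simp add: pbw_exponents_def)
  moreover have "cartan_function n B (mat 1)"
    unfolding cartan_function_def by (intro exI[of _ "\<lambda>_. 1"]) simp
  ultimately show ?thesis
    unfolding shift_form_def
    by (intro exI[of _ ?S] exI[of _ \<phi>] conjI F) (auto simp: \<phi>\<delta> up_cartan(1), auto simp: \<phi>_def)
qed

text \<open>The difference of two solutions, applied to $v_k\otimes u_m$, has no component along \<open>v\<^sub>i\<close> for
  \<open>i \<ge> k\<close>.  Its components vanish one after the other for decreasing \<open>i\<close>: once the later ones are
  zero, the equation multiplies the next one by $\mathit{ratio}-1\neq0$.\<close>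

lemma upper_shift_unique:
  assumes y: "admissible y"
    and F: "shift_form n \<kappa> A B F" "R_hat n \<kappa> A B ** F = B_op n \<kappa> y B ** F ** matrix_inv (B_op n \<kappa> y B)"
    and F': "shift_form n \<kappa> A B F'" "R_hat n \<kappa> A B ** F' = B_op n \<kappa> y B ** F' ** matrix_inv (B_op n \<kappa> y B)"
  shows "F = F'"
proof (rule matrix_eq_on_tb_u)
  fix k m assume k: "k \<in> {1..n}" and m: "composition n N m"
  define x where "x = F *v tb k (u m) - F' *v tb k (u m)"
  have eq: "twist y (mw m) *s (R_hat n \<kappa> A B *v x) = B_op n \<kappa> y B *v x"
  proof -
    have "twist y (mw m) *s (R_hat n \<kappa> A B *v (G *v tb k (u m))) = B_op n \<kappa> y B *v (G *v tb k (u m))"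
      if "R_hat n \<kappa> A B ** G = B_op n \<kappa> y B ** G ** matrix_inv (B_op n \<kappa> y B)" for G
    proof -
      have "(R_hat n \<kappa> A B ** G ** B_op n \<kappa> y B) *v tb k (u m) = (B_op n \<kappa> y B ** G) *v tb k (u m)"
        using that unfolding conjugation_eq_iff[OF twist_B_invertible] by (rule arg_cong)
      thus ?thesis unfolding matrix_vector_mul_assoc[symmetric] twist_B_tb vec.scale .
    qed
    from this[OF F(2)] this[OF F'(2)] show ?thesis
      unfolding x_def vec.diff vec.scale_right_diff_distrib by (simp only:)
  qed
  have high: "coord i x = 0" if "i \<in> {1..n}" "k \<le> i" for i
    unfolding x_def coord_diff
    using shift_form_upper(1,2)[OF F(1) k graded u_weight] shift_form_upper(1,2)[OF F'(1) k graded u_weight] that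
    by (cases "i = k") simp_all
  have wt: "weight_vector n V (shifted k i (mw m)) (coord i x)" if i: "i \<in> {1..n}" for i
    unfolding x_def coord_diff weight_vector_def
    by (rule vec.subspace_diff[OF subspace_weight_space])
      (use shift_form_upper(3)[OF F(1) k graded u_weight i] shift_form_upper(3)[OF F'(1) k graded u_weight i]
        in \<open>simp_all add: weight_vector_def\<close>)
  have "i \<in> {1..n} \<Longrightarrow> coord i x = 0" for i
  proof (induction "n - i" arbitrary: i rule: less_induct)
    case less
    show ?case
    proof (cases "k \<le> i")
      case False
      have "(\<Sum>j\<in>{i<..n}. root_f \<kappa> V i j *v coord j x) = 0"
        using less by (intro sum.neutral) auto
      hence "coord i (R_hat n \<kappa> A B *v x) = coord i x"
        using coord_R_hat_upper[OF less.prems] by simp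
      moreover have "coord i (B_op n \<kappa> y B *v x) = (ratio y i k m * twist y (mw m)) *s coord i x"
      proof -
        have "coord i (B_op n \<kappa> y B *v x) = twist y (shifted k i (mw m)) *s coord i x"
          by (rule coord_twist_B[OF wt less.prems])
        thus ?thesis using False twist_shifted[OF less.prems k, of y "mw m"] by (simp add: ratio_def)
      qed
      ultimately have "(twist y (mw m) * (ratio y i k m - 1)) *s coord i x = 0"
        using arg_cong[OF eq, of "coord i"] unfolding coord_scale
        by (simp add: right_diff_distrib mult.commute)
      moreover have "twist y (mw m) * (ratio y i k m - 1) \<noteq> 0"
        using twist_nonzero ratio_neq_1[OF y m less.prems k] False by auto
      ultimately show ?thesis by (simp only: vec.scale_eq_0_iff simp_thms)
    qed (use high less.prems in blast)
  qed
  hence "x = 0" by (intro eq_if_coords_eq) simp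
  thus "F *v tb k (u m) = F' *v tb k (u m)" by (simp add: x_def)
qed

lemma F_shift_upper:
  assumes "admissible y"
  shows "F_shift n \<kappa> y A B = F_up y"
  unfolding F_shift_def
proof (rule the_equality)
  show "shift_form n \<kappa> A B (F_up y) \<and> R_hat n \<kappa> A B ** F_up y = B_op n \<kappa> y B ** F_up y ** matrix_inv (B_op n \<kappa> y B)"
    using shift_form_F_up F_up_equation[OF assms] by blast
qed (use upper_shift_unique[OF assms] shift_form_F_up F_up_equation[OF assms] in blast)

end


section \<open>The shift with lowering operators in the vector representation\<close>

context vector_tensor
begin

text \<open>The conditions on \<open>y\<close> under which the shift equation determines \<open>F\<^sub>2\<^sub>1\<close>.\<close>

definition separated :: "(nat \<Rightarrow> complex) \<Rightarrow> bool"
  where "separated y \<longleftrightarrow> (\<forall>i\<in>{1..n}. \<forall>j\<in>{1..n}. i \<noteq> j \<longrightarrow> qpow \<kappa> (y i) \<noteq> qpow \<kappa> (y j))"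

lemma twist_unit_weight_eq_iff:
  assumes "i \<in> {1..n}" "k \<in> {1..n}"
  shows "twist y (unit_weight i) = twist y (unit_weight k) \<longleftrightarrow> qpow \<kappa> (y i) = qpow \<kappa> (y k)"
  unfolding twist_unit_weight[OF assms, of y] qpow_diff using twist_nonzero[of y "unit_weight i"]
  by (auto simp: field_simps)

lemma twist_unit_weight_scaled:
  assumes "k \<in> {1..n}"
  obtains z where "z \<noteq> 0" "\<And>i. i \<in> {1..n} \<Longrightarrow> twist y (unit_weight i) = z * qpow \<kappa> (y i)"
proof
  show "twist y (unit_weight k) / qpow \<kappa> (y k) \<noteq> 0" using twist_nonzero by simp
  fix i assume i: "i \<in> {1..n}"
  show "twist y (unit_weight i) = twist y (unit_weight k) / qpow \<kappa> (y k) * qpow \<kappa> (y i)"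
    unfolding twist_unit_weight[OF assms i, of y] qpow_diff by simp
qed

text \<open>$F_{21}=1+\sum_{i<j}E_{ji}\otimes Y_{ij}$ and $F_{21}^{-1}=1+\sum_{i<j}E_{ji}\otimes W_{ij}$.  As the
  twist acts on \<open>v\<^sub>i\<close> by a multiple of $q^{y_i}$, the shift equations
  $F_{21}B=\hat R_{21}^{-1}BF_{21}$ and $F_{21}^{-1}\hat R_{21}^{-1}B=BF_{21}^{-1}$ become
  $(q^{y_j}-q^{y_i})Y_{ij}=(q-q^{-1})\sum_{i\le k<j}q^{y_k}e_{kj}Y_{ik}$ and
  $(q^{y_i}-q^{y_j})W_{ij}=(q-q^{-1})\sum_{i<k\le j}q^{y_i}W_{kj}e_{ik}$, with $Y_{ii}=W_{ii}=1$.\<close>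

function down_coeff :: "(nat \<Rightarrow> complex) \<Rightarrow> nat \<Rightarrow> nat \<Rightarrow> complex^'d^'d" where
  "down_coeff y i j = (if j \<le> i then mat 1 else
     (\<Sum>k\<in>{i..<j}. (c * qpow \<kappa> (y k) / (qpow \<kappa> (y j) - qpow \<kappa> (y i))) *\<^sub>M (root_e \<kappa> V k j ** down_coeff y i k)))"
  by pat_completeness auto
termination by (relation "Wellfounded.measure (\<lambda>(y, i, j). j)") auto

function down_inverse_coeff :: "(nat \<Rightarrow> complex) \<Rightarrow> nat \<Rightarrow> nat \<Rightarrow> complex^'d^'d" where
  "down_inverse_coeff y i j = (if j \<le> i then mat 1 else
     (\<Sum>k\<in>{i<..j}. (c * qpow \<kappa> (y i) / (qpow \<kappa> (y i) - qpow \<kappa> (y j))) *\<^sub>M (down_inverse_coeff y k j ** root_e \<kappa> V i k)))"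
  by pat_completeness auto
termination by (relation "Wellfounded.measure (\<lambda>(y, i, j). j - i)") auto

declare down_coeff.simps [simp del] down_inverse_coeff.simps [simp del]

lemma down_coeff_same: "down_coeff y i i = mat 1"
  by (subst down_coeff.simps) simp

lemma down_inverse_coeff_same: "down_inverse_coeff y i i = mat 1"
  by (subst down_inverse_coeff.simps) simp

lemma down_recursion:
  assumes "separated y" "i \<in> {1..n}" "j \<in> {1..n}" "i < j"
  shows "(qpow \<kappa> (y j) - qpow \<kappa> (y i)) *s (down_coeff y i j *v w)
     = c *s (\<Sum>k\<in>{i..<j}. qpow \<kappa> (y k) *s (root_e \<kappa> V k j *v (down_coeff y i k *v w)))"
proof -
  have nz: "qpow \<kappa> (y j) - qpow \<kappa> (y i) \<noteq> 0" using assms unfolding separated_def by auto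
  have "down_coeff y i j *v w = (\<Sum>k\<in>{i..<j}. (c * qpow \<kappa> (y k) / (qpow \<kappa> (y j) - qpow \<kappa> (y i)))
      *s (root_e \<kappa> V k j *v (down_coeff y i k *v w)))"
    using assms(4) by (subst down_coeff.simps)
      (simp add: sum_mult_vec mscale_mult_vec flip: matrix_vector_mul_assoc)
  thus ?thesis using nz by (simp add: vec.scale_sum_right)
qed

lemma down_inverse_recursion:
  assumes "separated y" "i \<in> {1..n}" "j \<in> {1..n}" "i < j"
  shows "(qpow \<kappa> (y i) - qpow \<kappa> (y j)) *s (down_inverse_coeff y i j *v w)
     = (c * qpow \<kappa> (y i)) *s (\<Sum>k\<in>{i<..j}. down_inverse_coeff y k j *v (root_e \<kappa> V i k *v w))"
proof -
  have "qpow \<kappa> (y i) \<noteq> qpow \<kappa> (y j)" using assms unfolding separated_def by auto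
  hence nz: "qpow \<kappa> (y i) - qpow \<kappa> (y j) \<noteq> 0" by simp
  have "down_inverse_coeff y i j *v w = (\<Sum>k\<in>{i<..j}. (c * qpow \<kappa> (y i) / (qpow \<kappa> (y i) - qpow \<kappa> (y j)))
      *s (down_inverse_coeff y k j *v (root_e \<kappa> V i k *v w)))"
    using assms(4) by (subst down_inverse_coeff.simps)
      (simp add: sum_mult_vec mscale_mult_vec flip: matrix_vector_mul_assoc)
  thus ?thesis using nz by (simp add: vec.scale_sum_right)
qed

definition F_down :: "(nat \<Rightarrow> complex) \<Rightarrow> complex^('n \<times> 'd)^('n \<times> 'd)"
  where "F_down y = lower_op (down_coeff y)"

definition F_down_inverse :: "(nat \<Rightarrow> complex) \<Rightarrow> complex^('n \<times> 'd)^('n \<times> 'd)"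
  where "F_down_inverse y = lower_op (down_inverse_coeff y)"

lemma coord_lower_op_tb:
  assumes i: "i \<in> {1..n}" and k: "k \<in> {1..n}"
  shows "coord i (lower_op Z *v tb k w) = (if i = k then w else if k < i then Z k i *v w else 0)"
proof -
  have "(\<Sum>j\<in>{1..<i}. Z j i *v coord j (tb k w)) = (\<Sum>j\<in>{1..<i}. if j = k then Z k i *v w else 0)"
    by (rule sum.cong[OF refl]) (use i k in \<open>auto simp: coord_tb\<close>)
  also have "\<dots> = (if k < i then Z k i *v w else 0)" using k by simp
  finally show ?thesis unfolding coord_lower_op[OF i] coord_tb[OF i k] by auto
qed

lemma coord_R_hat_lower_inv:
  assumes i: "i \<in> {1..n}"
  shows "coord i (R_hat_lower_inv *v x) = coord i x - c *s (\<Sum>j\<in>{1..<i}. root_e \<kappa> V j i *v coord j x)"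
  unfolding R_hat_lower_inv_eq coord_lower_op[OF i] mscale_mult_vec vec.scale_sum_right[symmetric]
  by (simp add: vec.scale_minus_left)

lemma lower_equation_iff:
  "R_hat n \<kappa> B A ** F = B_op n \<kappa> y A ** F ** matrix_inv (B_op n \<kappa> y A)
     \<longleftrightarrow> F ** B_op n \<kappa> y A = R_hat_lower_inv ** (B_op n \<kappa> y A ** F)"
proof -
  have "R_hat n \<kappa> B A ** F ** B_op n \<kappa> y A = B_op n \<kappa> y A ** F
     \<longleftrightarrow> F ** B_op n \<kappa> y A = R_hat_lower_inv ** (B_op n \<kappa> y A ** F)"
  proof
    assume "R_hat n \<kappa> B A ** F ** B_op n \<kappa> y A = B_op n \<kappa> y A ** F"
    from arg_cong[OF this, of "\<lambda>X. R_hat_lower_inv ** X"]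
    have "(R_hat_lower_inv ** R_hat n \<kappa> B A) ** (F ** B_op n \<kappa> y A) = R_hat_lower_inv ** (B_op n \<kappa> y A ** F)"
      by (simp only: matrix_mul_assoc)
    thus "F ** B_op n \<kappa> y A = R_hat_lower_inv ** (B_op n \<kappa> y A ** F)"
      unfolding R_hat_lower_inverse matrix_mul_lid .
  next
    assume "F ** B_op n \<kappa> y A = R_hat_lower_inv ** (B_op n \<kappa> y A ** F)"
    from arg_cong[OF this, of "\<lambda>X. R_hat n \<kappa> B A ** X"]
    have "R_hat n \<kappa> B A ** (F ** B_op n \<kappa> y A) = (R_hat n \<kappa> B A ** R_hat_lower_inv) ** (B_op n \<kappa> y A ** F)"
      by (simp only: matrix_mul_assoc)
    hence "R_hat n \<kappa> B A ** (F ** B_op n \<kappa> y A) = B_op n \<kappa> y A ** F"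
      unfolding R_hat_lower_inverse matrix_mul_lid .
    thus "R_hat n \<kappa> B A ** F ** B_op n \<kappa> y A = B_op n \<kappa> y A ** F" by (simp only: matrix_mul_assoc)
  qed
  thus ?thesis unfolding conjugation_eq_iff[OF twist_A_invertible] .
qed

lemma F_down_equation:
  assumes y: "separated y"
  shows "R_hat n \<kappa> B A ** F_down y = B_op n \<kappa> y A ** F_down y ** matrix_inv (B_op n \<kappa> y A)"
  unfolding lower_equation_iff
proof (rule matrix_eq_on_tb)
  fix k w assume k: "k \<in> {1..n}"
  obtain z where z: "\<And>i. i \<in> {1..n} \<Longrightarrow> twist y (unit_weight i) = z * qpow \<kappa> (y i)"
    using twist_unit_weight_scaled[OF k] by metis
  define x where "x = F_down y *v tb k w"
  have x: "coord i x = (if i = k then w else if k < i then down_coeff y k i *v w else 0)" if "i \<in> {1..n}" for i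
    unfolding x_def F_down_def by (rule coord_lower_op_tb[OF that k])
  have "twist y (unit_weight k) *s x = R_hat_lower_inv *v (B_op n \<kappa> y A *v x)"
  proof (rule eq_if_coords_eq)
    fix i assume i: "i \<in> {1..n}"
    have "(\<Sum>j\<in>{1..<i}. root_e \<kappa> V j i *v coord j (B_op n \<kappa> y A *v x))
        = (\<Sum>j\<in>{1..<i}. if k \<le> j then z *s (qpow \<kappa> (y j) *s (root_e \<kappa> V j i *v (down_coeff y k j *v w))) else 0)"
    proof (rule sum.cong[OF refl])
      fix j assume j: "j \<in> {1..<i}"
      hence j': "j \<in> {1..n}" using i by auto
      show "root_e \<kappa> V j i *v coord j (B_op n \<kappa> y A *v x)
        = (if k \<le> j then z *s (qpow \<kappa> (y j) *s (root_e \<kappa> V j i *v (down_coeff y k j *v w))) else 0)"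
        unfolding coord_twist_A[OF j'] z[OF j'] x[OF j'] vec.scale
        by (cases "j = k") (auto simp: down_coeff_same)
    qed
    also have "\<dots> = z *s (\<Sum>j\<in>{k..<i}. qpow \<kappa> (y j) *s (root_e \<kappa> V j i *v (down_coeff y k j *v w)))"
      unfolding vec.scale_sum_right using k i by (intro sum.mono_neutral_cong_right) auto
    finally have S: "coord i (R_hat_lower_inv *v (B_op n \<kappa> y A *v x)) = (z * qpow \<kappa> (y i)) *s coord i x
        - c *s (z *s (\<Sum>j\<in>{k..<i}. qpow \<kappa> (y j) *s (root_e \<kappa> V j i *v (down_coeff y k j *v w))))"
      unfolding coord_R_hat_lower_inv[OF i] coord_twist_A[OF i] z[OF i] by (simp only:)
    show "coord i (twist y (unit_weight k) *s x) = coord i (R_hat_lower_inv *v (B_op n \<kappa> y A *v x))"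
    proof (cases "k < i")
      case True
      have xi: "coord i x = down_coeff y k i *v w" using x[OF i] True by simp
      have "c *s (z *s (\<Sum>j\<in>{k..<i}. qpow \<kappa> (y j) *s (root_e \<kappa> V j i *v (down_coeff y k j *v w))))
          = z *s ((qpow \<kappa> (y i) - qpow \<kappa> (y k)) *s (down_coeff y k i *v w))"
        unfolding down_recursion[OF y k i True] by (rule vec.scale_left_commute)
      thus ?thesis unfolding S coord_scale z[OF k] xi
        by (simp add: vec_eq_iff algebra_simps)
    next
      case False
      thus ?thesis unfolding S coord_scale z[OF k] using x[OF i] by (cases "i = k") simp_all
    qed
  qed
  thus "(F_down y ** B_op n \<kappa> y A) *v tb k w = (R_hat_lower_inv ** (B_op n \<kappa> y A ** F_down y)) *v tb k w"
    unfolding matrix_vector_mul_assoc[symmetric] twist_A_tb[OF k] vec.scale x_def .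
qed

text \<open>As for the other shift, but with increasing \<open>i\<close>: if the next component along \<open>v\<^sub>i\<close> were nonzero,
  the eigenvalues of the twist on \<open>v\<^sub>i\<close> and \<open>v\<^sub>k\<close> would be equal.\<close>

lemma lower_shift_unique:
  assumes y: "separated y"
    and F: "shift_form n \<kappa> B A F" "R_hat n \<kappa> B A ** F = B_op n \<kappa> y A ** F ** matrix_inv (B_op n \<kappa> y A)"
    and F': "shift_form n \<kappa> B A F'" "R_hat n \<kappa> B A ** F' = B_op n \<kappa> y A ** F' ** matrix_inv (B_op n \<kappa> y A)"
  shows "F = F'"
proof (rule matrix_eq_on_tb)
  fix k w assume k: "k \<in> {1..n}"
  define x where "x = F *v tb k w - F' *v tb k w"
  have eq: "twist y (unit_weight k) *s x = R_hat_lower_inv *v (B_op n \<kappa> y A *v x)"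
  proof -
    have "twist y (unit_weight k) *s (G *v tb k w) = R_hat_lower_inv *v (B_op n \<kappa> y A *v (G *v tb k w))"
      if "R_hat n \<kappa> B A ** G = B_op n \<kappa> y A ** G ** matrix_inv (B_op n \<kappa> y A)" for G
    proof -
      have "(G ** B_op n \<kappa> y A) *v tb k w = (R_hat_lower_inv ** (B_op n \<kappa> y A ** G)) *v tb k w"
        using that unfolding lower_equation_iff by (rule arg_cong)
      thus ?thesis unfolding matrix_vector_mul_assoc[symmetric] twist_A_tb[OF k] vec.scale .
    qed
    from this[OF F(2)] this[OF F'(2)] show ?thesis
      unfolding x_def vec.diff vec.scale_right_diff_distrib by (simp only:)
  qed
  have low: "coord i x = 0" if "i \<in> {1..n}" "i \<le> k" for i
    unfolding x_def coord_diff
    using shift_form_lower[OF F(1) k] shift_form_lower[OF F'(1) k] that by (cases "i = k") simp_all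
  have "i \<in> {1..n} \<Longrightarrow> coord i x = 0" for i
  proof (induction i rule: less_induct)
    case (less i)
    show ?case
    proof (cases "i \<le> k")
      case False
      have "(\<Sum>j\<in>{1..<i}. root_e \<kappa> V j i *v coord j (B_op n \<kappa> y A *v x)) = 0"
        using less by (intro sum.neutral) (auto simp: coord_twist_A)
      hence "coord i (R_hat_lower_inv *v (B_op n \<kappa> y A *v x)) = twist y (unit_weight i) *s coord i x"
        unfolding coord_R_hat_lower_inv[OF less.prems] coord_twist_A[OF less.prems] by simp
      hence "(twist y (unit_weight k) - twist y (unit_weight i)) *s coord i x = 0"
        using arg_cong[OF eq, of "coord i"] unfolding coord_scale by simp
      moreover have "twist y (unit_weight k) - twist y (unit_weight i) \<noteq> 0"
        using twist_unit_weight_eq_iff[OF k less.prems] y False k less.prems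
        unfolding separated_def by auto
      ultimately show ?thesis by (simp only: vec.scale_eq_0_iff simp_thms)
    qed (use low less.prems in blast)
  qed
  hence "x = 0" by (intro eq_if_coords_eq) simp
  thus "F *v tb k w = F' *v tb k w" by (simp add: x_def)
qed

text \<open>The operators $Y_{ij}$ in $F_{21}$ are combinations of PBW elements: their recursion
  multiplies by $e_{kj}$ from the left, and the root \<open>(kj)\<close> is larger than the roots
  occurring so far.  This is recorded by the last condition on the exponents; the condition before it
  states the weight $\alpha_i+\dots+\alpha_{j-1}$.\<close>

definition interval_exponent :: "nat \<Rightarrow> nat \<Rightarrow> (nat \<times> nat \<Rightarrow> nat) \<Rightarrow> bool"
  where "interval_exponent i j p \<longleftrightarrow> p \<in> pbw_exponents n
    \<and> (\<forall>t\<in>{1..<n}. pbw_weight n p t = (if i \<le> t \<and> t < j then 1 else 0))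
    \<and> (\<forall>r. p r \<noteq> 0 \<longrightarrow> fst r < j)"

definition pbw_combination :: "nat \<Rightarrow> nat \<Rightarrow> complex^'d^'d \<Rightarrow> bool"
  where "pbw_combination i j Y \<longleftrightarrow> (\<exists>P a. finite P \<and> Y = (\<Sum>p\<in>P. a p *\<^sub>M pbw_e n \<kappa> V p)
    \<and> (\<forall>p\<in>P. interval_exponent i j p))"

lemma pbw_combinationI:
  "finite P \<Longrightarrow> (\<And>p. p \<in> P \<Longrightarrow> interval_exponent i j p) \<Longrightarrow>
    pbw_combination i j (\<Sum>p\<in>P. a p *\<^sub>M pbw_e n \<kappa> V p)"
  unfolding pbw_combination_def by blast

lemma mscale_add: "(s + t) *\<^sub>M X = s *\<^sub>M X + t *\<^sub>M X" for X :: "complex^'m^'m"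
  by (simp add: mscale_def vec_eq_iff distrib_right)

lemma mscale_sum: "s *\<^sub>M (\<Sum>p\<in>P. X p) = (\<Sum>p\<in>P. s *\<^sub>M X p)" for X :: "'x \<Rightarrow> complex^'m^'m"
  by (simp add: mscale_def vec_eq_iff sum_distrib_left)

lemma mult_sum_right: "X ** (\<Sum>p\<in>P. Y p) = (\<Sum>p\<in>P. X ** Y p)" for Y :: "'x \<Rightarrow> complex^'m^'m"
  by (induction P rule: infinite_finite_induct) (simp_all add: matrix_add_ldistrib)

lemma mult_sum_left: "(\<Sum>p\<in>P. Y p) ** X = (\<Sum>p\<in>P. Y p ** X)" for Y :: "'x \<Rightarrow> complex^'m^'m"
  by (induction P rule: infinite_finite_induct) (simp_all add: matrix_add_rdistrib)

lemma mscale_zero_left: "0 *\<^sub>M X = 0" for X :: "complex^'m^'m"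
  by (simp add: mscale_def vec_eq_iff)

lemma pbw_combination_add:
  assumes "pbw_combination i j Y" "pbw_combination i j Y'"
  shows "pbw_combination i j (Y + Y')"
proof -
  obtain P a where P: "finite P" "Y = (\<Sum>p\<in>P. a p *\<^sub>M pbw_e n \<kappa> V p)"
    and P': "\<forall>p\<in>P. interval_exponent i j p"
    using assms(1) unfolding pbw_combination_def by blast
  obtain Q b where Q: "finite Q" "Y' = (\<Sum>p\<in>Q. b p *\<^sub>M pbw_e n \<kappa> V p)"
    and Q': "\<forall>p\<in>Q. interval_exponent i j p"
    using assms(2) unfolding pbw_combination_def by blast
  have "Y = (\<Sum>p\<in>P \<union> Q. (if p \<in> P then a p else 0) *\<^sub>M pbw_e n \<kappa> V p)"
    unfolding P(2) using P(1) Q(1) by (intro sum.mono_neutral_cong_left) (auto simp: mscale_zero_left)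
  moreover have "Y' = (\<Sum>p\<in>P \<union> Q. (if p \<in> Q then b p else 0) *\<^sub>M pbw_e n \<kappa> V p)"
    unfolding Q(2) using P(1) Q(1) by (intro sum.mono_neutral_cong_left) (auto simp: mscale_zero_left)
  ultimately have sum_eq: "Y + Y' = (\<Sum>p\<in>P \<union> Q. ((if p \<in> P then a p else 0) + (if p \<in> Q then b p else 0)) *\<^sub>M pbw_e n \<kappa> V p)"
    by (simp only: mscale_add sum.distrib)
  show ?thesis unfolding sum_eq
  proof (rule pbw_combinationI)
    show "finite (P \<union> Q)" using P(1) Q(1) by simp
    fix p assume "p \<in> P \<union> Q"
    thus "interval_exponent i j p" using P' Q' by blast
  qed
qed

lemma pbw_combination_zero: "pbw_combination i j 0"
  using pbw_combinationI[of "{}" i j] by simp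

lemma pbw_combination_sum:
  "(\<And>k. k \<in> K \<Longrightarrow> pbw_combination i j (Y k)) \<Longrightarrow> pbw_combination i j (\<Sum>k\<in>K. Y k)"
  by (induction K rule: infinite_finite_induct) (auto intro: pbw_combination_zero pbw_combination_add)

lemma pbw_combination_one: "pbw_combination i i (mat 1)"
proof -
  have "pbw_combination i i (\<Sum>p\<in>{\<lambda>_. 0}. 1 *\<^sub>M pbw_e n \<kappa> V p)"
    by (rule pbw_combinationI) (auto simp: interval_exponent_def pbw_exponents_def pbw_weight_def)
  thus ?thesis by (simp add: pbw_zero mscale_def)
qed

lemma root_e_times_pbw:
  assumes kj: "(k, j) \<in> set (pos_roots n)" and p: "\<And>r. p r \<noteq> 0 \<Longrightarrow> fst r < k"
  shows "root_e \<kappa> V k j ** pbw_e n \<kappa> V p = pbw_e n \<kappa> V (p((k, j) := 1))"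
proof -
  let ?p = "p((k, j) := 1)"
  let ?X = "\<lambda>(a, b). mpow (root_e \<kappa> V a b) (?p (a, b))"
  have p0: "p (k, b) = 0" for b using p[of "(k, b)"] by auto
  have "pbw_e n \<kappa> V ?p = ?X (k, j) ** prod_gt n (?X((k, j) := mat 1))"
    unfolding pbw_e_def
  proof (rule prod_gt_split_largest[OF kj])
    fix s assume "s \<in> set (pos_roots n)" "root_less (k, j) s"
    hence s: "\<not> fst s < k" "s \<noteq> (k, j)" by (auto simp: root_less_def)
    hence "?p s = 0" using p[of s] by fastforce
    moreover obtain a b where "s = (a, b)" by fastforce
    ultimately show "?X s = mat 1" by (simp only: prod.case mpow.simps)
  qed
  also have "?X (k, j) = root_e \<kappa> V k j" by simp
  also have "prod_gt n (?X((k, j) := mat 1)) = pbw_e n \<kappa> V p"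
    unfolding pbw_e_def
  proof (rule prod_gt_cong)
    fix s assume "s \<in> set (pos_roots n)"
    show "(?X((k, j) := mat 1)) s = (case s of (i, j) \<Rightarrow> mpow (root_e \<kappa> V i j) (p (i, j)))"
    proof (cases "s = (k, j)")
      case True
      thus ?thesis using p0[of j] by simp
    next
      case False
      obtain a b where "s = (a, b)" by fastforce
      hence "?p (a, b) = p (a, b)" using False by (intro fun_upd_other) blast
      hence "?X s = (case s of (i, j) \<Rightarrow> mpow (root_e \<kappa> V i j) (p (i, j)))"
        unfolding \<open>s = (a, b)\<close> prod.case by (rule arg_cong)
      thus ?thesis unfolding fun_upd_other[OF False] .
    qed
  qed
  finally show ?thesis by (rule sym)
qed

lemma pbw_weight_alt:
  "pbw_weight n p t = (\<Sum>r\<in>{r \<in> set (pos_roots n). fst r \<le> t \<and> t < snd r}. p r)"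
proof -
  have "{(i, j). (i, j) \<in> set (pos_roots n) \<and> i \<le> t \<and> t < j} = {r \<in> set (pos_roots n). fst r \<le> t \<and> t < snd r}"
    by auto
  thus ?thesis unfolding pbw_weight_def by (intro sum.cong) (auto split: prod.split)
qed

lemma pbw_weight_upd:
  assumes kj: "(k, j) \<in> set (pos_roots n)" and p: "p (k, j) = 0"
  shows "pbw_weight n (p((k, j) := 1)) t = pbw_weight n p t + (if k \<le> t \<and> t < j then 1 else 0)"
proof -
  let ?R = "{r \<in> set (pos_roots n). fst r \<le> t \<and> t < snd r}"
  have "finite ?R" by (rule finite_subset[OF _ finite_set[of "pos_roots n"]]) blast
  hence delta: "(\<Sum>r\<in>?R. if r = (k, j) then 1 else 0) = (if (k, j) \<in> ?R then 1 else 0 :: nat)"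
    by (rule sum.delta)
  have upd: "(p((k, j) := 1)) r = p r + (if r = (k, j) then 1 else 0)" for r
    using p by simp
  show ?thesis
    unfolding pbw_weight_alt upd sum.distrib delta using kj by (simp only: mem_Collect_eq fst_conv snd_conv simp_thms)
qed

lemma pbw_combination_step:
  assumes Y: "pbw_combination i k Y" and ik: "1 \<le> i" "i \<le> k" "k < j" "j \<le> n"
  shows "pbw_combination i j (s *\<^sub>M (root_e \<kappa> V k j ** Y))"
proof -
  obtain P a where P: "finite P" "Y = (\<Sum>p\<in>P. a p *\<^sub>M pbw_e n \<kappa> V p)"
    and P': "\<forall>p\<in>P. interval_exponent i k p"
    using Y unfolding pbw_combination_def by blast
  have ex: "p \<in> pbw_exponents n" if "p \<in> P" for p
    using bspec[OF P' that] unfolding interval_exponent_def by (elim conjE)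
  have wt: "pbw_weight n p t = (if i \<le> t \<and> t < k then 1 else 0)" if "p \<in> P" "t \<in> {1..<n}" for p t
    using bspec[OF P' that(1)] that(2) unfolding interval_exponent_def by (elim conjE) (rule bspec)
  have supp: "fst r < k" if "p \<in> P" "p r \<noteq> 0" for p r
    using bspec[OF P' that(1)] that(2) unfolding interval_exponent_def by (elim conjE allE impE)
  have kj: "(k, j) \<in> set (pos_roots n)" using ik by (auto simp: set_pos_roots)
  let ?g = "\<lambda>p :: nat \<times> nat \<Rightarrow> nat. p((k, j) := 1)"
  have p0: "p (k, j) = 0" if "p \<in> P" for p using supp[OF that, of "(k, j)"] by auto
  have undo: "(?g p)((k, j) := 0) = p" if "p \<in> P" for p
    by (rule ext) (simp add: p0[OF that])
  have inj: "inj_on ?g P"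
    by (rule inj_on_inverseI[where g = "\<lambda>p. p((k, j) := 0)"]) (rule undo)
  have mult: "root_e \<kappa> V k j ** pbw_e n \<kappa> V p = pbw_e n \<kappa> V (?g p)" if "p \<in> P" for p
    by (rule root_e_times_pbw[OF kj]) (rule supp[OF that])
  have "s *\<^sub>M (root_e \<kappa> V k j ** Y) = (\<Sum>p\<in>P. (s * a p) *\<^sub>M pbw_e n \<kappa> V (?g p))"
  proof -
    have "root_e \<kappa> V k j ** Y = (\<Sum>p\<in>P. root_e \<kappa> V k j ** (a p *\<^sub>M pbw_e n \<kappa> V p))"
      unfolding P(2) by (rule mult_sum_right)
    also have "\<dots> = (\<Sum>p\<in>P. a p *\<^sub>M pbw_e n \<kappa> V (?g p))"
      by (rule sum.cong[OF refl]) (simp only: mscale_mult_right mult)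
    finally show ?thesis by (simp only: mscale_sum mscale_mscale)
  qed
  also have "\<dots> = (\<Sum>p\<in>?g ` P. (s * a (p((k, j) := 0))) *\<^sub>M pbw_e n \<kappa> V p)"
    by (rule trans[OF _ sum.reindex[OF inj, symmetric]], rule sum.cong[OF refl]) (simp only: comp_def undo)
  finally have sum_eq: "s *\<^sub>M (root_e \<kappa> V k j ** Y)
      = (\<Sum>p\<in>?g ` P. (s * a (p((k, j) := 0))) *\<^sub>M pbw_e n \<kappa> V p)" .
  show ?thesis unfolding sum_eq
  proof (rule pbw_combinationI)
    show "finite (?g ` P)" using P(1) by simp
    fix p' assume "p' \<in> ?g ` P"
    then obtain p where p: "p \<in> P" "p' = ?g p" by blast
    have "?g p r = 0" if "r \<notin> set (pos_roots n)" for r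
    proof -
      have "r \<noteq> (k, j)" using kj that by blast
      hence "?g p r = p r" by (rule fun_upd_other)
      also have "p r = 0" using ex[OF p(1)] that unfolding pbw_exponents_def by blast
      finally show ?thesis .
    qed
    hence "p' \<in> pbw_exponents n" unfolding p(2) pbw_exponents_def by blast
    moreover have "pbw_weight n p' t = (if i \<le> t \<and> t < j then 1 else 0)" if "t \<in> {1..<n}" for t
      unfolding p(2) pbw_weight_upd[OF kj, of p t, OF p0[OF p(1)]] wt[OF p(1) that] using ik by auto
    moreover have "fst r < j" if "p' r \<noteq> 0" for r
    proof (cases "r = (k, j)")
      case False
      hence "p r \<noteq> 0" using that unfolding p(2) by (simp only: fun_upd_other simp_thms)
      thus ?thesis using supp[OF p(1), of r] ik by linarith
    qed (use ik in simp)
    ultimately show "interval_exponent i j p'" unfolding interval_exponent_def by blast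
  qed
qed

lemma pbw_combination_down_coeff:
  "1 \<le> i \<Longrightarrow> i \<le> j \<Longrightarrow> j \<le> n \<Longrightarrow> pbw_combination i j (down_coeff y i j)"
proof (induction j rule: less_induct)
  case (less j)
  show ?case
  proof (cases "j = i")
    case False
    have "pbw_combination i j (\<Sum>k\<in>{i..<j}. (c * qpow \<kappa> (y k) / (qpow \<kappa> (y j) - qpow \<kappa> (y i)))
        *\<^sub>M (root_e \<kappa> V k j ** down_coeff y i k))"
      by (rule pbw_combination_sum, rule pbw_combination_step) (use less in auto)
    thus ?thesis using False less.prems by (subst down_coeff.simps) simp
  qed (simp add: down_coeff_same pbw_combination_one)
qed

text \<open>A term $a_p\,E_{ji}\otimes e^p$ of $E_{ji}\otimes Y_{ij}$ belongs to the pair $(e^p,f_{ij})$, with a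
  constant as its coefficient.\<close>

lemma shift_form_F_down: "shift_form n \<kappa> B A (F_down y)"
proof -
  let ?R = "set (pos_roots n)"
  define \<delta> :: "nat \<times> nat \<Rightarrow> nat \<times> nat \<Rightarrow> nat" where "\<delta> r = (\<lambda>_. 0)(r := 1)" for r
  have inj: "r = r'" if "\<delta> r = \<delta> r'" for r r'
    using fun_cong[OF that, of r] by (auto simp: \<delta>_def split: if_splits)
  have \<delta>0: "\<delta> r \<noteq> (\<lambda>_. 0)" for r
  proof
    assume "\<delta> r = (\<lambda>_. 0)" from fun_cong[OF this, of r] show False by (simp add: \<delta>_def)
  qed
  define Q where "Q r Pa \<longleftrightarrow> finite (fst Pa)
      \<and> down_coeff y (fst r) (snd r) = (\<Sum>p\<in>fst Pa. snd Pa p *\<^sub>M pbw_e n \<kappa> V p)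
      \<and> (\<forall>p\<in>fst Pa. interval_exponent (fst r) (snd r) p)" for r and Pa :: "_ \<times> (_ \<Rightarrow> complex)"
  have "\<forall>r\<in>?R. \<exists>Pa. Q r Pa"
  proof
    fix r assume r: "r \<in> ?R"
    have "1 \<le> fst r" "fst r \<le> snd r" "snd r \<le> n" using r by (auto simp: set_pos_roots)
    hence "pbw_combination (fst r) (snd r) (down_coeff y (fst r) (snd r))"
      by (rule pbw_combination_down_coeff)
    then obtain P a where "finite P" "down_coeff y (fst r) (snd r) = (\<Sum>p\<in>P. a p *\<^sub>M pbw_e n \<kappa> V p)"
        "\<forall>p\<in>P. interval_exponent (fst r) (snd r) p"
      unfolding pbw_combination_def by blast
    hence "Q r (P, a)" unfolding Q_def fst_conv snd_conv by blast
    thus "\<exists>Pa. Q r Pa" by blast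
  qed
  then obtain f where f: "\<forall>r\<in>?R. Q r (f r)" using bchoice by blast
  define P where "P r = fst (f r)" for r
  define a where "a r = snd (f r)" for r
  have Pa: "finite (P r)
      \<and> down_coeff y (fst r) (snd r) = (\<Sum>p\<in>P r. a r p *\<^sub>M pbw_e n \<kappa> V p)
      \<and> (\<forall>p\<in>P r. interval_exponent (fst r) (snd r) p)" if "r \<in> ?R" for r
    using bspec[OF f that] unfolding Q_def P_def a_def .
  define \<phi> :: "(nat \<times> nat \<Rightarrow> nat) \<Rightarrow> (nat \<times> nat \<Rightarrow> nat) \<Rightarrow> complex^('n \<times> 'd)^('n \<times> 'd)"
    where "\<phi> p r = (if r = (\<lambda>_. 0) then 1 else a (SOME s. r = \<delta> s) p) *\<^sub>M mat 1" for p r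
  have \<phi>\<delta>: "\<phi> p (\<delta> r) = a r p *\<^sub>M mat 1" for p r
  proof -
    have "(SOME s. \<delta> r = \<delta> s) = r" by (rule some_equality) (auto dest: inj)
    thus ?thesis using \<delta>0 by (simp add: \<phi>_def)
  qed
  let ?T = "(\<lambda>(r, p). (p, \<delta> r)) ` (SIGMA r:?R. P r)"
  let ?S = "insert (\<lambda>_. 0, \<lambda>_. 0) ?T"
  let ?f = "\<lambda>(p, r). pbw_e n \<kappa> B p ** pbw_f n \<kappa> A r ** \<phi> p r"
  have finT: "finite ?T" using Pa by (intro finite_imageI finite_SigmaI) auto
  have notin: "(\<lambda>_. 0, \<lambda>_. 0) \<notin> ?T"
  proof
    assume "(\<lambda>_. 0, \<lambda>_. 0) \<in> ?T"
    then obtain r where "(\<lambda>_. 0) = \<delta> r" by auto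
    thus False using \<delta>0 by metis
  qed
  have "(\<Sum>x\<in>?S. ?f x) = mat 1 + (\<Sum>x\<in>?T. ?f x)"
    using finT notin by (subst sum.insert) (simp_all add: pbw_zero \<phi>_def mscale_def)
  also have "(\<Sum>x\<in>?T. ?f x) = (\<Sum>x\<in>(SIGMA r:?R. P r). ?f (case x of (r, p) \<Rightarrow> (p, \<delta> r)))"
    by (subst sum.reindex) (auto simp: inj_on_def dest: inj)
  also have "\<dots> = (\<Sum>r\<in>?R. \<Sum>p\<in>P r. ?f (p, \<delta> r))"
    using Pa by (subst sum.Sigma) (auto simp: case_prod_beta)
  also have "\<dots> = (\<Sum>r\<in>?R. tensor_op (mat 1) (down_coeff y (fst r) (snd r)) ** root_f \<kappa> A (fst r) (snd r))"
  proof (rule sum.cong[OF refl])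
    fix r assume r: "r \<in> ?R"
    have pf: "pbw_f n \<kappa> A (\<delta> r) = root_f \<kappa> A (fst r) (snd r)"
      using pbw_single(2)[of "fst r" "snd r" n \<kappa> A] r by (simp add: \<delta>_def)
    have "tensor_op (mat 1) (down_coeff y (fst r) (snd r)) = (\<Sum>p\<in>P r. a r p *\<^sub>M pbw_e n \<kappa> B p)"
    proof (rule matrix_eq_on_tb)
      fix k w
      show "tensor_op (mat 1) (down_coeff y (fst r) (snd r)) *v tb k w = (\<Sum>p\<in>P r. a r p *\<^sub>M pbw_e n \<kappa> B p) *v tb k w"
        using Pa[OF r] by (simp add: tensor_op_tb sum_mult_vec mscale_mult_vec pbw_legs tb_sum tb_scale)
    qed
    hence "tensor_op (mat 1) (down_coeff y (fst r) (snd r)) ** root_f \<kappa> A (fst r) (snd r)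
        = (\<Sum>p\<in>P r. (a r p *\<^sub>M pbw_e n \<kappa> B p) ** root_f \<kappa> A (fst r) (snd r))"
      by (simp only: mult_sum_left)
    also have "\<dots> = (\<Sum>p\<in>P r. ?f (p, \<delta> r))"
      by (rule sum.cong[OF refl]) (simp add: pf \<phi>\<delta> mscale_mult_left mscale_mult_right)
    finally show "(\<Sum>p\<in>P r. ?f (p, \<delta> r))
        = tensor_op (mat 1) (down_coeff y (fst r) (snd r)) ** root_f \<kappa> A (fst r) (snd r)" by (rule sym)
  qed
  finally have F: "F_down y = (\<Sum>(p, r)\<in>?S. pbw_e n \<kappa> B p ** pbw_f n \<kappa> A r ** \<phi> p r)"
    by (simp only: F_down_def lower_op_def)
  have cart: "cartan_function n A (\<phi> p r)" for p r
    unfolding cartan_function_def \<phi>_def by (metis mscale_mult_vec matrix_vector_mul_lid)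
  have zero: "(\<lambda>_. 0) \<in> pbw_exponents n" by (simp add: pbw_exponents_def)
  have cond: "p \<in> pbw_exponents n \<and> r' \<in> pbw_exponents n
            \<and> (\<forall>k\<in>{1..<n}. pbw_weight n p k = pbw_weight n r' k)" if pr: "(p, r') \<in> ?S" for p r'
  proof (cases "(p, r') = (\<lambda>_. 0, \<lambda>_. 0)")
    case False
    then obtain r where r: "r \<in> ?R" "p \<in> P r" "r' = \<delta> r" using pr by auto
    obtain i j where ij: "r = (i, j)" by fastforce
    have "r' \<in> pbw_exponents n" using r by (auto simp: pbw_exponents_def \<delta>_def)
    moreover have "pbw_weight n r' t = (if fst r \<le> t \<and> t < snd r then 1 else 0)" for t
    proof -
      have "pbw_weight n (\<lambda>_. 0) t = 0" by (simp add: pbw_weight_def)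
      thus ?thesis using pbw_weight_upd[of i j "\<lambda>_. 0" t] r(1)
        unfolding r(3) \<delta>_def ij fst_conv snd_conv by simp
    qed
    moreover have "interval_exponent (fst r) (snd r) p" using Pa[OF r(1)] r(2) by blast
    ultimately show ?thesis unfolding interval_exponent_def by auto
  qed (use zero in simp)
  show ?thesis
    unfolding shift_form_def
  proof (intro exI[of _ ?S] exI[of _ \<phi>] conjI F ballI)
    show "finite ?S" using finT by simp
    show "\<phi> (\<lambda>_. 0) (\<lambda>_. 0) = mat 1" by (simp add: \<phi>_def mscale_def)
    fix x assume x: "x \<in> ?S"
    obtain p r where pr: "x = (p, r)" by fastforce
    show "case x of (p, r) \<Rightarrow> p \<in> pbw_exponents n \<and> r \<in> pbw_exponents n
            \<and> (\<forall>k\<in>{1..<n}. pbw_weight n p k = pbw_weight n r k) \<and> cartan_function n A (\<phi> p r)"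
      unfolding pr prod.case using cond[OF x[unfolded pr]] cart by blast
  qed simp
qed

lemma F_shift_lower:
  assumes "separated y"
  shows "F_shift n \<kappa> y B A = F_down y"
  unfolding F_shift_def
proof (rule the_equality)
  show "shift_form n \<kappa> B A (F_down y) \<and> R_hat n \<kappa> B A ** F_down y = B_op n \<kappa> y A ** F_down y ** matrix_inv (B_op n \<kappa> y A)"
    using shift_form_F_down F_down_equation[OF assms] by blast
qed (use lower_shift_unique[OF assms] shift_form_F_down F_down_equation[OF assms] in blast)

lemma F_down_inverse_equation:
  assumes y: "separated y"
  shows "F_down_inverse y ** R_hat_lower_inv ** B_op n \<kappa> y A = B_op n \<kappa> y A ** F_down_inverse y"
proof (rule matrix_eq_on_tb)
  fix k w assume k: "k \<in> {1..n}"
  obtain z where z: "\<And>i. i \<in> {1..n} \<Longrightarrow> twist y (unit_weight i) = z * qpow \<kappa> (y i)"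
    using twist_unit_weight_scaled[OF k] by metis
  define x where "x = R_hat_lower_inv *v tb k w"
  have x: "coord i x = (if i = k then w else if k < i then (- c) *s (root_e \<kappa> V k i *v w) else 0)" if "i \<in> {1..n}" for i
    unfolding x_def R_hat_lower_inv_eq coord_lower_op_tb[OF that k] by (simp add: mscale_mult_vec)
  have "twist y (unit_weight k) *s (F_down_inverse y *v x) = B_op n \<kappa> y A *v (F_down_inverse y *v tb k w)"
  proof (rule eq_if_coords_eq)
    fix i assume i: "i \<in> {1..n}"
    have R: "coord i (B_op n \<kappa> y A *v (F_down_inverse y *v tb k w)) = (z * qpow \<kappa> (y i)) *s
        (if i = k then w else if k < i then down_inverse_coeff y k i *v w else 0)"
      unfolding coord_twist_A[OF i] z[OF i] F_down_inverse_def coord_lower_op_tb[OF i k] ..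
    have L: "coord i (F_down_inverse y *v x) = coord i x + (\<Sum>j\<in>{1..<i}. down_inverse_coeff y j i *v coord j x)"
      unfolding F_down_inverse_def by (rule coord_lower_op[OF i])
    show "coord i (twist y (unit_weight k) *s (F_down_inverse y *v x))
        = coord i (B_op n \<kappa> y A *v (F_down_inverse y *v tb k w))"
    proof (cases "k < i")
      case True
      let ?G = "\<lambda>j. down_inverse_coeff y j i *v (root_e \<kappa> V k j *v w)"
      have "(\<Sum>j\<in>{1..<i}. down_inverse_coeff y j i *v coord j x)
          = (\<Sum>j\<in>insert k {k<..<i}. down_inverse_coeff y j i *v coord j x)"
        using k i True by (intro sum.mono_neutral_right) (auto simp: x)
      also have "\<dots> = down_inverse_coeff y k i *v coord k x + (\<Sum>j\<in>{k<..<i}. down_inverse_coeff y j i *v coord j x)"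
        by (rule sum.insert) auto
      also have "(\<Sum>j\<in>{k<..<i}. down_inverse_coeff y j i *v coord j x) = (\<Sum>j\<in>{k<..<i}. (- c) *s ?G j)"
      proof (rule sum.cong[OF refl])
        fix j assume "j \<in> {k<..<i}"
        hence j: "j \<in> {1..n}" "k < j" "j \<noteq> k" using i k by auto
        show "down_inverse_coeff y j i *v coord j x = (- c) *s ?G j"
          unfolding x[OF j(1)] using j(2,3) by (simp add: vec.scale mult_vec_uminus)
      qed
      also have "coord k x = w" using x[OF k] by simp
      finally have S: "(\<Sum>j\<in>{1..<i}. down_inverse_coeff y j i *v coord j x)
          = down_inverse_coeff y k i *v w + (\<Sum>j\<in>{k<..<i}. (- c) *s ?G j)" .
      have "coord i x = (- c) *s ?G i" using x[OF i] True by (simp add: down_inverse_coeff_same)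
      moreover have "(\<Sum>j\<in>{k<..i}. (- c) *s ?G j) = (- c) *s ?G i + (\<Sum>j\<in>{k<..<i}. (- c) *s ?G j)"
      proof -
        have "{k<..i} = insert i {k<..<i}" using True by auto
        thus ?thesis by simp
      qed
      ultimately have L': "coord i (F_down_inverse y *v x) = down_inverse_coeff y k i *v w + (- c) *s (\<Sum>j\<in>{k<..i}. ?G j)"
        unfolding L S vec.scale_sum_right by (simp only: add_ac)
      have "z *s ((qpow \<kappa> (y k) - qpow \<kappa> (y i)) *s (down_inverse_coeff y k i *v w))
          = z *s ((c * qpow \<kappa> (y k)) *s (\<Sum>j\<in>{k<..i}. ?G j))"
        unfolding down_inverse_recursion[OF y k i True] ..
      thus ?thesis using True unfolding coord_scale R L' z[OF k]
        by (simp add: vec_eq_iff algebra_simps)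
    next
      case False
      have S0: "(\<Sum>j\<in>{1..<i}. down_inverse_coeff y j i *v coord j x) = 0"
        using False i by (intro sum.neutral) (auto simp: x)
      have xi: "coord i x = (if i = k then w else 0)" using x[OF i] False by simp
      show ?thesis using False unfolding coord_scale R L S0 xi z[OF k] by simp
    qed
  qed
  thus "(F_down_inverse y ** R_hat_lower_inv ** B_op n \<kappa> y A) *v tb k w = (B_op n \<kappa> y A ** F_down_inverse y) *v tb k w"
    unfolding matrix_vector_mul_assoc[symmetric] twist_A_tb[OF k] vec.scale x_def .
qed

text \<open>By the two equations, the product of $F_{21}$ with the candidate for the inverse commutes with the
  twist, whose eigenvalues on \<open>v\<^sub>1, \<dots>, v\<^sub>n\<close> are distinct.  So it is diagonal, and being
  unitriangular it is the identity.\<close>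

lemma F_down_matrix_inv:
  assumes y: "separated y"
  shows "matrix_inv (F_down y) = F_down_inverse y"
proof -
  let ?C = "F_down_inverse y ** F_down y" and ?T = "B_op n \<kappa> y A"
  have "?C ** ?T = F_down_inverse y ** (F_down y ** ?T)" by (simp only: matrix_mul_assoc)
  also have "F_down y ** ?T = R_hat_lower_inv ** (?T ** F_down y)"
    using F_down_equation[OF y] unfolding lower_equation_iff .
  also have "F_down_inverse y ** (R_hat_lower_inv ** (?T ** F_down y))
      = (F_down_inverse y ** R_hat_lower_inv ** ?T) ** F_down y" by (simp only: matrix_mul_assoc)
  also have "\<dots> = ?T ** ?C" unfolding F_down_inverse_equation[OF y] by (simp only: matrix_mul_assoc)
  finally have comm: "?C ** ?T = ?T ** ?C" .
  have "?C = mat 1"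
  proof (rule matrix_eq_on_tb)
    fix k w assume k: "k \<in> {1..n}"
    have Ck: "twist y (unit_weight k) *s (?C *v tb k w) = ?T *v (?C *v tb k w)"
      using arg_cong[OF comm, of "\<lambda>X. X *v tb k w"]
      unfolding matrix_vector_mul_assoc[symmetric] twist_A_tb[OF k] vec.scale .
    show "?C *v tb k w = mat 1 *v tb k w"
    proof (rule eq_if_coords_eq)
      fix i assume i: "i \<in> {1..n}"
      show "coord i (?C *v tb k w) = coord i (mat 1 *v tb k w)"
      proof (cases "i = k")
        case True
        let ?x = "F_down y *v tb k w"
        have x: "coord j ?x = (if j = k then w else if k < j then down_coeff y k j *v w else 0)" if "j \<in> {1..n}" for j
          unfolding F_down_def by (rule coord_lower_op_tb[OF that k])
        have "coord k (F_down_inverse y *v ?x) = coord k ?x + (\<Sum>j\<in>{1..<k}. down_inverse_coeff y j k *v coord j ?x)"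
          unfolding F_down_inverse_def by (rule coord_lower_op[OF k])
        also have "(\<Sum>j\<in>{1..<k}. down_inverse_coeff y j k *v coord j ?x) = 0"
          using k by (intro sum.neutral) (auto simp: x)
        finally show ?thesis using k
          by (simp add: True x coord_tb flip: matrix_vector_mul_assoc)
      next
        case False
        have "twist y (unit_weight k) *s coord i (?C *v tb k w) = twist y (unit_weight i) *s coord i (?C *v tb k w)"
          using arg_cong[OF Ck, of "coord i"] unfolding coord_scale coord_twist_A[OF i] .
        hence "(twist y (unit_weight k) - twist y (unit_weight i)) *s coord i (?C *v tb k w) = 0"
          by simp
        moreover have "twist y (unit_weight k) - twist y (unit_weight i) \<noteq> 0"
          using twist_unit_weight_eq_iff[OF k i] y False k i unfolding separated_def by auto
        ultimately have "coord i (?C *v tb k w) = 0" by (simp only: vec.scale_eq_0_iff simp_thms)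
        thus ?thesis using False i k by (simp add: coord_tb)
      qed
    qed
  qed
  hence "F_down_inverse y ** F_down y = mat 1" .
  moreover from this have "F_down y ** F_down_inverse y = mat 1" by (simp add: matrix_left_right_inverse)
  ultimately show ?thesis by (intro matrix_inv_unique)
qed

end


section \<open>Diagonal matrix elements of the dynamical R-matrix\<close>

text \<open>The scalar identity behind the product formula.  Let \<open>S\<^sub>i\<close> and \<open>T\<^sub>i\<close> be the expressions in the
  two recursions, up to constants, and $\rho_i$ the factor of index \<open>i\<close> in the product.  Passing from \<open>i\<close> to
  \<open>i - 1\<close> multiplies each of \<open>S\<^sub>i\<close> and \<open>T\<^sub>i\<close> by a scalar, and the product of both scalars is
  $\rho_i$.  The term of index \<open>i\<close> of the sum is then $(\rho_i-1)\prod_{j>i}\rho_j$, and the sum telescopes.\<close>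

lemma recursions_give_product:
  fixes Q L :: complex and z a g :: "nat \<Rightarrow> complex"
  assumes nz: "Q \<noteq> 0" "L \<noteq> 0" and k: "k \<ge> 1"
    and a: "\<And>i. i \<in> {1..<k} \<Longrightarrow> (Q\<^sup>2 * z i - 1) * a i
              = (L - inverse L) * (L ^ (k - i - 1) + (\<Sum>j\<in>{i<..<k}. L ^ (j - i - 1) * a j))"
    and g: "\<And>i. i \<in> {1..<k} \<Longrightarrow> (1 - z i) * g i
              = (Q * L - inverse (Q * L)) * inverse L ^ (k - i - 1)
                + (L - inverse L) * (\<Sum>j\<in>{i<..<k}. inverse L ^ (j - i - 1) * g j)"
    and z: "\<And>i. i \<in> {1..<k} \<Longrightarrow> Q\<^sup>2 * z i \<noteq> 1 \<and> z i \<noteq> 1"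
  shows "1 + (\<Sum>i\<in>{1..<k}. Q * z i * a i * g i)
    = (\<Prod>i\<in>{1..<k}. 1 - (L - inverse L) * (Q * L - inverse (Q * L)) * (Q * z i) / ((z i - 1) * (Q\<^sup>2 * z i - 1)))"
proof -
  define \<rho> where "\<rho> i = 1 - (L - inverse L) * (Q * L - inverse (Q * L)) * (Q * z i) / ((z i - 1) * (Q\<^sup>2 * z i - 1))" for i
  define S where "S i = L ^ (k - i - 1) + (\<Sum>j\<in>{i<..<k}. L ^ (j - i - 1) * a j)" for i
  define T where "T i = (Q * L - inverse (Q * L)) * inverse L ^ (k - i - 1)
                + (L - inverse L) * (\<Sum>j\<in>{i<..<k}. inverse L ^ (j - i - 1) * g j)" for i
  have "S 0 * T 0 = (Q * L - inverse (Q * L)) * (\<Prod>j\<in>{0<..<k}. \<rho> j)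
     \<and> 1 + (\<Sum>j\<in>{0<..<k}. Q * z j * a j * g j) = (\<Prod>j\<in>{0<..<k}. \<rho> j)"
  proof (rule inc_induct[of 0 "k - 1"])
    have "{k - 1<..<k} = {}" using k by auto
    moreover have "k - (k - 1) - 1 = 0" using k by simp
    ultimately show "S (k - 1) * T (k - 1) = (Q * L - inverse (Q * L)) * (\<Prod>j\<in>{k - 1<..<k}. \<rho> j)
     \<and> 1 + (\<Sum>j\<in>{k - 1<..<k}. Q * z j * a j * g j) = (\<Prod>j\<in>{k - 1<..<k}. \<rho> j)"
      unfolding S_def T_def by simp
  next
    fix i assume i: "i < k - 1"
    let ?i = "Suc i"
    assume IH: "S ?i * T ?i = (Q * L - inverse (Q * L)) * (\<Prod>j\<in>{?i<..<k}. \<rho> j)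
     \<and> 1 + (\<Sum>j\<in>{?i<..<k}. Q * z j * a j * g j) = (\<Prod>j\<in>{?i<..<k}. \<rho> j)"
    have mem: "?i \<in> {1..<k}" using i by auto
    have range: "{i<..<k} = insert ?i {?i<..<k}" using i by auto
    have e: "k - i - 1 = Suc (k - ?i - 1)" using i by simp
    have S: "S i = L * S ?i + a ?i"
    proof -
      have "(\<Sum>j\<in>{?i<..<k}. L ^ (j - i - 1) * a j) = (\<Sum>j\<in>{?i<..<k}. L * (L ^ (j - ?i - 1) * a j))"
      proof (rule sum.cong[OF refl])
        fix j assume "j \<in> {?i<..<k}"
        hence "j - i - 1 = Suc (j - ?i - 1)" by auto
        thus "L ^ (j - i - 1) * a j = L * (L ^ (j - ?i - 1) * a j)" by simp
      qed
      thus ?thesis unfolding S_def range e by (simp add: distrib_left flip: sum_distrib_left)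
    qed
    have T: "T i = T ?i * inverse L + (L - inverse L) * g ?i"
    proof -
      have "(\<Sum>j\<in>{?i<..<k}. inverse L ^ (j - i - 1) * g j) = (\<Sum>j\<in>{?i<..<k}. inverse L * (inverse L ^ (j - ?i - 1) * g j))"
      proof (rule sum.cong[OF refl])
        fix j assume "j \<in> {?i<..<k}"
        hence "j - i - 1 = Suc (j - ?i - 1)" by auto
        thus "inverse L ^ (j - i - 1) * g j = inverse L * (inverse L ^ (j - ?i - 1) * g j)" by simp
      qed
      hence X: "(\<Sum>j\<in>{i<..<k}. inverse L ^ (j - i - 1) * g j)
          = g ?i + inverse L * (\<Sum>j\<in>{?i<..<k}. inverse L ^ (j - ?i - 1) * g j)"
        unfolding range by (simp flip: sum_distrib_left)
      show ?thesis unfolding T_def X e power_Suc by (simp add: algebra_simps)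
    qed
    let ?D1 = "Q\<^sup>2 * z ?i - 1" and ?D2 = "1 - z ?i"
    have D: "?D1 \<noteq> 0" "?D2 \<noteq> 0" using z[OF mem] by auto
    have ai: "a ?i = (L - inverse L) * S ?i / ?D1"
      using a[OF mem] D(1) by (simp add: S_def eq_divide_eq mult.commute)
    have gi: "g ?i = T ?i / ?D2"
      using g[OF mem] D(2) by (simp add: T_def eq_divide_eq mult.commute)
    have \<rho>: "\<rho> ?i = 1 + (L - inverse L) * (Q * L - inverse (Q * L)) * (Q * z ?i) / (?D1 * ?D2)"
    proof -
      have "(z ?i - 1) * ?D1 = - (?D1 * ?D2)" by (simp add: algebra_simps)
      thus ?thesis unfolding \<rho>_def by simp
    qed
    have key: "(L + (L - inverse L) / ?D1) * (inverse L + (L - inverse L) / ?D2) = \<rho> ?i"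
    proof -
      have "(L * ?D1 + (L - inverse L)) * (inverse L * ?D2 + (L - inverse L))
          = ?D1 * ?D2 + (L - inverse L) * (Q * L - inverse (Q * L)) * (Q * z ?i)"
        using nz by (simp add: field_simps power2_eq_square)
      moreover have "(L + (L - inverse L) / ?D1) * (inverse L + (L - inverse L) / ?D2)
          = ((L * ?D1 + (L - inverse L)) / ?D1) * ((inverse L * ?D2 + (L - inverse L)) / ?D2)"
        using D by (simp only: add_divide_distrib nonzero_mult_div_cancel_right not_False_eq_True)
      moreover have "(?D1 * ?D2 + (L - inverse L) * (Q * L - inverse (Q * L)) * (Q * z ?i)) / (?D1 * ?D2) = \<rho> ?i"
        unfolding \<rho> using D by (simp only: add_divide_distrib divide_self mult_eq_0_iff simp_thms)
      ultimately show ?thesis by (simp only: times_divide_times_eq)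
    qed
    have "S i * T i = (S ?i * T ?i) * ((L + (L - inverse L) / ?D1) * (inverse L + (L - inverse L) / ?D2))"
    proof -
      have "S i = S ?i * (L + (L - inverse L) / ?D1)"
        unfolding S ai by (simp only: distrib_left times_divide_eq_right mult.commute)
      moreover have "T i = T ?i * (inverse L + (L - inverse L) / ?D2)"
        unfolding T gi by (simp only: distrib_left times_divide_eq_right mult.commute)
      ultimately show ?thesis by (simp only: mult_ac)
    qed
    hence 1: "S i * T i = (Q * L - inverse (Q * L)) * (\<Prod>j\<in>{i<..<k}. \<rho> j)"
      unfolding key using IH unfolding range by (simp add: mult_ac)
    have "Q * z ?i * a ?i * g ?i = (\<rho> ?i - 1) * (\<Prod>j\<in>{?i<..<k}. \<rho> j)"
    proof -
      have "Q * z ?i * a ?i * g ?i = Q * z ?i * (L - inverse L) * (S ?i * T ?i) / (?D1 * ?D2)"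
        unfolding ai gi by simp
      also have "\<dots> = (\<rho> ?i - 1) * (\<Prod>j\<in>{?i<..<k}. \<rho> j)"
        unfolding \<rho> conjunct1[OF IH] by (simp add: mult_ac)
      finally show ?thesis .
    qed
    hence 2: "1 + (\<Sum>j\<in>{i<..<k}. Q * z j * a j * g j) = (\<Prod>j\<in>{i<..<k}. \<rho> j)"
    proof -
      let ?P = "\<Prod>j\<in>{?i<..<k}. \<rho> j"
      have "(\<Sum>j\<in>insert ?i {?i<..<k}. Q * z j * a j * g j)
          = Q * z ?i * a ?i * g ?i + (\<Sum>j\<in>{?i<..<k}. Q * z j * a j * g j)"
        by (rule sum.insert) auto
      moreover have "(\<Prod>j\<in>insert ?i {?i<..<k}. \<rho> j) = \<rho> ?i * ?P"
        by (rule prod.insert) auto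
      moreover have "1 + ((\<rho> ?i - 1) * ?P + (\<Sum>j\<in>{?i<..<k}. Q * z j * a j * g j)) = (\<rho> ?i - 1) * ?P + ?P"
        by (simp only: conjunct2[OF IH, symmetric] add_ac)
      moreover have "(\<rho> ?i - 1) * ?P + ?P = \<rho> ?i * ?P" by (simp add: left_diff_distrib)
      ultimately show ?thesis unfolding range
        using \<open>Q * z ?i * a ?i * g ?i = (\<rho> ?i - 1) * ?P\<close> by (simp only:)
    qed
    show "S i * T i = (Q * L - inverse (Q * L)) * (\<Prod>j\<in>{i<..<k}. \<rho> j)
     \<and> 1 + (\<Sum>j\<in>{i<..<k}. Q * z j * a j * g j) = (\<Prod>j\<in>{i<..<k}. \<rho> j)" using 1 2 by blast
  qed simp
  moreover have "{0<..<k} = {1..<k}" by auto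
  ultimately show ?thesis unfolding \<rho>_def by simp
qed

context monomial_tensor
begin

lemma admissible_separated: "admissible y \<Longrightarrow> separated y"
  unfolding separated_def
proof (intro ballI impI)
  fix i j assume y: "admissible y" and ij: "i \<in> {1..n}" "j \<in> {1..n}" "i \<noteq> j"
  have "qpow \<kappa> (y i - y j + of_int 0) \<noteq> 1"
    using y ij unfolding admissible_def by (metis abs_zero of_nat_0_le_iff add_nonneg_nonneg mult_nonneg_nonneg zero_le_numeral)
  thus "qpow \<kappa> (y i) \<noteq> qpow \<kappa> (y j)" by (auto simp: qpow_diff)
qed

text \<open>The shift equation expresses $\hat R_{12}F_{12}$ through $F_{12}$ and the twist, which saves the
  summation over the roots in $\hat R_{12}$.\<close>

lemma coord_R_hat_F_up:
  assumes y: "admissible y" and m: "composition n N m" and k: "k \<in> {1..n}" and i: "i \<in> {1..n}"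
  shows "coord i (R_hat n \<kappa> A B *v (F_up y *v tb k (u m))) = (if i = k then u m
     else if i < k then (ratio y i k m * up_coeff y i k m) *s u (move_unit k i m) else 0)"
proof -
  have eq: "twist y (mw m) *s (R_hat n \<kappa> A B *v (F_up y *v tb k (u m))) = B_op n \<kappa> y B *v (F_up y *v tb k (u m))"
  proof -
    have "(R_hat n \<kappa> A B ** F_up y ** B_op n \<kappa> y B) *v tb k (u m) = (B_op n \<kappa> y B ** F_up y) *v tb k (u m)"
      using F_up_equation[OF y] unfolding conjugation_eq_iff[OF twist_B_invertible] by (rule arg_cong)
    thus ?thesis unfolding matrix_vector_mul_assoc[symmetric] twist_B_tb vec.scale .
  qed
  have wt: "weight_vector n V (shifted k j (mw m)) (coord j (F_up y *v tb k (u m)))" if j: "j \<in> {1..n}" for j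
    by (rule shift_form_upper(3)[OF shift_form_F_up k graded u_weight j])
  have B: "coord i (B_op n \<kappa> y B *v (F_up y *v tb k (u m)))
      = twist y (shifted k i (mw m)) *s coord i (F_up y *v tb k (u m))"
    by (rule coord_twist_B[OF wt i])
  have "twist y (mw m) *s coord i (R_hat n \<kappa> A B *v (F_up y *v tb k (u m)))
      = twist y (mw m) *s (if i = k then u m
     else if i < k then (ratio y i k m * up_coeff y i k m) *s u (move_unit k i m) else 0)"
  proof (cases "i = k")
    case True
    thus ?thesis using arg_cong[OF eq, of "coord i"] unfolding coord_scale B coord_F_up[OF k i]
      by (simp add: shifted_same)
  next
    case False
    have tw: "twist y (shifted k i (mw m)) = ratio y i k m * twist y (mw m)"
      unfolding ratio_def using False by (intro twist_shifted i k) simp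
    show ?thesis using False arg_cong[OF eq, of "coord i"] unfolding coord_scale B coord_F_up[OF k i] tw
      by (simp add: mult_ac)
  qed
  thus ?thesis unfolding vec.scale_cancel_left using twist_nonzero by blast
qed

lemma coord_K:
  assumes "\<And>j. j \<in> {1..n} \<Longrightarrow> weight_vector n V (\<nu> j) (coord j x)" and i: "i \<in> {1..n}"
  shows "coord i (K_op n \<kappa> A B *v x) = qpow \<kappa> (\<nu> i i - sum (\<nu> i) {1..n} / of_nat n) *s coord i x"
proof -
  have form: "weight_form n (unit_weight j) \<mu> = \<mu> j - sum \<mu> {1..n} / of_nat n" if "j \<in> {1..n}" for j \<mu>
  proof -
    have "(\<Sum>s\<in>{1..n}. unit_weight j s * \<mu> s) = \<mu> j"
      using sum_mult_unit_weight[OF that, of \<mu>] by (simp only: mult.commute)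
    thus ?thesis unfolding weight_form_def sum_unit_weight[OF that] by simp
  qed
  have "coord i (K_op n \<kappa> A B *v x)
      = (\<Sum>j\<in>{1..n}. if j = i then qpow \<kappa> (\<nu> i i - sum (\<nu> i) {1..n} / of_nat n) *s coord i x else 0)"
  proof (rule trans[OF coord_expand sum.cong[OF refl]])
    fix j assume j: "j \<in> {1..n}"
    have "K_op n \<kappa> A B *v tb j (coord j x) = qpow \<kappa> (\<nu> j j - sum (\<nu> j) {1..n} / of_nat n) *s tb j (coord j x)"
      using K_op_weight_vector[OF tb_weight_A[OF j] tb_weight_vector_B[OF assms(1)[OF j]], of \<kappa>]
      unfolding form[OF j] .
    thus "coord i (K_op n \<kappa> A B *v tb j (coord j x))
        = (if j = i then qpow \<kappa> (\<nu> i i - sum (\<nu> i) {1..n} / of_nat n) *s coord i x else 0)"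
      using i j by (simp add: coord_scale coord_tb)
  qed
  thus ?thesis using i by simp
qed

text \<open>The operators $W_{ik}$ of $F_{21}^{-1}$ lead from the monomial with one unit moved from \<open>i\<close> to \<open>k\<close> back
  to the original one, and their recursion becomes a scalar one.\<close>

function down_scalar :: "(nat \<Rightarrow> complex) \<Rightarrow> nat \<Rightarrow> nat \<Rightarrow> (nat \<Rightarrow> nat) \<Rightarrow> complex" where
  "down_scalar y i k m = c * qpow \<kappa> (y i) / (qpow \<kappa> (y i) - qpow \<kappa> (y k))
     * (e_coeff i k (move_unit k i m) + (\<Sum>j\<in>{i<..<k}. e_coeff i j (move_unit k i m) * down_scalar y j k m))"
  by pat_completeness auto
termination by (relation "Wellfounded.measure (\<lambda>(y, i, k, m). k - i)") auto

declare down_scalar.simps [simp del]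

lemma down_inverse_on_moved:
  assumes y: "separated y" and k: "k \<in> {1..n}" and pos: "\<And>s. s \<in> {1..n} \<Longrightarrow> m s > 0"
  shows "1 \<le> i \<Longrightarrow> i < k \<Longrightarrow>
    down_inverse_coeff y i k *v u (move_unit k i m) = down_scalar y i k m *s u m"
proof (induction "k - i" arbitrary: i rule: less_induct)
  case less
  let ?m = "move_unit k i m"
  have i: "i \<in> {1..n}" using less.prems k by auto
  have nz: "qpow \<kappa> (y i) - qpow \<kappa> (y k) \<noteq> 0" using y i k less.prems unfolding separated_def by auto
  have "{i<..k} = insert k {i<..<k}" using less.prems by auto
  hence "(\<Sum>j\<in>{i<..k}. down_inverse_coeff y j k *v (root_e \<kappa> V i j *v u ?m))
      = down_inverse_coeff y k k *v (root_e \<kappa> V i k *v u ?m)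
        + (\<Sum>j\<in>{i<..<k}. down_inverse_coeff y j k *v (root_e \<kappa> V i j *v u ?m))" by simp
  also have "down_inverse_coeff y k k *v (root_e \<kappa> V i k *v u ?m) = e_coeff i k ?m *s u m"
  proof -
    have "move_unit i k ?m = m"
      using pos[OF i] less.prems by (auto simp: move_unit_def fun_eq_iff)
    thus ?thesis using root_e_u[of i k ?m] less.prems k by (simp add: down_inverse_coeff_same)
  qed
  also have "(\<Sum>j\<in>{i<..<k}. down_inverse_coeff y j k *v (root_e \<kappa> V i j *v u ?m))
      = (\<Sum>j\<in>{i<..<k}. (e_coeff i j ?m * down_scalar y j k m) *s u m)"
  proof (rule sum.cong[OF refl])
    fix j assume "j \<in> {i<..<k}"
    hence j: "i < j" "j < k" by auto
    have "move_unit i j ?m = move_unit k j m"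
      using j pos[OF i] by (intro move_unit_trans') auto
    hence "root_e \<kappa> V i j *v u ?m = e_coeff i j ?m *s u (move_unit k j m)"
      using root_e_u[of i j ?m] less.prems j k by simp
    moreover have "down_inverse_coeff y j k *v u (move_unit k j m) = down_scalar y j k m *s u m"
      using less.hyps[of j] j less.prems by simp
    ultimately show "down_inverse_coeff y j k *v (root_e \<kappa> V i j *v u ?m) = (e_coeff i j ?m * down_scalar y j k m) *s u m"
      by (simp add: vec.scale)
  qed
  finally have S: "(\<Sum>j\<in>{i<..k}. down_inverse_coeff y j k *v (root_e \<kappa> V i j *v u ?m))
      = (e_coeff i k ?m + (\<Sum>j\<in>{i<..<k}. e_coeff i j ?m * down_scalar y j k m)) *s u m"
    by (simp only: vec.scale_sum_left vec.scale_left_distrib)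
  have "(qpow \<kappa> (y i) - qpow \<kappa> (y k)) *s (down_inverse_coeff y i k *v u ?m)
      = (qpow \<kappa> (y i) - qpow \<kappa> (y k)) *s (down_scalar y i k m *s u m)"
    unfolding down_inverse_recursion[OF y i k less.prems(2)] S vec.scale_scale down_scalar.simps[of y i k m]
    using nz by simp
  thus ?case using nz unfolding vec.scale_cancel_left by blast
qed

text \<open>The exponent of weight zero.\<close>

definition level :: "nat \<Rightarrow> nat \<Rightarrow> nat" where "level l s = (if s \<in> {1..n} then l else 0)"

lemma composition_level: "N = n * l \<Longrightarrow> composition n N (level l)"
  by (auto simp: composition_def level_def)

lemma qpow_of_nat_mult: "qpow \<kappa> (of_nat d * of_nat l) = qpow \<kappa> (of_nat l) ^ d"
  by (simp add: qpow_def exp_of_nat_mult[symmetric] mult_ac)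

lemma c_qnum: "c * qnum \<kappa> x = qpow \<kappa> x - inverse (qpow \<kappa> x)"
  using q_diff_nonzero by (simp add: c_def qnum_def qpow_minus)

text \<open>In the notation of \<open>recursions_give_product\<close>, $Q=q$, $L=q^l$, $z_i=q^{y_k-y_i}$, and $a_i$, $g_i$ are
  the coefficients of $F_{12}$ and $F_{21}^{-1}$.  The monomials differ from \<open>(l, \<dots>, l)\<close> by one unit, which
  turns the coefficients of the root vectors into powers of \<open>L\<close> times $[l]$ or $[l+1]$; the latter occurs
  for the last step back to \<open>v\<^sub>k\<close>, where the exponent is \<open>l + 1\<close>.\<close>

lemma R_dyn_diagonal:
  assumes N: "N = n * l" and l: "l \<ge> 1" and y: "admissible y" and k: "k \<in> {1..n}"
  shows "coord k (R_dyn n \<kappa> y A B *v tb k (u (level l)))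
     = (\<Prod>i\<in>{1..<k}. 1 - qint \<kappa> l * qint \<kappa> (l + 1) * xi \<kappa> (y k - y i)) *s u (level l)"
proof -
  let ?m = "level l"
  have m: "composition n N ?m" by (rule composition_level[OF N])
  note sep = admissible_separated[OF y]
  define x1 where "x1 = R_hat n \<kappa> A B *v (F_up y *v tb k (u ?m))"
  define x2 where "x2 = K_op n \<kappa> A B *v x1"
  have x1: "coord i x1 = (if i = k then u ?m
     else if i < k then (ratio y i k ?m * up_coeff y i k ?m) *s u (move_unit k i ?m) else 0)"
    if "i \<in> {1..n}" for i
    unfolding x1_def by (rule coord_R_hat_F_up[OF y m k that])
  have wt: "weight_vector n V (shifted k i (mw ?m)) (coord i x1)" if i: "i \<in> {1..n}" for i
    using u_weight[of ?m] u_moved_weight[OF m i k] unfolding x1[OF i]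
    by (auto simp: shifted_same intro: weight_vector_scale weight_vector_zero)
  have sum_m: "sum (mw ?m) {1..n} / of_nat n = of_nat l"
  proof -
    have "sum (mw ?m) {1..n} = of_nat n * of_nat l" by (simp add: mw_def level_def)
    thus ?thesis using k by simp
  qed
  \<comment> \<open>On \<open>v\<^sub>i\<close> times a vector of weight \<open>\<nu>\<close>, \<open>K\<close> acts by \<open>q\<close> to the power \<open>\<nu>\<^sub>i\<close> minus the average of \<open>\<nu>\<close>.\<close>
  have x2: "coord i x2 = qpow \<kappa> (if i = k then 0 else - 1) *s coord i x1" if i: "i \<in> {1..n}" for i
  proof -
    have "shifted k i (mw ?m) i - of_nat l = (if i = k then 0 else - 1)"
      using i by (simp add: shifted_def mw_def level_def unit_weight_def)
    moreover have "coord i x2 = qpow \<kappa> (shifted k i (mw ?m) i - sum (shifted k i (mw ?m)) {1..n} / of_nat n) *s coord i x1"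
      unfolding x2_def by (rule coord_K[OF wt i])
    ultimately show ?thesis unfolding sum_shifted[OF i k] sum_m by simp
  qed
  have "R_dyn n \<kappa> y A B *v tb k (u ?m) = F_down_inverse y *v x2"
    unfolding R_dyn_def R_univ_def F_shift_lower[OF sep] F_shift_upper[OF y] F_down_matrix_inv[OF sep] x2_def x1_def
    by (simp only: matrix_vector_mul_assoc matrix_mul_assoc)
  hence "coord k (R_dyn n \<kappa> y A B *v tb k (u ?m)) = coord k x2 + (\<Sum>i\<in>{1..<k}. down_inverse_coeff y i k *v coord i x2)"
    unfolding F_down_inverse_def by (simp only: coord_lower_op[OF k])
  also have "coord k x2 = u ?m" using x2[OF k] x1[OF k] by simp
  also have "(\<Sum>i\<in>{1..<k}. down_inverse_coeff y i k *v coord i x2)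
      = (\<Sum>i\<in>{1..<k}. (exp \<kappa> * qpow \<kappa> (y k - y i) * up_coeff y i k ?m * down_scalar y i k ?m) *s u ?m)"
  proof (rule sum.cong[OF refl])
    fix i assume "i \<in> {1..<k}"
    hence i: "1 \<le> i" "i < k" "i \<in> {1..n}" "i \<noteq> k" using k by auto
    have "qpow \<kappa> (- 1) * ratio y i k ?m = exp \<kappa> * qpow \<kappa> (y k - y i)"
    proof -
      have "mw ?m k = mw ?m i" using i k by (simp add: mw_def level_def)
      hence "qpow \<kappa> (- 1) * ratio y i k ?m = qpow \<kappa> (- 1 + (2 + (y k - y i)))"
        unfolding ratio_def qpow_add[symmetric] by simp
      also have "\<dots> = qpow \<kappa> (1 + (y k - y i))" by simp
      finally show ?thesis by (simp only: qpow_add qpow_1)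
    qed
    hence "coord i x2 = (exp \<kappa> * qpow \<kappa> (y k - y i) * up_coeff y i k ?m) *s u (move_unit k i ?m)"
      using x2[OF i(3)] x1[OF i(3)] i by (simp flip: mult.assoc)
    moreover have "down_inverse_coeff y i k *v u (move_unit k i ?m) = down_scalar y i k ?m *s u ?m"
      by (rule down_inverse_on_moved[OF sep k _ i(1,2)]) (use l in \<open>simp add: level_def\<close>)
    ultimately show "down_inverse_coeff y i k *v coord i x2
        = (exp \<kappa> * qpow \<kappa> (y k - y i) * up_coeff y i k ?m * down_scalar y i k ?m) *s u ?m"
      by (simp only: vec.scale vec.scale_scale)
  qed
  also have "u ?m + (\<Sum>i\<in>{1..<k}. (exp \<kappa> * qpow \<kappa> (y k - y i) * up_coeff y i k ?m * down_scalar y i k ?m) *s u ?m)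
      = (1 + (\<Sum>i\<in>{1..<k}. exp \<kappa> * qpow \<kappa> (y k - y i) * up_coeff y i k ?m * down_scalar y i k ?m)) *s u ?m"
    by (simp only: vec.scale_left_distrib vec.scale_one vec.scale_sum_left)
  also have "1 + (\<Sum>i\<in>{1..<k}. exp \<kappa> * qpow \<kappa> (y k - y i) * up_coeff y i k ?m * down_scalar y i k ?m)
      = (\<Prod>i\<in>{1..<k}. 1 - qint \<kappa> l * qint \<kappa> (l + 1) * xi \<kappa> (y k - y i))"
  proof -
    let ?Q = "exp \<kappa>" and ?L = "qpow \<kappa> (of_nat l)"
    let ?z = "\<lambda>i. qpow \<kappa> (y k - y i)" and ?a = "\<lambda>i. up_coeff y i k ?m" and ?g = "\<lambda>i. down_scalar y i k ?m"
    have QL: "qpow \<kappa> (of_nat (l + 1)) = ?Q * ?L" by (simp add: qpow_add)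
    have cl: "c * qnum \<kappa> (of_nat l) = ?L - inverse ?L" by (rule c_qnum)
    have cl1: "c * qnum \<kappa> (of_nat (l + 1)) = ?Q * ?L - inverse (?Q * ?L)" unfolding c_qnum QL ..
    have z2: "?Q\<^sup>2 * ?z i = qpow \<kappa> (2 + (y k - y i))" for i
    proof -
      have "qpow \<kappa> 2 = ?Q\<^sup>2" using qpow_of_nat[of \<kappa> 2] by simp
      thus ?thesis by (simp only: qpow_add)
    qed
    have fc: "f_coeff i j ?m = ?L ^ (j - i - 1) * qnum \<kappa> (of_nat l)" if "i \<in> {1..<k}" "i < j" "j \<le> k" for i j
    proof -
      have "(\<Sum>s\<in>{i<..<j}. of_nat (?m s)) = (\<Sum>s\<in>{i<..<j}. of_nat l :: complex)"
        by (rule sum.cong[OF refl]) (use that k in \<open>auto simp: level_def\<close>)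
      also have "\<dots> = of_nat (j - i - 1) * of_nat l" by (simp add: card_greaterThanLessThan)
      finally have "qpow \<kappa> (\<Sum>s\<in>{i<..<j}. of_nat (?m s)) = ?L ^ (j - i - 1)" by (simp only: qpow_of_nat_mult)
      moreover have "?m i = l" using that k by (simp add: level_def)
      ultimately show ?thesis unfolding f_coeff_def by (simp only:)
    qed
    have ec: "e_coeff i j (move_unit k i ?m) = inverse ?L ^ (j - i - 1) * qnum \<kappa> (of_nat (if j = k then l + 1 else l))"
      if "i \<in> {1..<k}" "i < j" "j \<le> k" for i j
    proof -
      have "(\<Sum>s\<in>{i<..<j}. of_nat (move_unit k i ?m s)) = (\<Sum>s\<in>{i<..<j}. of_nat l :: complex)"
        by (rule sum.cong[OF refl]) (use that k in \<open>auto simp: level_def move_unit_def\<close>)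
      also have "\<dots> = of_nat (j - i - 1) * of_nat l" by (simp add: card_greaterThanLessThan)
      finally have "qpow \<kappa> (- (\<Sum>s\<in>{i<..<j}. of_nat (move_unit k i ?m s))) = inverse ?L ^ (j - i - 1)"
        by (simp only: qpow_minus qpow_of_nat_mult power_inverse)
      moreover have "move_unit k i ?m j = (if j = k then l + 1 else l)"
        using that k by (auto simp: level_def move_unit_def)
      ultimately show ?thesis unfolding e_coeff_def by (simp only:)
    qed
    have A: "(?Q\<^sup>2 * ?z i - 1) * ?a i
        = (?L - inverse ?L) * (?L ^ (k - i - 1) + (\<Sum>j\<in>{i<..<k}. ?L ^ (j - i - 1) * ?a j))"
      if i: "i \<in> {1..<k}" for i
    proof -
      have i': "i \<in> {1..n}" "i < k" using i k by auto
      have "mw ?m k = mw ?m i" using i' k by (simp add: mw_def level_def)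
      hence r: "ratio y i k ?m = ?Q\<^sup>2 * ?z i" unfolding z2 ratio_def by (simp add: algebra_simps)
      have "(?Q\<^sup>2 * ?z i - 1) * ?a i = ?Q\<^sup>2 * ?z i * ?a i - ?a i"
        by (simp only: left_diff_distrib mult_1_left)
      also have "?Q\<^sup>2 * ?z i * ?a i = ?a i + c * (f_coeff i k ?m + (\<Sum>j\<in>{i<..<k}. f_coeff i j ?m * ?a j))"
        using up_recursion[OF y m i'(1) k i'(2)] unfolding r by (rule sym)
      also have "\<dots> - ?a i = c * (f_coeff i k ?m + (\<Sum>j\<in>{i<..<k}. f_coeff i j ?m * ?a j))"
        by (rule add_diff_cancel_left')
      also have "(\<Sum>j\<in>{i<..<k}. f_coeff i j ?m * ?a j) = (\<Sum>j\<in>{i<..<k}. qnum \<kappa> (of_nat l) * (?L ^ (j - i - 1) * ?a j))"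
        by (rule sum.cong[OF refl]) (use fc[OF i] in \<open>simp add: mult_ac\<close>)
      also have "f_coeff i k ?m = ?L ^ (k - i - 1) * qnum \<kappa> (of_nat l)" using fc[OF i] i' by simp
      finally show ?thesis unfolding cl[symmetric] sum_distrib_left[symmetric] by (simp add: algebra_simps)
    qed
    have G: "(1 - ?z i) * ?g i = (?Q * ?L - inverse (?Q * ?L)) * inverse ?L ^ (k - i - 1)
        + (?L - inverse ?L) * (\<Sum>j\<in>{i<..<k}. inverse ?L ^ (j - i - 1) * ?g j)"
      if i: "i \<in> {1..<k}" for i
    proof -
      let ?S = "e_coeff i k (move_unit k i ?m) + (\<Sum>j\<in>{i<..<k}. e_coeff i j (move_unit k i ?m) * ?g j)"
      have i': "i \<in> {1..n}" "i < k" using i k by auto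
      have ne: "qpow \<kappa> (y i) - qpow \<kappa> (y k) \<noteq> 0" using sep i' k unfolding separated_def by auto
      have "1 - ?z i = (qpow \<kappa> (y i) - qpow \<kappa> (y k)) / qpow \<kappa> (y i)"
        by (simp add: qpow_diff diff_divide_distrib)
      moreover have "?g i = c * qpow \<kappa> (y i) / (qpow \<kappa> (y i) - qpow \<kappa> (y k)) * ?S"
        by (rule down_scalar.simps)
      ultimately have "(1 - ?z i) * ?g i = c * ?S" using ne by simp
      also have "(\<Sum>j\<in>{i<..<k}. e_coeff i j (move_unit k i ?m) * ?g j)
          = (\<Sum>j\<in>{i<..<k}. qnum \<kappa> (of_nat l) * (inverse ?L ^ (j - i - 1) * ?g j))"
      proof (rule sum.cong[OF refl])
        fix j assume "j \<in> {i<..<k}"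
        hence j: "i < j" "j \<le> k" "j \<noteq> k" by auto
        show "e_coeff i j (move_unit k i ?m) * ?g j = qnum \<kappa> (of_nat l) * (inverse ?L ^ (j - i - 1) * ?g j)"
          unfolding ec[OF i j(1,2)] using j(3) by (simp only: if_False mult_ac)
      qed
      also have "e_coeff i k (move_unit k i ?m) = inverse ?L ^ (k - i - 1) * qnum \<kappa> (of_nat (l + 1))"
        using ec[OF i i'(2) order_refl] by (simp only: if_True simp_thms)
      also have "c * (inverse ?L ^ (k - i - 1) * qnum \<kappa> (of_nat (l + 1))
            + (\<Sum>j\<in>{i<..<k}. qnum \<kappa> (of_nat l) * (inverse ?L ^ (j - i - 1) * ?g j)))
          = (c * qnum \<kappa> (of_nat (l + 1))) * inverse ?L ^ (k - i - 1)
            + (c * qnum \<kappa> (of_nat l)) * (\<Sum>j\<in>{i<..<k}. inverse ?L ^ (j - i - 1) * ?g j)"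
        unfolding sum_distrib_left[symmetric] by (simp only: distrib_left mult_ac)
      finally show ?thesis unfolding cl cl1 .
    qed
    have Z: "?Q\<^sup>2 * ?z i \<noteq> 1 \<and> ?z i \<noteq> 1" if i: "i \<in> {1..<k}" for i
    proof -
      have i': "i \<in> {1..n}" "i \<noteq> k" using i k by auto
      have "qpow \<kappa> (y k - y i + of_int t) \<noteq> 1" if "\<bar>t\<bar> \<le> 2 * int N + 2" for t
        by (rule y[unfolded admissible_def, rule_format, OF k i'(1)]) (use i' that in auto)
      from this[of 2] this[of 0] show ?thesis unfolding z2 by (simp add: add.commute)
    qed
    have "1 + (\<Sum>i\<in>{1..<k}. ?Q * ?z i * ?a i * ?g i)
      = (\<Prod>i\<in>{1..<k}. 1 - (?L - inverse ?L) * (?Q * ?L - inverse (?Q * ?L)) * (?Q * ?z i) / ((?z i - 1) * (?Q\<^sup>2 * ?z i - 1)))"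
      by (rule recursions_give_product) (use A G Z k in auto)
    also have "\<dots> = (\<Prod>i\<in>{1..<k}. 1 - qint \<kappa> l * qint \<kappa> (l + 1) * xi \<kappa> (y k - y i))"
    proof (rule prod.cong[OF refl])
      fix i
      have "xi \<kappa> (y k - y i) = c\<^sup>2 * (?Q * ?z i) / ((?z i - 1) * (?Q\<^sup>2 * ?z i - 1))"
        unfolding xi_def z2 c_def[symmetric] by (simp add: qpow_add add.commute mult.commute)
      hence "qint \<kappa> l * qint \<kappa> (l + 1) * xi \<kappa> (y k - y i)
          = (c * qnum \<kappa> (of_nat l)) * (c * qnum \<kappa> (of_nat (l + 1))) * (?Q * ?z i) / ((?z i - 1) * (?Q\<^sup>2 * ?z i - 1))"
        unfolding qint_eq_qnum by (simp only: times_divide_eq_right power2_eq_square mult_ac)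
      thus "1 - (?L - inverse ?L) * (?Q * ?L - inverse (?Q * ?L)) * (?Q * ?z i) / ((?z i - 1) * (?Q\<^sup>2 * ?z i - 1))
          = 1 - qint \<kappa> l * qint \<kappa> (l + 1) * xi \<kappa> (y k - y i)"
        unfolding cl cl1 by (simp only:)
    qed
    finally show ?thesis .
  qed
  finally show ?thesis .
qed

end


section \<open>Translation operators\<close>

lemma dual_move_cong:
  "(\<And>i. i \<in> {1..<n} \<Longrightarrow> \<mu> i = \<nu> i) \<Longrightarrow> dual_move n \<mu> y = dual_move n \<nu> y"
  unfolding dual_move_def by (intro ext arg_cong2[where f = "(+)"] arg_cong2[where f = "(*)"] sum.cong) simp_all

text \<open>The property which singles out the operator \<open>qshift n X\<close> in its definition.\<close>

definition qshift_property where
  "qshift_property n X D \<longleftrightarrow> (\<forall>\<psi> \<eta>. D (\<lambda>y. \<psi> y + \<eta> y) = (\<lambda>y. D \<psi> y + D \<eta> y))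
       \<and> (\<forall>v \<mu> g. (\<forall>i\<in>{1..<n}. X i *v v = \<mu> i *s v) \<longrightarrow>
             D (\<lambda>y. g y *s v) = (\<lambda>y. g (dual_move n \<mu> y) *s v))"

lemma qshift_property_sum:
  assumes D: "qshift_property n X D"
  shows "finite I \<Longrightarrow> D (\<lambda>y. \<Sum>b\<in>I. f b y) = (\<lambda>y. \<Sum>b\<in>I. D (f b) y)"
proof (induction I rule: finite_induct)
  case empty
  have "D (\<lambda>y. 0 *s 0) = (\<lambda>y. 0 *s 0)"
    using D unfolding qshift_property_def by (elim conjE allE[of _ 0] allE[of _ "\<lambda>_. 0"] impE) simp_all
  thus ?case by simp
next
  case (insert b I)
  have "D (\<lambda>y. f b y + (\<Sum>b\<in>I. f b y)) = (\<lambda>y. D (f b) y + D (\<lambda>y. \<Sum>b\<in>I. f b y) y)"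
    by (rule conjunct1[OF D[unfolded qshift_property_def], rule_format])
  thus ?case using insert by (simp add: insert.IH)
qed

text \<open>A translation operator is well defined when joint eigenvectors span: in a basis of
  eigenvectors it translates each coefficient function separately.\<close>

lemma qshift_property_qshift:
  fixes X :: "nat \<Rightarrow> complex^'m^'m"
  assumes E: "eigen_spanning {1..<n} X E"
  shows "qshift_property n X (qshift n X)"
proof -
  obtain Bs where Bs: "Bs \<subseteq> E" "finite Bs" "vec.independent Bs" "vec.span Bs = UNIV"
    using eigen_spanning_basis[OF E] by metis
  define ev where "ev b = (SOME \<nu>. b \<in> joint_eigenspace {1..<n} X \<nu>)" for b
  have ev: "b \<in> joint_eigenspace {1..<n} X (ev b)" if "b \<in> Bs" for b
    using E Bs(1) that someI_ex[of "\<lambda>\<nu>. b \<in> joint_eigenspace {1..<n} X \<nu>"]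
    unfolding ev_def eigen_spanning_def by blast
  define D where "D \<psi> y = (\<Sum>b\<in>Bs. vec.representation Bs (\<psi> (dual_move n (ev b) y)) b *s b)" for \<psi> y
  have sum_rep: "(\<Sum>b\<in>Bs. vec.representation Bs v b *s b) = v" for v
    by (rule vec.sum_representation_eq) (use Bs in auto)
  have "qshift_property n X D"
    unfolding qshift_property_def
  proof (intro conjI allI impI)
    fix \<psi> \<eta> :: "(nat \<Rightarrow> complex) \<Rightarrow> complex^'m"
    have "vec.representation Bs (v + w) b = vec.representation Bs v b + vec.representation Bs w b" for v w b
      using vec.representation_add[OF Bs(3)] Bs(4) by simp
    thus "D (\<lambda>y. \<psi> y + \<eta> y) = (\<lambda>y. D \<psi> y + D \<eta> y)"
      unfolding D_def by (simp add: vec.scale_left_distrib sum.distrib)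
  next
    fix v \<mu> and g :: "(nat \<Rightarrow> complex) \<Rightarrow> complex"
    assume "\<forall>i\<in>{1..<n}. X i *v v = \<mu> i *s v"
    hence v: "v \<in> joint_eigenspace {1..<n} X \<mu>" by (simp add: joint_eigenspace_def)
    show "D (\<lambda>y. g y *s v) = (\<lambda>y. g (dual_move n \<mu> y) *s v)"
    proof
      fix y
      have "D (\<lambda>y. g y *s v) y = (\<Sum>b\<in>Bs. g (dual_move n \<mu> y) *s (vec.representation Bs v b *s b))"
        unfolding D_def
      proof (rule sum.cong[OF refl])
        fix b assume b: "b \<in> Bs"
        have rep: "vec.representation Bs (z *s v) b = z * vec.representation Bs v b" for z
          using vec.representation_scale[OF Bs(3), of v z] Bs(4) by simp
        show "vec.representation Bs (g (dual_move n (ev b) y) *s v) b *s b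
            = g (dual_move n \<mu> y) *s (vec.representation Bs v b *s b)"
        proof (cases "vec.representation Bs v b = 0")
          case False
          have "dual_move n (ev b) y = dual_move n \<mu> y"
            by (rule dual_move_cong) (rule representation_joint_eigenvector[OF Bs(3,4,2) ev v False])
          thus ?thesis unfolding rep vec.scale_scale by simp
        qed (simp add: rep)
      qed
      also have "\<dots> = g (dual_move n \<mu> y) *s v"
        unfolding vec.scale_sum_right[symmetric] sum_rep ..
      finally show "D (\<lambda>y. g y *s v) y = g (dual_move n \<mu> y) *s v" .
    qed
  qed
  moreover have "D' = D''" if D': "qshift_property n X D'" and D'': "qshift_property n X D''" for D' D''
  proof
    fix \<psi> :: "(nat \<Rightarrow> complex) \<Rightarrow> complex^'m"
    have \<psi>: "\<psi> = (\<lambda>y. \<Sum>b\<in>Bs. vec.representation Bs (\<psi> y) b *s b)" unfolding sum_rep ..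
    have eq: "D1 \<psi> = (\<lambda>y. \<Sum>b\<in>Bs. vec.representation Bs (\<psi> (dual_move n (ev b) y)) b *s b)"
      if D1: "qshift_property n X D1" for D1
    proof -
      have "D1 \<psi> = (\<lambda>y. \<Sum>b\<in>Bs. D1 (\<lambda>y. vec.representation Bs (\<psi> y) b *s b) y)"
        by (subst \<psi>) (rule qshift_property_sum[OF D1 Bs(2)])
      moreover have "D1 (\<lambda>y. vec.representation Bs (\<psi> y) b *s b)
          = (\<lambda>y. vec.representation Bs (\<psi> (dual_move n (ev b) y)) b *s b)" if "b \<in> Bs" for b
      proof -
        have "X i *v b = ev b i *s b" if "i \<in> {1..<n}" for i
          using ev[OF \<open>b \<in> Bs\<close>] that by (simp add: joint_eigenspace_def)
        thus ?thesis by (rule conjunct2[OF D1[unfolded qshift_property_def], rule_format])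
      qed
      ultimately show ?thesis by (simp cong: sum.cong)
    qed
    show "D' \<psi> = D'' \<psi>" unfolding eq[OF D'] eq[OF D''] ..
  qed
  ultimately have "\<exists>!D. qshift_property n X D" by blast
  from theI'[OF this] show ?thesis
    unfolding qshift_def qshift_property_def .
qed

lemma qshift_sum:
  "eigen_spanning {1..<n} X E \<Longrightarrow> finite I \<Longrightarrow>
    qshift n X (\<lambda>y. \<Sum>b\<in>I. f b y) = (\<lambda>y. \<Sum>b\<in>I. qshift n X (f b) y)"
  using qshift_property_sum[OF qshift_property_qshift] .

lemma qshift_eigenvector:
  "eigen_spanning {1..<n} X E \<Longrightarrow> v \<in> joint_eigenspace {1..<n} X \<mu> \<Longrightarrow>
    qshift n X (\<lambda>y. g y *s v) = (\<lambda>y. g (dual_move n \<mu> y) *s v)"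
  using qshift_property_qshift[of n X E] unfolding qshift_property_def joint_eigenspace_def by blast

text \<open>Up to a translation of all coordinates by the same number, a weight \<open>\<nu>\<close> moves the coordinate
  \<open>y\<^sub>s\<close> by \<open>2 \<nu>\<^sub>s\<close>.\<close>

lemma dual_move_coweight:
  assumes s: "s \<in> {1..n}"
  shows "dual_move n (\<lambda>i. - coweight n \<nu> i) y s = y s + 2 * (\<nu> s - sum \<nu> {1..n} / of_nat n)"
proof -
  define \<delta> where "\<delta> t = (if t = s then 1 else 0 :: complex)" for t
  have "(\<Sum>i\<in>{1..<n}. - coweight n \<nu> i * ((if s = i + 1 then 1 else 0) - (if s = i then 1 else 0)))
      = (\<Sum>i\<in>{1..<n}. coweight n \<nu> i * (\<delta> i - \<delta> (i + 1)))"
    by (rule sum.cong[OF refl]) (auto simp: \<delta>_def)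
  also have "\<dots> = weight_form n \<delta> \<nu>" by (rule sum_coweight_differences)
  also have "\<dots> = \<nu> s - sum \<nu> {1..n} / of_nat n"
  proof -
    have "(\<Sum>t\<in>{1..n}. \<delta> t * \<nu> t) = (\<Sum>t\<in>{1..n}. if t = s then \<nu> t else 0)"
      by (rule sum.cong[OF refl]) (simp add: \<delta>_def)
    moreover have "sum \<delta> {1..n} = 1" using s by (simp add: \<delta>_def[abs_def])
    ultimately show ?thesis using s by (simp add: weight_form_def)
  qed
  finally show ?thesis unfolding dual_move_def by simp
qed

context monomial_tensor
begin

lemma qshift_tb:
  assumes a: "\<And>i k m. i \<in> {1..<n} \<Longrightarrow> k \<in> {1..n} \<Longrightarrow> X i *v tb k (u m) = ev k m i *s tb k (u m)"
  shows "eigen_spanning {1..<n} X {tb k w | k w. k \<in> {1..n} \<and> w \<in> range u}"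
    and "k \<in> {1..n} \<Longrightarrow> qshift n X (\<lambda>y. g y *s tb k (u m)) = (\<lambda>y. g (dual_move n (ev k m) y) *s tb k (u m))"
proof -
  have j: "tb k (u m) \<in> joint_eigenspace {1..<n} X (ev k m)" if "k \<in> {1..n}" for k m
    using a that by (simp add: joint_eigenspace_def)
  show E: "eigen_spanning {1..<n} X {tb k w | k w. k \<in> {1..n} \<and> w \<in> range u}"
    unfolding eigen_spanning_def using span_tb[OF u_span] j by blast
  show "k \<in> {1..n} \<Longrightarrow> qshift n X (\<lambda>y. g y *s tb k (u m)) = (\<lambda>y. g (dual_move n (ev k m) y) *s tb k (u m))"
    using qshift_eigenvector[OF E j] .
qed

lemma dual_h_tb:
  assumes "i \<in> {1..<n}" "k \<in> {1..n}"
  shows "dual_h n A i *v tb k w = coweight n (unit_weight k) i *s tb k w"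
    and "dual_h n B i *v tb k (u m) = coweight n (mw m) i *s tb k (u m)"
  by (rule dual_h_weight_vector[OF tb_weight_A[OF assms(2)] assms(1)])
    (rule dual_h_weight_vector[OF tb_weight_vector_B[OF u_weight] assms(1)])

text \<open>The weight of $v_k\otimes u_m$ for the outer translation, in which $H_2$ occurs with a factor $1/2$.\<close>

definition outer_weight :: "nat \<Rightarrow> (nat \<Rightarrow> nat) \<Rightarrow> nat \<Rightarrow> complex"
  where "outer_weight k m s = unit_weight k s + mw m s / 2"

lemma coweight_outer: "coweight n (outer_weight k m) i = coweight n (unit_weight k) i + coweight n (mw m) i / 2"
  unfolding coweight_def outer_weight_def sum.distrib sum_divide_distrib[symmetric]
  by (simp add: add_divide_distrib diff_divide_distrib distrib_left)

lemma outer_shift_tb: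
  assumes "i \<in> {1..<n}" "k \<in> {1..n}"
  shows "- (dual_h n A i + (1 / 2) *\<^sub>M dual_h n B i) *v tb k (u m)
     = - coweight n (outer_weight k m) i *s tb k (u m)"
  unfolding uminus_mult_vec matrix_vector_mult_add_rdistrib mscale_mult_vec dual_h_tb[OF assms] coweight_outer
  by (simp add: vec_eq_iff algebra_simps)

lemma inner_shift_tb:
  assumes "i \<in> {1..<n}" "k \<in> {1..n}"
  shows "(1 / 2) *\<^sub>M dual_h n B i *v tb k (u m) = coweight n (\<lambda>s. mw m s / 2) i *s tb k (u m)"
proof -
  have "coweight n (\<lambda>s. mw m s / 2) i = coweight n (mw m) i / 2"
    unfolding coweight_def sum_divide_distrib[symmetric] by (simp add: diff_divide_distrib)
  thus ?thesis unfolding mscale_mult_vec dual_h_tb(2)[OF assms] by (simp add: vec_eq_iff)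
qed

lemma weight_vector_level: "coweight n (mw (level l)) i = 0" if "i \<in> {1..n}"
proof -
  have "sum (mw (level l)) {1..i} = (\<Sum>s\<in>{1..i}. of_nat l)"
    by (rule sum.cong[OF refl]) (use that in \<open>auto simp: mw_def level_def\<close>)
  moreover have "sum (mw (level l)) {1..n} = (\<Sum>s\<in>{1..n}. of_nat l)"
    by (rule sum.cong[OF refl]) (auto simp: mw_def level_def)
  ultimately show ?thesis using that by (simp add: coweight_def)
qed

text \<open>An exponent of weight zero is constant, and its degree determines the constant.\<close>

lemma zero_weight_space:
  assumes N: "N = n * l" and w: "w \<in> weight_space n V (\<lambda>_. 0)"
  shows "\<exists>b. w = b *s u (level l)"
proof -
  have "\<exists>\<mu>. x \<in> joint_eigenspace {1..<n} (gen_h V) \<mu>" if "x \<in> range u" for x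
    using that u_weight unfolding weight_vector_def weight_space_eq by blast
  hence E: "eigen_spanning {1..<n} (gen_h V) (range u)"
    unfolding eigen_spanning_def using u_span by blast
  let ?Z = "joint_eigenspace {1..<n} (gen_h V) (\<lambda>_. 0)"
  let ?T = "range (\<lambda>b. b *s u (level l))"
  have "range u \<inter> ?Z \<subseteq> ?T"
  proof
    fix x assume x: "x \<in> range u \<inter> ?Z"
    then obtain m where m: "x = u m" by blast
    show "x \<in> ?T"
    proof (cases "x = 0")
      case True
      thus ?thesis by (intro range_eqI[of _ _ 0]) simp
    next
      case False
      have "composition n N m" using False m u_zero by metis
      moreover have "mw m i - mw m (i + 1) = mw (level l) i - mw (level l) (i + 1)" if i: "i \<in> {1..<n}" for i
      proof -
        have "x \<in> joint_eigenspace {1..<n} (gen_h V) (\<lambda>i. mw m i - mw m (i + 1))"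
          using u_weight[of m] unfolding m weight_vector_def weight_space_eq .
        hence "mw m i - mw m (i + 1) = 0"
          using joint_eigenvalue_unique[OF False, of "{1..<n}" "gen_h V" "\<lambda>i. mw m i - mw m (i + 1)" "\<lambda>_. 0" i] x i
          by blast
        moreover have "mw (level l) i = mw (level l) (i + 1)" using i by (simp add: mw_def level_def)
        ultimately show ?thesis by simp
      qed
      ultimately have "m = level l"
        using composition_determined[OF _ composition_level[OF N]] by blast
      thus ?thesis unfolding m by (intro range_eqI[of _ _ 1]) simp
    qed
  qed
  moreover have "vec.subspace ?T"
  proof (rule vec.subspaceI)
    show "0 \<in> ?T" by (intro range_eqI[of _ _ 0]) simp
    show "x + z \<in> ?T" if xz: "x \<in> ?T" "z \<in> ?T" for x z
    proof -
      obtain b b' where "x = b *s u (level l)" "z = b' *s u (level l)" using xz by blast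
      hence "x + z = (b + b') *s u (level l)" by (simp only: vec.scale_left_distrib)
      thus ?thesis by blast
    qed
    show "b *s x \<in> ?T" if x: "x \<in> ?T" for b x
    proof -
      obtain b' where "x = b' *s u (level l)" using x by blast
      hence "b *s x = (b * b') *s u (level l)" by (simp only: vec.scale_scale)
      thus ?thesis by blast
    qed
  qed
  ultimately have "vec.span (range u \<inter> ?Z) \<subseteq> ?T" by (rule vec.span_minimal)
  thus ?thesis using joint_eigenspace_subset_span[OF E, of "\<lambda>_. 0"] w unfolding weight_space_eq by blast
qed

text \<open>The differences of coordinates change by $2\delta_{ik}-2\delta_{jk}+m_i-m_j$, which is at most
  \<open>N + 2\<close> in absolute value; hence the bound \<open>3 N + 4 = (2 N + 2) + (N + 2)\<close>.\<close>

lemma admissible_moved: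
  assumes y: "generic_point n \<kappa> {- (3 * int N + 4)..3 * int N + 4} y"
    and k: "k \<in> {1..n}" and m: "composition n N m"
  shows "admissible (dual_move n (\<lambda>i. - coweight n (outer_weight k m) i) y)"
  unfolding admissible_def
proof (intro ballI allI impI)
  fix i j and t :: int
  assume i: "i \<in> {1..n}" and j: "j \<in> {1..n}" and t: "i \<noteq> j \<and> \<bar>t\<bar> \<le> 2 * int N + 2"
  let ?y = "dual_move n (\<lambda>i. - coweight n (outer_weight k m) i) y"
  let ?d = "2 * (if i = k then 1 else 0) - 2 * (if j = k then 1 else 0) + int (m i) - int (m j) + t"
  have "?y i - ?y j = y i - y j + 2 * (outer_weight k m i - outer_weight k m j)"
    unfolding dual_move_coweight[OF i] dual_move_coweight[OF j] by (simp add: algebra_simps)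
  also have "\<dots> = y i - y j + of_int (2 * (if i = k then 1 else 0) - 2 * (if j = k then 1 else 0) + int (m i) - int (m j))"
    by (simp add: outer_weight_def unit_weight_def mw_def)
  finally have "?y i - ?y j + of_int t = y i - y j + of_int ?d" by simp
  moreover have "?d \<in> {- (3 * int N + 4)..3 * int N + 4}"
    using composition_le[OF m i] composition_le[OF m j] t by auto
  hence "qpow \<kappa> (y i - y j + of_int ?d) \<noteq> 1"
    using y i j t unfolding generic_point_def by blast
  ultimately show "qpow \<kappa> (?y i - ?y j + of_int t) \<noteq> 1" by metis
qed

text \<open>The operator translates the coefficient of $v_k\otimes u_m$ in \<open>\<Phi>\<close> to a point depending on \<open>m\<close>, so
  \<open>\<Phi>\<close> has to be known at all these points; but since its component along \<open>v\<^sub>k\<close> has weight zero there, only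
  the translation belonging to \<open>(l, \<dots>, l)\<close> contributes.\<close>

lemma coord_outer_shift:
  assumes N: "N = n * l" and k: "k \<in> {1..n}"
    and \<Phi>: "\<And>m. composition n N m \<Longrightarrow> let z = dual_move n (\<lambda>i. - coweight n (outer_weight k m) i) y
              in coord k (\<Phi> z) = h z *s u (level l)"
  shows "coord k (qshift n (\<lambda>i. - (dual_h n A i + (1 / 2) *\<^sub>M dual_h n B i)) \<Phi> y)
     = h (dual_move n (\<lambda>i. - coweight n (outer_weight k (level l)) i) y) *s u (level l)"
proof -
  let ?X = "\<lambda>i. - (dual_h n A i + (1 / 2) *\<^sub>M dual_h n B i)"
  let ?move = "\<lambda>k m. dual_move n (\<lambda>i. - coweight n (outer_weight k m) i) y"
  have E: "eigen_spanning {1..<n} ?X {tb k w | k w. k \<in> {1..n} \<and> w \<in> range u}"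
    by (rule qshift_tb(1)[where ev = "\<lambda>k m i. - coweight n (outer_weight k m) i"]) (rule outer_shift_tb)
  have ev: "qshift n ?X (\<lambda>y. g y *s tb k (u m)) y = g (?move k m) *s tb k (u m)" if "k \<in> {1..n}" for g k m
    by (rule fun_cong[OF qshift_tb(2)[where ev = "\<lambda>k m i. - coweight n (outer_weight k m) i"], OF outer_shift_tb that])
  have "\<exists>\<mu>. x \<in> joint_eigenspace {1..<n} (gen_h V) \<mu>" if "x \<in> range u" for x
    using that u_weight unfolding weight_vector_def weight_space_eq by blast
  hence EV: "eigen_spanning {1..<n} (gen_h V) (range u)"
    unfolding eigen_spanning_def using u_span by blast
  obtain Bs where Bs: "Bs \<subseteq> range u" "finite Bs" "vec.independent Bs" "vec.span Bs = UNIV" "0 \<notin> Bs"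
    using eigen_spanning_basis[OF EV] by metis
  define ex where "ex b = (SOME m. b = u m)" for b
  have ex: "b = u (ex b)" if "b \<in> Bs" for b
  proof -
    have "\<exists>m. b = u m" using Bs(1) that by blast
    thus ?thesis unfolding ex_def by (rule someI_ex)
  qed
  have ex_comp: "composition n N (ex b)" if "b \<in> Bs" for b
    using ex[OF that] u_zero[of "ex b"] Bs(5) that by metis
  let ?r = "vec.representation Bs"
  have sum_rep: "(\<Sum>b\<in>Bs. ?r v b *s b) = v" for v
    by (rule vec.sum_representation_eq) (use Bs in auto)
  define f where "f ib z = ?r (coord (fst ib) (\<Phi> z)) (snd ib) *s tb (fst ib) (u (ex (snd ib)))" for ib z
  have "\<Phi> z = (\<Sum>ib\<in>{1..n} \<times> Bs. f ib z)" for z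
  proof -
    have "\<Phi> z = (\<Sum>i\<in>{1..n}. tb i (\<Sum>b\<in>Bs. ?r (coord i (\<Phi> z)) b *s b))"
      unfolding sum_rep by (rule tb_expansion)
    also have "\<dots> = (\<Sum>i\<in>{1..n}. \<Sum>b\<in>Bs. f (i, b) z)"
      unfolding f_def tb_sum tb_scale fst_conv snd_conv using ex by (intro sum.cong[OF refl]) simp
    finally show ?thesis by (simp add: sum.cartesian_product)
  qed
  hence "\<Phi> = (\<lambda>z. \<Sum>ib\<in>{1..n} \<times> Bs. f ib z)" by (rule ext)
  hence "qshift n ?X \<Phi> y = (\<Sum>ib\<in>{1..n} \<times> Bs. qshift n ?X (f ib) y)"
    using fun_cong[OF qshift_sum[OF E, of "{1..n} \<times> Bs" f], of y] Bs(2) by simp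
  also have "\<dots> = (\<Sum>i\<in>{1..n}. \<Sum>b\<in>Bs. qshift n ?X (f (i, b)) y)"
    by (simp add: sum.cartesian_product)
  also have "\<dots> = (\<Sum>i\<in>{1..n}. \<Sum>b\<in>Bs. ?r (coord i (\<Phi> (?move i (ex b)))) b *s tb i (u (ex b)))"
    unfolding f_def fst_conv snd_conv using ev by (intro sum.cong[OF refl]) simp
  finally have expansion: "qshift n ?X \<Phi> y
      = (\<Sum>i\<in>{1..n}. \<Sum>b\<in>Bs. ?r (coord i (\<Phi> (?move i (ex b)))) b *s tb i (u (ex b)))" .
  have "coord k (qshift n ?X \<Phi> y)
      = (\<Sum>i\<in>{1..n}. if i = k then \<Sum>b\<in>Bs. ?r (coord k (\<Phi> (?move k (ex b)))) b *s u (ex b) else 0)"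
    unfolding expansion coord_sum coord_scale
  proof (rule sum.cong[OF refl])
    fix i assume i: "i \<in> {1..n}"
    show "(\<Sum>b\<in>Bs. ?r (coord i (\<Phi> (?move i (ex b)))) b *s coord k (tb i (u (ex b))))
        = (if i = k then \<Sum>b\<in>Bs. ?r (coord k (\<Phi> (?move k (ex b)))) b *s u (ex b) else 0)"
      unfolding coord_tb[OF k i] by (cases "i = k") simp_all
  qed
  also have "\<dots> = (\<Sum>b\<in>Bs. ?r (coord k (\<Phi> (?move k (ex b)))) b *s u (ex b))" using k by simp
  also have "\<dots> = (\<Sum>b\<in>Bs. h (?move k (level l)) *s (?r (u (level l)) b *s b))"
  proof (rule sum.cong[OF refl])
    fix b assume b: "b \<in> Bs"
    have "coord k (\<Phi> (?move k (ex b))) = h (?move k (ex b)) *s u (level l)"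
      using \<Phi>[OF ex_comp[OF b]] by (simp add: Let_def)
    hence r: "?r (coord k (\<Phi> (?move k (ex b)))) b = h (?move k (ex b)) * ?r (u (level l)) b"
      using vec.representation_scale[OF Bs(3), of "u (level l)"] Bs(4) by simp
    show "?r (coord k (\<Phi> (?move k (ex b)))) b *s u (ex b) = h (?move k (level l)) *s (?r (u (level l)) b *s b)"
    proof (cases "?r (u (level l)) b = 0")
      case False
      have lv: "u (level l) \<in> joint_eigenspace {1..<n} (gen_h V) (\<lambda>i. mw (level l) i - mw (level l) (i + 1))"
        using u_weight[of "level l"] unfolding weight_vector_def weight_space_eq .
      have bv: "b' \<in> joint_eigenspace {1..<n} (gen_h V) (\<lambda>i. mw (ex b') i - mw (ex b') (i + 1))" if "b' \<in> Bs" for b'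
        using u_weight[of "ex b'"] ex[OF that] unfolding weight_vector_def weight_space_eq by simp
      have "mw (ex b) i - mw (ex b) (i + 1) = mw (level l) i - mw (level l) (i + 1)" if "i \<in> {1..<n}" for i
        using representation_joint_eigenvector[OF Bs(3,4,2) bv lv False that] .
      hence "ex b = level l" by (rule composition_determined[OF ex_comp[OF b] composition_level[OF N]])
      thus ?thesis unfolding r using ex[OF b] by simp
    qed (simp add: r)
  qed
  also have "\<dots> = h (?move k (level l)) *s u (level l)"
    unfolding vec.scale_sum_right[symmetric] sum_rep ..
  finally show ?thesis .
qed

lemma coord_L_general:
  assumes N: "N = n * l" and l: "l \<ge> 1" and k: "k \<in> {1..n}"
    and y: "generic_point n \<kappa> {- (3 * int N + 4)..3 * int N + 4} y"
    and \<psi>: "\<And>z. \<psi> z = b z *s u (level l)"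
  shows "coord k (L_general n \<kappa> A B (\<lambda>z. tb k (\<psi> z)) y)
     = (let z = dual_move n (\<lambda>i. - coweight n (outer_weight k (level l)) i) y
        in (\<Prod>i\<in>{1..<k}. 1 - qint \<kappa> l * qint \<kappa> (l + 1) * xi \<kappa> (z k - z i)) *s \<psi> z)"
proof -
  let ?u = "u (level l)"
  have "qshift n (\<lambda>i. (1 / 2) *\<^sub>M dual_h n B i) (\<lambda>z. b z *s tb k ?u)
      = (\<lambda>z. b (dual_move n (coweight n (\<lambda>s. mw (level l) s / 2)) z) *s tb k ?u)"
    by (rule qshift_tb(2)[OF inner_shift_tb k])
  moreover have "dual_move n (coweight n (\<lambda>s. mw (level l) s / 2)) z = z" for z
  proof -
    have "coweight n (\<lambda>s. mw (level l) s / 2) i = 0" if "i \<in> {1..<n}" for i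
    proof -
      have "coweight n (\<lambda>s. mw (level l) s / 2) i = coweight n (mw (level l)) i / 2"
        unfolding coweight_def sum_divide_distrib[symmetric] by (simp add: diff_divide_distrib)
      thus ?thesis using weight_vector_level[of i l] that by simp
    qed
    hence "dual_move n (coweight n (\<lambda>s. mw (level l) s / 2)) z = dual_move n (\<lambda>_. 0) z"
      by (rule dual_move_cong)
    also have "\<dots> = z" by (rule ext) (simp add: dual_move_def)
    finally show ?thesis .
  qed
  ultimately have inner: "qshift n (\<lambda>i. (1 / 2) *\<^sub>M dual_h n B i) (\<lambda>z. tb k (\<psi> z)) = (\<lambda>z. b z *s tb k ?u)"
    unfolding \<psi> tb_scale by simp
  define h where "h z = b z * (\<Prod>i\<in>{1..<k}. 1 - qint \<kappa> l * qint \<kappa> (l + 1) * xi \<kappa> (z k - z i))" for z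
  have "coord k (L_general n \<kappa> A B (\<lambda>z. tb k (\<psi> z)) y)
      = h (dual_move n (\<lambda>i. - coweight n (outer_weight k (level l)) i) y) *s ?u"
    unfolding L_general_def inner
  proof (rule coord_outer_shift[OF N k])
    fix m assume m: "composition n N m"
    let ?z = "dual_move n (\<lambda>i. - coweight n (outer_weight k m) i) y"
    have "coord k (R_dyn n \<kappa> ?z A B *v (b ?z *s tb k ?u)) = h ?z *s ?u"
      unfolding vec.scale coord_scale R_dyn_diagonal[OF N l admissible_moved[OF y k m] k] h_def by simp
    thus "let z = ?z in coord k (R_dyn n \<kappa> z A B *v (b z *s tb k ?u)) = h z *s ?u"
      unfolding Let_def .
  qed
  thus ?thesis unfolding Let_def \<psi> h_def by (simp add: mult.commute)
qed

end


section \<open>The Hamiltonian\<close>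

theorem lemma2:
  fixes q \<kappa> :: complex and n l :: nat and V :: "('d::finite) action"
  assumes q: "exp \<kappa> = q" and not_root_of_unity: "\<And>m::nat. m > 0 \<Longrightarrow> q ^ m \<noteq> 1"
    and n: "n = CARD('n::{finite,linorder})" "n \<ge> 2" and l: "l \<ge> 1"
    and V: "uq_rep n \<kappa> V" "irreducible_rep n V"
      "highest_weight_rep n V (\<lambda>i. if i = 1 then of_nat (n * l) else 0)"
  shows "\<exists>M. finite M \<and>
    (\<forall>\<psi> y. function_of_differences n \<psi> \<and> (\<forall>z. \<psi> z \<in> weight_space n V (\<lambda>_. 0)) \<and>
            generic_point n \<kappa> M y \<longrightarrow>
       I1 TYPE('n) \<kappa> V \<psi> y =
         (\<Sum>i = 1..n. transl i
            (\<lambda>z. (\<Prod>k\<in>{1..<i}. 1 - qint \<kappa> l * qint \<kappa> (l + 1) * xi \<kappa> (z i - z k)) *s \<psi> z) y))"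
proof -
  let ?N = "n * l"
  obtain v where v: "v \<noteq> 0" "v \<in> weight_space n V (\<lambda>i. if i = 1 then of_nat ?N else 0)"
      "\<forall>i\<in>{1..<n}. gen_e V i *v v = 0"
      "\<forall>W. invariant_subspace n V W \<and> v \<in> W \<longrightarrow> W = UNIV"
    using V(3) unfolding highest_weight_rep_def by blast
  have root: "exp \<kappa> ^ m \<noteq> 1" if "m > 0" for m
    using not_root_of_unity[OF that] unfolding q .
  have "highest_weight_vector \<kappa> n ?N V v"
    by unfold_locales (rule root n(2) V(1) V(2) v(1) v(2) bspec[OF v(3)] v(4)[rule_format]; simp)+
  from highest_weight_vector.monomial_action_exists[OF this]
  obtain u where u: "monomial_action \<kappa> n ?N V u" by blast
  interpret T: monomial_tensor \<kappa> n V "TYPE('n)" ?N u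
    by unfold_locales (rule root n(1) u uq_rep_graded[OF V(1)]; assumption?)+
  let ?M = "{- (3 * int ?N + 4)..3 * int ?N + 4}"
  have "I1 TYPE('n) \<kappa> V \<psi> y = (\<Sum>i = 1..n. transl i
            (\<lambda>z. (\<Prod>k\<in>{1..<i}. 1 - qint \<kappa> l * qint \<kappa> (l + 1) * xi \<kappa> (z i - z k)) *s \<psi> z) y)"
    if diff: "function_of_differences n \<psi>" and zero: "\<forall>z. \<psi> z \<in> weight_space n V (\<lambda>_. 0)"
      and y: "generic_point n \<kappa> ?M y" for \<psi> y
  proof -
    have "\<forall>z. \<exists>b. \<psi> z = b *s u (T.level l)" using T.zero_weight_space[OF refl] zero by blast
    then obtain b where b: "\<And>z. \<psi> z = b z *s u (T.level l)" by metis
    have "I1 TYPE('n) \<kappa> V \<psi> y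
        = (\<Sum>i\<in>{1..n}. T.coord i (L_general n \<kappa> (first_leg matrix_rep) (second_leg V) (\<lambda>z. T.tb i (\<psi> z)) y))"
      unfolding I1_def L_op_def T.sum_pos T.coord_def T.tb_def n(1)[symmetric] ..
    also have "\<dots> = (\<Sum>i = 1..n. transl i
            (\<lambda>z. (\<Prod>k\<in>{1..<i}. 1 - qint \<kappa> l * qint \<kappa> (l + 1) * xi \<kappa> (z i - z k)) *s \<psi> z) y)"
    proof (rule sum.cong[OF refl])
      fix i assume i: "i \<in> {1..n}"
      let ?z = "dual_move n (\<lambda>j. - coweight n (T.outer_weight i (T.level l)) j) y"
      let ?y = "y(i := y i + 2)"
      \<comment> \<open>The two points differ by a common translation of the coordinates, invisible to functions of differences.\<close>
      have move: "?z s - ?z t = ?y s - ?y t" if s: "s \<in> {1..n}" and t: "t \<in> {1..n}" for s t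
      proof -
        have "?z s - ?z t = y s - y t + 2 * (T.outer_weight i (T.level l) s - T.outer_weight i (T.level l) t)"
          unfolding dual_move_coweight[OF s] dual_move_coweight[OF t] by (simp add: algebra_simps)
        thus ?thesis using s t
          by (simp add: T.outer_weight_def T.mw_def T.level_def T.unit_weight_def)
      qed
      have \<psi>: "\<psi> ?z = \<psi> ?y"
        using diff move unfolding function_of_differences_def by blast
      have "T.coord i (L_general n \<kappa> (first_leg matrix_rep) (second_leg V) (\<lambda>z. T.tb i (\<psi> z)) y)
          = (\<Prod>k\<in>{1..<i}. 1 - qint \<kappa> l * qint \<kappa> (l + 1) * xi \<kappa> (?z i - ?z k)) *s \<psi> ?z"
        using T.coord_L_general[OF refl l i y b] unfolding Let_def .
      also have "(\<Prod>k\<in>{1..<i}. 1 - qint \<kappa> l * qint \<kappa> (l + 1) * xi \<kappa> (?z i - ?z k))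
          = (\<Prod>k\<in>{1..<i}. 1 - qint \<kappa> l * qint \<kappa> (l + 1) * xi \<kappa> (?y i - ?y k))"
      proof (rule prod.cong[OF refl])
        fix k assume "k \<in> {1..<i}"
        hence "k \<in> {1..n}" using i by auto
        show "1 - qint \<kappa> l * qint \<kappa> (l + 1) * xi \<kappa> (?z i - ?z k)
            = 1 - qint \<kappa> l * qint \<kappa> (l + 1) * xi \<kappa> (?y i - ?y k)"
          unfolding move[OF i \<open>k \<in> {1..n}\<close>] ..
      qed
      finally show "T.coord i (L_general n \<kappa> (first_leg matrix_rep) (second_leg V) (\<lambda>z. T.tb i (\<psi> z)) y)
          = transl i (\<lambda>z. (\<Prod>k\<in>{1..<i}. 1 - qint \<kappa> l * qint \<kappa> (l + 1) * xi \<kappa> (z i - z k)) *s \<psi> z) y"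
        unfolding transl_def \<psi> .
    qed
    finally show ?thesis .
  qed
  thus ?thesis by (intro exI[of _ ?M] conjI) (simp, blast)
qed

end
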